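(* Let $p,q\ge 1$ be integers. The subgroup $U(p)\times U(q)$ and the non-isotropic dilations generate the full automorphism group $\mathrm{Aut}(D_{p,q})$. Furthermore, every element of $\mathrm{Aut}(D_{p,q})$ can be written in the form $$U_{p+1}M_pU_p\cdots M_1U_1,$$ where $U_1,\dots,U_{p+1}$ are automorphisms of $D_{p,q}$ fixing (i.e. mapping onto itself) the subspace $\{[z]\in D_{p,q}:[z]=[z_1,\dots,z_p,0,\dots,0]\}$ and $M_1,\dots,M_p$ are non-isotropic dilations of $D_{p,q}$.
   Context: $H_{p,q}=\begin{pmatrix}I_p&0\\0&-I_q\end{pmatrix}$ and $\cdot^H$ is the Hermitian (conjugate) transpose. The generalized ball is $D_{p,q}=\{[z]\in\mathbb P^{p+q-1}: z^HH_{p,q}z>0\}$. $\mathrm{Aut}(D_{p,q})$ is the group of biholomorphic automorphisms of $D_{p,q}$. It is known that every automorphism of $D_{p,q}$ has the form $[z]\mapsto[Az]$ with $A\in U(p,q)=\{A\in GL(p+q,\mathbb C):A^HH_{p,q}A=H_{p,q}\}$, so that $\mathrm{Aut}(D_{p,q})\cong PU(p,q)$; matrices in $U(p,q)$ are identified with the automorphisms they induce. $U(p)\times U(q)$ is regarded as the subgroup of block diagonal matrices in $U(p,q)$. A non-isotropic dilation of $D_{p,q}$ is an automorphism induced by a matrix in $U(p,q)$ of the following form: for some $j\in\{1,\dots,p\}$ and real $a,b\ge0$ with $a^2-b^2=1$, the matrix has $(j,j)$ entry $a$, $(j,p+q)$ entry $-b$, $(p+q,j)$ entry $b$, $(p+q,p+q)$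 entry $-a$, all other diagonal entries equal to $1$, and all remaining entries equal to $0$. *)

theory Defs
  imports "HOL-Analysis.Analysis" "HOL-Algebra.Bij" "HOL-Algebra.Generated_Groups"
begin

text \<open>
  The point [z] of projective space, for nonzero z, is represented by the complex line through 0 and z,
  regarded as a set of vectors.
\<close>

definition proj_point :: "complex^'n \<Rightarrow> (complex^'n) set" where
  "proj_point z = range (\<lambda>c. c *s z)"

text \<open>
  The standard affine charts. The coordinate space of the i-th chart is the affine hyperplane
  of all w with w $ i = 1, so that [z] has the coordinates z $ k / z $ i for k different from i,
  and the inverse of the chart is w \<mapsto> [w].
\<close>

definition affine_patch :: "'n \<Rightarrow> (complex^'n) set set" where
  "affine_patch i = {proj_point z | z. z $ i \<noteq> 0}"

definition affine_chart :: "'n \<Rightarrow> (complex^'n) set \<Rightarrow> complex^'n" where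
  "affine_chart i L = (THE w. w \<in> L \<and> w $ i = 1)"

text \<open>
  Holomorphy in several variables, as complex Frechet differentiability: multiplication by a
  complex matrix makes the derivative complex linear.
\<close>

definition complex_differentiable_within ::
    "(complex^'m \<Rightarrow> complex^'n) \<Rightarrow> complex^'m \<Rightarrow> (complex^'m) set \<Rightarrow> bool" where
  "complex_differentiable_within F w S \<longleftrightarrow>
     (\<exists>A :: complex^'m^'n. (F has_derivative (\<lambda>h. A *v h)) (at w within S))"

text \<open>
  Every point x of D lies in a chart domain, and f x lies in a chart domain, such that a whole
  neighbourhood of x in its chart is contained in D and mapped into the chart domain of f x,
  and such that the coordinate expression of f is holomorphic there. (Hence only open sets D
  carry holomorphic maps, and holomorphic maps are continuous.)
\<close>

definition proj_holomorphic_on ::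
    "((complex^'m) set \<Rightarrow> (complex^'n) set) \<Rightarrow> (complex^'m) set set \<Rightarrow> bool" where
  "proj_holomorphic_on f D \<longleftrightarrow>
     (\<forall>x\<in>D. \<exists>i j W. x \<in> affine_patch i \<and> f x \<in> affine_patch j \<and>
        open W \<and> affine_chart i x \<in> W \<and>
        (\<forall>w\<in>W. w $ i = 1 \<longrightarrow>
           proj_point w \<in> D \<and> f (proj_point w) \<in> affine_patch j \<and>
           complex_differentiable_within (\<lambda>v. affine_chart j (f (proj_point v))) w
             {v. v $ i = 1}))"

text \<open>As in BijGroup, automorphisms are extensional functions, undefined outside D.\<close>

definition biholomorphic_auts ::
    "(complex^'n) set set \<Rightarrow> ((complex^'n) set \<Rightarrow> (complex^'n) set) set" where
  "biholomorphic_auts D =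
     {f \<in> Bij D. proj_holomorphic_on f D \<and> proj_holomorphic_on (restrict (inv_into D f) D) D}"

definition Aut_group ::
    "(complex^'n) set set \<Rightarrow> ((complex^'n) set \<Rightarrow> (complex^'n) set) monoid" where
  "Aut_group D = (BijGroup D) \<lparr>carrier := biholomorphic_auts D\<rparr>"

definition induced_map ::
    "(complex^'n) set set \<Rightarrow> complex^'n^'n \<Rightarrow> (complex^'n) set \<Rightarrow> (complex^'n) set" where
  "induced_map D A = (\<lambda>L\<in>D. (\<lambda>z. A *v z) ` L)"

text \<open>
  The integers p and q are the cardinalities of two finite (nonempty) index types 'p and 'q;
  the coordinates 1, ..., p are indexed by Inl and p+1, ..., p+q by Inr.
\<close>

definition hermitian_transpose :: "complex^'n^'m \<Rightarrow> complex^'m^'n" where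
  "hermitian_transpose A = (\<chi> i j. cnj (A $ j $ i))"

definition Hpq :: "complex^('p::finite + 'q::finite)^('p + 'q)" where
  "Hpq = (\<chi> i j. if i = j then (case i of Inl _ \<Rightarrow> 1 | Inr _ \<Rightarrow> -1) else 0)"

text \<open>The sum is real, since Hpq is Hermitian.\<close>

definition herm_form :: "complex^('p::finite + 'q::finite) \<Rightarrow> real" where
  "herm_form z = Re (\<Sum>i\<in>UNIV. cnj (z $ i) * (Hpq *v z) $ i)"

definition Dpq :: "(complex^('p::finite + 'q::finite)) set set" where
  "Dpq = {proj_point z | z. z \<noteq> 0 \<and> herm_form z > 0}"

definition unitary_group :: "(complex^'n^'n) set" where
  "unitary_group = {A. hermitian_transpose A ** A = mat 1}"

definition U_pq :: "(complex^('p::finite + 'q::finite)^('p + 'q)) set" where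
  "U_pq = {A. invertible A \<and> hermitian_transpose A ** Hpq ** A = Hpq}"

definition block_diag ::
    "complex^'p^'p \<Rightarrow> complex^'q^'q \<Rightarrow> complex^('p::finite + 'q::finite)^('p + 'q)" where
  "block_diag B C = (\<chi> r c. case (r, c) of
       (Inl i, Inl j) \<Rightarrow> B $ i $ j
     | (Inr i, Inr j) \<Rightarrow> C $ i $ j
     | _ \<Rightarrow> 0)"

definition UpxUq_auts ::
    "((complex^('p::finite + 'q::finite)) set \<Rightarrow> (complex^('p + 'q)) set) set" where
  "UpxUq_auts = {induced_map Dpq (block_diag B C) | B C.
                   B \<in> unitary_group \<and> C \<in> unitary_group}"

text \<open>
  The index l of type 'q plays the role of the last coordinate p + q, as index types carry no
  order.
\<close>

definition dilation_matrix ::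
    "'q \<Rightarrow> 'p \<Rightarrow> real \<Rightarrow> real \<Rightarrow> complex^('p::finite + 'q::finite)^('p + 'q)" where
  "dilation_matrix l j a b = (\<chi> r c.
     if r = Inl j \<and> c = Inl j then of_real a
     else if r = Inl j \<and> c = Inr l then - of_real b
     else if r = Inr l \<and> c = Inl j then of_real b
     else if r = Inr l \<and> c = Inr l then - of_real a
     else if r = c then 1 else 0)"

definition dilations ::
    "'q \<Rightarrow> ((complex^('p::finite + 'q::finite)) set \<Rightarrow> (complex^('p + 'q)) set) set" where
  "dilations l = {induced_map Dpq A | A.
     A \<in> U_pq \<and> (\<exists>j a b. a \<ge> 0 \<and> b \<ge> 0 \<and> a\<^sup>2 - b\<^sup>2 = 1 \<and> A = dilation_matrix l j a b)}"

definition p_subspace :: "(complex^('p::finite + 'q::finite)) set set" where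
  "p_subspace = {proj_point z | z. proj_point z \<in> Dpq \<and> (\<forall>k. z $ Inr k = 0)}"

definition subspace_auts ::
    "((complex^('p::finite + 'q::finite)) set \<Rightarrow> (complex^('p + 'q)) set) set" where
  "subspace_auts = {f \<in> carrier (Aut_group Dpq). f ` p_subspace = p_subspace}"

text \<open>alternating_word G U M n is the product U (n+1) * M n * U n * ... * M 1 * U 1 in G.\<close>

primrec alternating_word ::
    "('a, 'b) monoid_scheme \<Rightarrow> (nat \<Rightarrow> 'a) \<Rightarrow> (nat \<Rightarrow> 'a) \<Rightarrow> nat \<Rightarrow> 'a" where
  "alternating_word G U M 0 = U 1"
| "alternating_word G U M (Suc n) =
     U (n + 2) \<otimes>\<^bsub>G\<^esub> (M (n + 1) \<otimes>\<^bsub>G\<^esub> alternating_word G U M n)"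

end

theory Submission
  imports Defs "HOL-Complex_Analysis.Conformal_Mappings"
begin

text \<open>
  The main point is that every automorphism f, with inverse h, of D_{p,q} is linear. For p at least 2,
  take a projective line L in D_{p,q}, a linear form u vanishing on L, and Y homogeneous coordinates of a
  point of f(L). A constant vector field c in the target has the homogeneous lift Y_k c; its image
  under the derivative of h, taken normal to L by means of u, is the value at a point of L of a
  holomorphic section of O(1), because L has normal bundle O(1) + ... + O(1). Hence this function is
  affine in an affine parameter t of L. As its values for varying k are proportional to the vector Y,
  f maps L to a line projectively. Comparing the first-order expansions of f at two points x and y, for
  which the lines xw and yw lie in D_{p,q}, shows that f is linear for w in an open set; linearity
  spreads along lines to all of D_{p,q}. For p = 1 the domain is a ball and the Schwarz lemma in one
  variable suffices. A linear map that preserves D_{p,q} preserves the null cone of the Hermitian form,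
  hence the form up to a positive factor.

  The factorisation is a column reduction: an element of U(p) x U(q) followed by one dilation (an
  involution) moves the image of the j-th basis vector back to that vector without disturbing the
  basis vectors treated before.
\<close>

section \<open>Projective points and Hermitian forms\<close>

text \<open>A line L contained in D_{p,q} is compact, so sections of a line bundle over it form a
  finite-dimensional space and the boundary behaviour of f never enters. The obstacle is that f(L)
  is not known to be a line, so f restricted to L comes with no bundle of known degree. This is why
  vector fields are transported backwards by h: the linear field z \<mapsto> z_k c makes sense on
  the whole target, and its image lives over the known line L, in the known normal bundle. The image
  is Y_k times a factor that depends on the point but not on k; the sections for all k together are
  therefore homogeneous coordinates of f along L, of degree one. They could vanish for a bad c, so c
  is taken to be the image of a normal vector u under the derivative of a lift of f at one point.
  The vector u is a negative basis vector made orthogonal to L, which keeps \<open>herm u u\<close>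
  nonzero. For p = 1 the method has nothing to start from: a positive definite subspace of dimension
  two does not exist, so the ball contains no projective line.\<close>

lemma mem_proj_point: "w \<in> proj_point z \<longleftrightarrow> (\<exists>c. w = c *s z)"
  by (auto simp: proj_point_def)

lemma proj_point_self: "z \<in> proj_point z"
  unfolding mem_proj_point by (rule exI[of _ 1]) simp

lemma proj_point_scale: "c \<noteq> 0 \<Longrightarrow> proj_point (c *s z) = proj_point z" for c :: complex
  unfolding set_eq_iff mem_proj_point
  by (metis (no_types, lifting) vector_smult_assoc nonzero_eq_divide_eq)

lemma proj_point_eq_iff:
  assumes "z \<noteq> 0"
  shows "proj_point w = proj_point z \<longleftrightarrow> (\<exists>c. c \<noteq> 0 \<and> w = c *s z)"
proof
  assume eq: "proj_point w = proj_point z"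
  obtain c where "w = c *s z"
    using proj_point_self[of w] eq mem_proj_point by blast
  moreover have "c \<noteq> 0"
  proof
    assume "c = 0"
    then have "w = 0" using \<open>w = c *s z\<close> by simp
    then have "z \<in> proj_point (0 :: complex^'a)"
      using proj_point_self[of z] eq by simp
    then show False using assms by (auto simp: mem_proj_point)
  qed
  ultimately show "\<exists>c. c \<noteq> 0 \<and> w = c *s z" by blast
qed (auto simp: proj_point_scale)

lemma proj_point_mem_eq: "w \<in> proj_point z \<Longrightarrow> w \<noteq> 0 \<Longrightarrow> proj_point w = proj_point z"
  by (metis mem_proj_point proj_point_scale vector_smult_lzero)

text \<open>Proportionality as vanishing of the 2x2 minors: an identity without the unknown factor,
  which can therefore be differentiated along a curve.\<close>

lemma proj_point_eq_minor:
  assumes "proj_point z = proj_point w"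
  shows "z $ i * w $ j = z $ j * w $ i"
  using proj_point_self[of z] assms by (auto simp: mem_proj_point)

lemma affine_chart_proj_point:
  assumes "z $ i \<noteq> 0"
  shows "affine_chart i (proj_point z) = (1 / z $ i) *s z"
  unfolding affine_chart_def
proof (rule the_equality)
  show "(1 / z $ i) *s z \<in> proj_point z \<and> ((1 / z $ i) *s z) $ i = 1"
    using assms by (auto simp: mem_proj_point)
next
  fix w assume w: "w \<in> proj_point z \<and> w $ i = 1"
  then obtain c where c: "w = c *s z" unfolding mem_proj_point by blast
  then have "c * z $ i = 1" using w by simp
  then show "w = (1 / z $ i) *s z" using assms c by (simp add: field_simps)
qed

lemma proj_point_in_affine_patch: "proj_point z \<in> affine_patch i \<longleftrightarrow> z $ i \<noteq> 0"
proof
  assume "proj_point z \<in> affine_patch i"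
  then obtain w where w: "proj_point z = proj_point w" "w $ i \<noteq> 0" by (auto simp: affine_patch_def)
  then have "w \<in> proj_point z" using proj_point_self[of w] by simp
  then obtain c where "w = c *s z" unfolding mem_proj_point by blast
  then show "z $ i \<noteq> 0" using w(2) by auto
qed (auto simp: affine_patch_def)

section \<open>The standard Hermitian product on C^n\<close>

definition cprod :: "complex^'n \<Rightarrow> complex^'n \<Rightarrow> complex" where
  "cprod x y = (\<Sum>i\<in>UNIV. cnj (x $ i) * y $ i)"

lemma cprod_add_right: "cprod x (y + z) = cprod x y + cprod x z"
  by (simp add: cprod_def algebra_simps sum.distrib)

lemma cprod_add_left: "cprod (x + y) z = cprod x z + cprod y z"
  by (simp add: cprod_def algebra_simps sum.distrib)

lemma cprod_diff_right: "cprod x (y - z) = cprod x y - cprod x z"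
  by (simp add: cprod_def algebra_simps sum_subtractf)

lemma cprod_diff_left: "cprod (x - y) z = cprod x z - cprod y z"
  by (simp add: cprod_def algebra_simps sum_subtractf)

lemma cprod_scale_right: "cprod x (c *s y) = c * cprod x y"
  by (simp add: cprod_def sum_distrib_left algebra_simps)

lemma cprod_scale_left: "cprod (c *s x) y = cnj c * cprod x y"
  by (simp add: cprod_def sum_distrib_left algebra_simps)

lemma cprod_commute: "cprod y x = cnj (cprod x y)"
  by (simp add: cprod_def mult.commute)

lemma cprod_self: "cprod x x = of_real ((norm x)\<^sup>2)"
proof -
  have "(norm x)\<^sup>2 = (\<Sum>i\<in>UNIV. (cmod (x $ i))\<^sup>2)"
    by (simp add: norm_vec_def L2_set_def sum_nonneg)
  moreover have "cprod x x = (\<Sum>i\<in>UNIV. of_real ((cmod (x $ i))\<^sup>2))"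
    unfolding cprod_def by (rule sum.cong[OF refl], subst mult.commute, rule complex_norm_square[symmetric])
  ultimately show ?thesis by simp
qed

lemma cprod_axis_left: "cprod (axis i 1) y = y $ i"
proof -
  have "cprod (axis i 1) y = (\<Sum>k\<in>UNIV. if k = i then y $ k else 0)"
    unfolding cprod_def by (rule sum.cong) (auto simp: axis_def)
  then show ?thesis by simp
qed

lemma cprod_adjoint: "cprod (A *v x) y = cprod x (hermitian_transpose A *v y)"
proof -
  have "cprod (A *v x) y = (\<Sum>i\<in>UNIV. \<Sum>j\<in>UNIV. cnj (A $ i $ j) * cnj (x $ j) * y $ i)"
    by (simp add: cprod_def matrix_vector_mult_def sum_distrib_right)
  also have "\<dots> = (\<Sum>j\<in>UNIV. \<Sum>i\<in>UNIV. cnj (A $ i $ j) * cnj (x $ j) * y $ i)"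
    by (rule sum.swap)
  also have "\<dots> = cprod x (hermitian_transpose A *v y)"
    by (simp add: cprod_def matrix_vector_mult_def hermitian_transpose_def sum_distrib_left mult_ac)
  finally show ?thesis .
qed

lemma matrix_eqI_cprod:
  fixes M N :: "complex^'n^'n"
  assumes "\<And>x y. cprod x (M *v y) = cprod x (N *v y)"
  shows "M = N"
proof -
  have "M *v y = N *v y" for y
    using assms[of "axis i 1" y for i] by (simp add: vec_eq_iff cprod_axis_left)
  then show ?thesis by (simp add: matrix_eq)
qed

lemma norm_vec_smult: "norm (a *s u) = cmod a * norm u" for u :: "complex^'n"
proof -
  have "complex_of_real ((norm (a *s u))\<^sup>2) = cnj a * (a * cprod u u)"
    unfolding cprod_self[symmetric] cprod_scale_left cprod_scale_right by (rule mult.left_commute)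
  also have "\<dots> = (a * cnj a) * of_real ((norm u)\<^sup>2)"
    by (simp only: cprod_self mult_ac)
  also have "\<dots> = of_real ((cmod a * norm u)\<^sup>2)"
    by (simp only: complex_norm_square[symmetric] of_real_mult[symmetric] power_mult_distrib)
  finally have "(norm (a *s u))\<^sup>2 = (cmod a * norm u)\<^sup>2" using of_real_eq_iff by blast
  then show ?thesis by (simp add: power2_eq_iff_nonneg)
qed

text \<open>The part of y orthogonal to a unit vector u has squared norm |y|^2 - |<u, y>|^2. That
  this is nonnegative is the inequality; that it is zero is the equality case, which later gives
  rigidity in the Schwarz lemma.\<close>

lemma
  fixes x y :: "complex^'n"
  shows cprod_Cauchy_Schwarz: "(cmod (cprod x y))\<^sup>2 \<le> (norm x)\<^sup>2 * (norm y)\<^sup>2"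
  and cprod_Cauchy_Schwarz_eq:
    "norm x = 1 \<Longrightarrow> (cmod (cprod x y))\<^sup>2 = (norm y)\<^sup>2 \<Longrightarrow> y = cprod x y *s x"
proof -
  have main: "(norm (y - cprod u y *s u))\<^sup>2 = (norm y)\<^sup>2 - (cmod (cprod u y))\<^sup>2"
    if "norm u = 1" for u :: "complex^'n"
  proof -
    have "complex_of_real ((norm (y - cprod u y *s u))\<^sup>2) = cprod y y - cprod u y * cprod y u"
    proof -
      have "cprod u u = 1" using that by (simp add: cprod_self)
      then show ?thesis
        unfolding cprod_self[symmetric]
        by (simp add: cprod_diff_left cprod_diff_right cprod_scale_left cprod_scale_right
            cprod_commute[of y u])
    qed
    also have "\<dots> = of_real ((norm y)\<^sup>2 - (cmod (cprod u y))\<^sup>2)"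
      unfolding of_real_diff complex_norm_square cprod_commute[of y u] cprod_self[of y] by simp
    finally show ?thesis using of_real_eq_iff by blast
  qed
  show "norm x = 1 \<Longrightarrow> (cmod (cprod x y))\<^sup>2 = (norm y)\<^sup>2 \<Longrightarrow> y = cprod x y *s x"
    using main[of x] by simp
  show "(cmod (cprod x y))\<^sup>2 \<le> (norm x)\<^sup>2 * (norm y)\<^sup>2"
  proof (cases "x = 0")
    case True then show ?thesis by (simp add: cprod_def)
  next
    case False
    define u where "u = of_real (1 / norm x) *s x"
    have "norm u = 1" using False by (simp add: u_def norm_vec_smult norm_divide)
    then have "(norm (y - cprod u y *s u))\<^sup>2 = (norm y)\<^sup>2 - (cmod (cprod u y))\<^sup>2" by (rule main)
    then have "(cmod (cprod u y))\<^sup>2 \<le> (norm y)\<^sup>2"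
      using zero_le_power2[of "norm (y - cprod u y *s u)"] by linarith
    moreover have "cmod (cprod u y) = cmod (cprod x y) / norm x"
      by (simp add: u_def cprod_scale_left norm_divide)
    ultimately show ?thesis using False by (simp add: power_divide field_simps)
  qed
qed

text \<open>Source of the continuity and product rules for scaling a vector by a complex
  number.\<close>

lemma bounded_bilinear_vec_smult:
  "bounded_bilinear ((*s) :: complex \<Rightarrow> complex^'n \<Rightarrow> complex^'n)"
proof
  fix a b :: complex and u v :: "complex^'n" and r :: real
  show "(a + b) *s u = a *s u + b *s u" by (simp add: vector_sadd_rdistrib)
  show "a *s (u + v) = a *s u + a *s v" by (simp add: vector_add_ldistrib)
  show "(r *\<^sub>R a) *s u = r *\<^sub>R (a *s u)" by (simp add: vec_eq_iff)
  show "a *s (r *\<^sub>R u) = r *\<^sub>R (a *s u)" by (simp add: vec_eq_iff)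
  show "\<exists>K. \<forall>(a::complex) (b::complex^'n). norm (a *s b) \<le> norm a * norm b * K"
    by (rule exI[of _ 1]) (simp add: norm_vec_smult)
qed

lemmas continuous_on_vec_smult [continuous_intros] =
  bounded_bilinear.continuous_on[OF bounded_bilinear_vec_smult]
lemmas has_derivative_vec_smult = bounded_bilinear.FDERIV[OF bounded_bilinear_vec_smult]

section \<open>The indefinite Hermitian form, polarised so as to be conjugate linear in the first
  argument\<close>

definition herm :: "complex^('p::finite + 'q::finite) \<Rightarrow> complex^('p + 'q) \<Rightarrow> complex" where
  "herm x y = cprod x (Hpq *v y)"

lemma Hpq_mult_nth: "(Hpq *v y) $ i = (case i of Inl _ \<Rightarrow> y $ i | Inr _ \<Rightarrow> - y $ i)"
  by (cases i) (simp_all add: matrix_vector_mult_def Hpq_def mult_delta_left)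

lemma sum_UNIV_Plus:
  "(\<Sum>i\<in>(UNIV :: ('p::finite + 'q::finite) set). g i) = (\<Sum>i\<in>UNIV. g (Inl i)) + (\<Sum>i\<in>UNIV. g (Inr i))"
  using sum.Plus[of "UNIV :: 'p set" "UNIV :: 'q set" g] by (simp add: comp_def)

lemma herm_expand:
  "herm x y = (\<Sum>i\<in>UNIV. cnj (x $ Inl i) * y $ Inl i) - (\<Sum>i\<in>UNIV. cnj (x $ Inr i) * y $ Inr i)"
  by (simp add: herm_def cprod_def sum_UNIV_Plus Hpq_mult_nth sum_negf)

lemma herm_form_eq: "herm_form z = Re (herm z z)"
  by (simp add: herm_form_def herm_def cprod_def)

lemma herm_form_expand:
  "herm_form z = (\<Sum>i\<in>UNIV. (cmod (z $ Inl i))\<^sup>2) - (\<Sum>i\<in>UNIV. (cmod (z $ Inr i))\<^sup>2)"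
  by (simp add: herm_form_eq herm_expand cmod_power2) (simp add: power2_eq_square)

lemma herm_add_right: "herm x (y + z) = herm x y + herm x z"
  by (simp add: herm_def matrix_vector_right_distrib cprod_add_right)
lemma herm_add_left: "herm (x + y) z = herm x z + herm y z"
  by (simp add: herm_def cprod_add_left)
lemma herm_scale_right: "herm x (c *s y) = c * herm x y"
  by (simp add: herm_def vector_scalar_commute cprod_scale_right)
lemma herm_scale_left: "herm (c *s x) y = cnj c * herm x y"
  by (simp add: herm_def cprod_scale_left)
lemma herm_diff_right: "herm x (y - z) = herm x y - herm x z"
  by (simp add: herm_def matrix_vector_mult_diff_distrib cprod_diff_right)
lemma herm_diff_left: "herm (x - y) z = herm x z - herm y z"
  by (simp add: herm_def cprod_diff_left)
lemma herm_commute: "herm y x = cnj (herm x y)"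
  by (simp add: herm_expand mult.commute)
lemma herm_self: "herm z z = of_real (herm_form z)"
  by (metis herm_commute herm_form_eq complex_is_Real_iff Reals_cnj_iff of_real_Re)
lemma herm_zero [simp]: "herm x 0 = 0" "herm 0 x = 0"
  by (simp_all add: herm_expand)
lemmas herm_simps = herm_add_right herm_add_left herm_scale_right herm_scale_left
  herm_diff_right herm_diff_left

lemma herm_form_scale: "herm_form (c *s z) = (cmod c)\<^sup>2 * herm_form z"
  by (simp add: herm_form_expand norm_mult power_mult_distrib sum_distrib_left right_diff_distrib)

lemma herm_form_zero [simp]: "herm_form 0 = 0" by (simp add: herm_form_expand)

lemma continuous_on_herm_form [continuous_intros]:
  "continuous_on S g \<Longrightarrow> continuous_on S (\<lambda>x. herm_form (g x))"
  unfolding herm_form_expand by (intro continuous_intros)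

lemma bounded_linear_herm: "bounded_linear (herm a)"
proof -
  have "bounded_linear (\<lambda>y. \<Sum>i\<in>UNIV. cnj (a $ i) * (Hpq *v y) $ i)"
    by (intro bounded_linear_sum bounded_linear_const_mult
        bounded_linear_compose[OF bounded_linear_vec_nth matrix_vector_mul_bounded_linear])
  then show ?thesis by (simp add: herm_def[abs_def] cprod_def)
qed

lemma continuous_on_herm [continuous_intros]:
  "continuous_on S g \<Longrightarrow> continuous_on S h \<Longrightarrow> continuous_on S (\<lambda>x. herm (g x) (h x))"
  unfolding herm_expand by (intro continuous_intros)

lemma proj_point_in_Dpq: "proj_point z \<in> Dpq \<longleftrightarrow> herm_form z > 0"
proof
  assume "proj_point z \<in> Dpq"
  then obtain w where w: "proj_point z = proj_point w" "w \<noteq> 0" "herm_form w > 0" by (auto simp: Dpq_def)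
  then obtain c where "z = c *s w" "c \<noteq> 0" using proj_point_eq_iff[of w z] by auto
  then show "herm_form z > 0" using w by (simp add: herm_form_scale)
next
  assume "herm_form z > 0"
  moreover then have "z \<noteq> 0" by auto
  ultimately show "proj_point z \<in> Dpq" by (auto simp: Dpq_def)
qed

lemma Dpq_cases:
  assumes "L \<in> Dpq"
  obtains z where "L = proj_point z" "herm_form z > 0" "z \<noteq> 0"
  using assms by (auto simp: Dpq_def)

section \<open>The group U(p,q)\<close>

lemma Hpq_involution: "Hpq ** Hpq = (mat 1 :: complex^('p::finite + 'q::finite)^('p + 'q))"
  by (auto simp: matrix_eq matrix_vector_mul_assoc[symmetric] vec_eq_iff Hpq_mult_nth split: sum.splits)

text \<open>Since H^2 = 1, the relation A^H H A = H makes H A^H H a left inverse of A. Preservation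
  of the form thus already contains invertibility.\<close>

lemma U_pq_iff: "A \<in> U_pq \<longleftrightarrow> (\<forall>x y. herm (A *v x) (A *v y) = herm x y)"
proof
  assume "A \<in> U_pq"
  then show "\<forall>x y. herm (A *v x) (A *v y) = herm x y"
    by (simp add: U_pq_def herm_def cprod_adjoint matrix_vector_mul_assoc matrix_mul_assoc)
next
  assume h: "\<forall>x y. herm (A *v x) (A *v y) = herm x y"
  have eq: "hermitian_transpose A ** Hpq ** A = Hpq"
    by (rule matrix_eqI_cprod)
      (use h in \<open>simp add: herm_def cprod_adjoint matrix_vector_mul_assoc matrix_mul_assoc\<close>)
  have "(Hpq ** hermitian_transpose A ** Hpq) ** A = Hpq ** (hermitian_transpose A ** Hpq ** A)"
    by (simp add: matrix_mul_assoc)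
  also have "\<dots> = mat 1" by (simp add: eq Hpq_involution)
  finally have "(Hpq ** hermitian_transpose A ** Hpq) ** A = mat 1" .
  then have "invertible A" using invertible_left_inverse by blast
  then show "A \<in> U_pq" using eq by (simp add: U_pq_def)
qed

lemma U_pq_mult: "A \<in> U_pq \<Longrightarrow> B \<in> U_pq \<Longrightarrow> A ** B \<in> U_pq"
  by (simp add: U_pq_iff matrix_vector_mul_assoc[symmetric])

lemma U_pq_one: "mat 1 \<in> U_pq"
  by (simp add: U_pq_iff)

lemma U_pq_inverse:
  assumes "A \<in> U_pq"
  obtains B where "B \<in> U_pq" "A ** B = mat 1" "B ** A = mat 1"
proof -
  obtain B where B: "A ** B = mat 1" "B ** A = mat 1"
    using assms by (auto simp: U_pq_def invertible_def)
  have "herm (B *v x) (B *v y) = herm x y" for x y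
  proof -
    have "herm (B *v x) (B *v y) = herm (A *v (B *v x)) (A *v (B *v y))"
      using assms by (simp add: U_pq_iff)
    then show ?thesis by (simp add: matrix_vector_mul_assoc B)
  qed
  then have "B \<in> U_pq" by (simp add: U_pq_iff)
  then show ?thesis using that B by blast
qed

lemma U_pq_herm_form: "A \<in> U_pq \<Longrightarrow> herm_form (A *v z) = herm_form z"
  by (simp add: herm_form_eq U_pq_iff)

lemma image_proj_point: "(\<lambda>z. A *v z) ` proj_point z = proj_point (A *v z)" for A :: "complex^'n^'m"
  unfolding proj_point_def image_image by (simp add: vector_scalar_commute)

lemma induced_map_proj_point:
  "herm_form z > 0 \<Longrightarrow> induced_map Dpq A (proj_point z) = proj_point (A *v z)"
  by (simp add: induced_map_def proj_point_in_Dpq image_proj_point)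

section \<open>Induced automorphisms and local lifts\<close>

text \<open>Differentiability in homogeneous coordinates, at a point of an open subset of C^(p+q);
  derivatives of chart expressions are only taken within an affine hyperplane.\<close>

definition cdiff :: "(complex^'m \<Rightarrow> complex^'n) \<Rightarrow> complex^'m \<Rightarrow> bool" where
  "cdiff F z \<longleftrightarrow> (\<exists>A :: complex^'m^'n. (F has_derivative (\<lambda>h. A *v h)) (at z))"

definition cderiv :: "(complex \<Rightarrow> complex^'n) \<Rightarrow> complex^'n \<Rightarrow> complex \<Rightarrow> bool" where
  "cderiv \<gamma> v t \<longleftrightarrow> (\<gamma> has_derivative (\<lambda>d. d *s v)) (at t)"

lemma complex_linear_matrix:
  fixes D :: "complex^'m \<Rightarrow> complex^'n"
  assumes "\<And>x y. D (x + y) = D x + D y" "\<And>c x. D (c *s x) = c *s D x"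
  obtains T :: "complex^'m^'n" where "\<And>x. T *v x = D x"
proof -
  have "Vector_Spaces.linear (*s) (*s) D"
    using assms by unfold_locales (auto simp: vector_add_ldistrib vector_sadd_rdistrib)
  then show ?thesis using that matrix_works by blast
qed

lemma complex_differentiable_withinI:
  fixes F :: "complex^'m \<Rightarrow> complex^'n"
  assumes F: "(F has_derivative D) (at w within S)" and D: "\<And>c h. D (c *s h) = c *s D h"
  shows "complex_differentiable_within F w S"
proof -
  have "D (x + y) = D x + D y" for x y
    using F by (simp add: has_derivative_def bounded_linear.linear linear_add)
  then obtain A where "\<And>h. A *v h = D h" using complex_linear_matrix[of D] D by blast
  then have "D = (\<lambda>h. A *v h)" by auto
  then show ?thesis unfolding complex_differentiable_within_def using F by metis
qed

lemma bounded_linear_matrix_nth: "bounded_linear (\<lambda>v. (A *v v) $ j)" for A :: "complex^'m^'n"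
  by (rule bounded_linear_compose[OF bounded_linear_vec_nth matrix_vector_mul_bounded_linear])

text \<open>Dividing by the j-th coordinate is the affine chart applied to a lift, and the quotient
  rule keeps the derivative complex linear. Applied to the identity it also covers the projection
  onto a chart hyperplane.\<close>

lemma complex_differentiable_within_normalize:
  assumes F: "cdiff F w" and j: "F w $ j \<noteq> 0"
  shows "complex_differentiable_within (\<lambda>v. (1 / F v $ j) *s F v) w S"
proof -
  obtain A where "(F has_derivative (*v) A) (at w)" using F by (auto simp: cdiff_def)
  then have A: "(F has_derivative (*v) A) (at w within S)" by (rule has_derivative_at_withinI)
  show ?thesis
  proof (rule complex_differentiable_withinI)
    have "((\<lambda>v. inverse (F v $ j)) has_derivative
        (\<lambda>h. - (inverse (F w $ j) * (A *v h) $ j * inverse (F w $ j)))) (at w within S)"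
      by (rule Deriv.has_derivative_inverse[OF j bounded_linear.has_derivative[OF bounded_linear_vec_nth A]])
    then show "((\<lambda>v. (1 / F v $ j) *s F v) has_derivative
       (\<lambda>h. inverse (F w $ j) *s (A *v h)
          + (- (inverse (F w $ j) * (A *v h) $ j * inverse (F w $ j))) *s F w))
       (at w within S)"
      unfolding inverse_eq_divide[symmetric] by (rule has_derivative_vec_smult[OF _ A])
  next
    fix c h
    show "inverse (F w $ j) *s (A *v (c *s h))
          + (- (inverse (F w $ j) * (A *v (c *s h)) $ j * inverse (F w $ j))) *s F w
       = c *s (inverse (F w $ j) *s (A *v h)
          + (- (inverse (F w $ j) * (A *v h) $ j * inverse (F w $ j))) *s F w)"
      by (simp add: vector_scalar_commute vec_eq_iff algebra_simps)
  qed
qed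

lemma cdiff_matrix: "cdiff ((*v) A) z" for A :: "complex^'m^'n"
  unfolding cdiff_def by (intro exI[of _ A] bounded_linear_imp_has_derivative matrix_vector_mul_bounded_linear)

lemma cdiff_imp_isCont: "cdiff F z \<Longrightarrow> isCont F z"
  unfolding cdiff_def by (metis has_derivative_continuous)

lemma cdiff_imp_continuous_on:
  "(\<And>z. z \<in> S \<Longrightarrow> cdiff F z) \<Longrightarrow> continuous_on S F"
  by (intro continuous_at_imp_continuous_on ballI cdiff_imp_isCont)

lemma cdiff_compose:
  assumes "cdiff F z" "cdiff G (F z)"
  shows "cdiff (\<lambda>z. G (F z)) z"
proof -
  obtain A B where "(F has_derivative (*v) A) (at z)" "(G has_derivative (*v) B) (at (F z))"
    using assms by (auto simp: cdiff_def)
  then have "((G \<circ> F) has_derivative ((*v) B \<circ> (*v) A)) (at z)" by (rule diff_chain_at)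
  moreover have "(*v) B \<circ> (*v) A = (*v) (B ** A)"
    by (rule ext) (simp only: comp_def matrix_vector_mul_assoc)
  ultimately show ?thesis by (auto simp: cdiff_def comp_def)
qed

lemma open_herm_form_pos: "open {w. herm_form w > 0}"
  by (intro open_Collect_less continuous_intros)

lemma open_nth_neq: "open {w :: complex^'m. (A *v w) $ j \<noteq> 0}" for A :: "complex^'m^'n"
  by (intro open_Collect_neq continuous_intros linear_continuous_on bounded_linear_matrix_nth)

text \<open>A nonvanishing differentiable lift F on an open subset of C^(p+q) yields the chart
  expression (1 / F_j) F, so holomorphy of a new map can be checked in homogeneous
  coordinates.\<close>

lemma proj_holomorphic_on_DpqI:
  assumes "\<And>z0. herm_form z0 > 0 \<Longrightarrow> \<exists>F \<Omega>. open \<Omega> \<and> z0 \<in> \<Omega> \<and> F z0 \<noteq> 0 \<and>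
    (\<forall>z\<in>\<Omega>. herm_form z > 0 \<and> f (proj_point z) = proj_point (F z) \<and> cdiff F z)"
  shows "proj_holomorphic_on f Dpq"
  unfolding proj_holomorphic_on_def
proof
  fix L :: "(complex^('a + 'b)) set" assume "L \<in> Dpq"
  then obtain z1 where z1: "L = proj_point z1" "herm_form z1 > 0" "z1 \<noteq> 0" by (rule Dpq_cases)
  then obtain i where i: "z1 $ i \<noteq> 0" by (auto simp: vec_eq_iff)
  \<comment> \<open>With i-th coordinate 1, z is its own image under the chart, so W can be taken as
    an open set around z itself.\<close>
  define z where "z = (1 / z1 $ i) *s z1"
  have z: "L = proj_point z" "herm_form z > 0" "z $ i = 1"
    using z1 i by (simp_all add: z_def proj_point_scale herm_form_scale)
  obtain F \<Omega> where \<Omega>: "open \<Omega>" "z \<in> \<Omega>" "F z \<noteq> 0" "\<And>w. w \<in> \<Omega> \<Longrightarrow> herm_form w > 0"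
    "\<And>w. w \<in> \<Omega> \<Longrightarrow> f (proj_point w) = proj_point (F w)" "\<And>w. w \<in> \<Omega> \<Longrightarrow> cdiff F w"
    using assms[OF z(2)] by blast
  obtain j where j: "F z $ j \<noteq> 0" using \<Omega>(3) by (auto simp: vec_eq_iff)
  define W where "W = \<Omega> \<inter> (\<lambda>w. F w $ j) -` (- {0})"
  have W: "open W"
    unfolding W_def
    by (intro continuous_open_preimage continuous_intros cdiff_imp_continuous_on \<Omega>) auto
  show "\<exists>i j W. L \<in> affine_patch i \<and> f L \<in> affine_patch j \<and> open W \<and> affine_chart i L \<in> W \<and>
      (\<forall>w\<in>W. w $ i = 1 \<longrightarrow> proj_point w \<in> Dpq \<and> f (proj_point w) \<in> affine_patch j \<and>
         complex_differentiable_within (\<lambda>v. affine_chart j (f (proj_point v))) w {v. v $ i = 1})"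
  proof (rule exI[of _ i], rule exI[of _ j], rule exI[of _ W], intro conjI ballI impI)
    show "L \<in> affine_patch i" using z by (simp add: proj_point_in_affine_patch)
    show "f L \<in> affine_patch j"
      using z \<Omega>(2,5) j by (simp add: proj_point_in_affine_patch)
    show "open W" by (rule W)
    show "affine_chart i L \<in> W"
      using z \<Omega>(2) j by (simp add: W_def affine_chart_proj_point)
    fix w assume w: "w \<in> W" and w1: "w $ i = 1"
    show "proj_point w \<in> Dpq" using w \<Omega>(4) by (simp add: W_def proj_point_in_Dpq)
    show "f (proj_point w) \<in> affine_patch j"
      using w \<Omega>(5) by (simp add: W_def proj_point_in_affine_patch)
    have eq: "affine_chart j (f (proj_point v)) = (1 / F v $ j) *s F v" if "v \<in> W" for v
      using that \<Omega>(5) by (simp add: W_def affine_chart_proj_point)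
    have "complex_differentiable_within (\<lambda>v. (1 / F v $ j) *s F v) w {v. v $ i = 1}"
      using w \<Omega>(6) by (intro complex_differentiable_within_normalize) (simp_all add: W_def)
    then obtain B where B: "((\<lambda>v. (1 / F v $ j) *s F v) has_derivative (*v) B)
        (at w within {v. v $ i = 1})"
      by (auto simp: complex_differentiable_within_def)
    obtain d where d: "d > 0" "ball w d \<subseteq> W" using W w openE by blast
    have "((\<lambda>v. affine_chart j (f (proj_point v))) has_derivative (*v) B) (at w within {v. v $ i = 1})"
    proof (rule has_derivative_transform_within[OF B d(1)])
      show "w \<in> {v. v $ i = 1}" using w1 by simp
      fix v assume "v \<in> {v. v $ i = 1}" "dist v w < d"
      then have "v \<in> W" using d(2) by (auto simp: dist_commute)
      then show "(1 / F v $ j) *s F v = affine_chart j (f (proj_point v))" using eq by simp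
    qed
    then show "complex_differentiable_within
        (\<lambda>v. affine_chart j (f (proj_point v))) w {v. v $ i = 1}"
      by (auto simp: complex_differentiable_within_def)
  qed
qed

section \<open>Automorphisms induced by U(p,q)\<close>

lemma proj_holomorphic_on_induced_map:
  assumes "A \<in> U_pq"
  shows "proj_holomorphic_on (induced_map Dpq A) Dpq"
proof (rule proj_holomorphic_on_DpqI)
  fix z0 :: "complex^('a + 'b)" assume "herm_form z0 > 0"
  moreover then have "herm_form (A *v z0) > 0" using assms by (simp add: U_pq_herm_form)
  then have "A *v z0 \<noteq> 0" by auto
  ultimately show "\<exists>F \<Omega>. open \<Omega> \<and> z0 \<in> \<Omega> \<and> F z0 \<noteq> 0 \<and>
      (\<forall>z\<in>\<Omega>. herm_form z > 0 \<and> induced_map Dpq A (proj_point z) = proj_point (F z) \<and> cdiff F z)"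
    using open_herm_form_pos
    by (intro exI[of _ "(*v) A"] exI[of _ "{z. herm_form z > 0}"])
      (simp add: induced_map_proj_point cdiff_matrix)
qed

lemma induced_map_in_Dpq: "A \<in> U_pq \<Longrightarrow> L \<in> Dpq \<Longrightarrow> induced_map Dpq A L \<in> Dpq"
  by (erule Dpq_cases) (simp add: induced_map_proj_point proj_point_in_Dpq U_pq_herm_form)

lemma induced_map_compose:
  "B \<in> U_pq \<Longrightarrow> L \<in> Dpq \<Longrightarrow> induced_map Dpq A (induced_map Dpq B L) = induced_map Dpq (A ** B) L"
  by (erule Dpq_cases) (simp add: induced_map_proj_point U_pq_herm_form matrix_vector_mul_assoc)

lemma induced_map_one: "L \<in> Dpq \<Longrightarrow> induced_map Dpq (mat 1) L = L"
  by (erule Dpq_cases) (simp add: induced_map_proj_point)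

lemma induced_map_bij:
  assumes "A ** B = mat 1" "B ** A = mat 1" "A \<in> U_pq" "B \<in> U_pq"
  shows "bij_betw (induced_map Dpq A) Dpq Dpq"
    and "restrict (inv_into Dpq (induced_map Dpq A)) Dpq = induced_map Dpq B"
proof -
  have "bij_betw (induced_map Dpq A :: (complex^('a + 'b)) set \<Rightarrow> _) Dpq Dpq"
    by (rule bij_betwI[where g = "induced_map Dpq B"])
      (use assms in \<open>simp_all only: induced_map_in_Dpq induced_map_compose induced_map_one Pi_iff\<close>, simp_all add: induced_map_in_Dpq)
  then show bij: "bij_betw (induced_map Dpq A) Dpq Dpq" .
  show "restrict (inv_into Dpq (induced_map Dpq A)) Dpq = induced_map Dpq B"
  proof
    fix L
    show "restrict (inv_into Dpq (induced_map Dpq A)) Dpq L = induced_map Dpq B L"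
    proof (cases "L \<in> Dpq")
      case True
      have "inv_into Dpq (induced_map Dpq A) L = induced_map Dpq B L"
        using bij True assms
        by (intro inv_into_f_eq) (auto simp: bij_betw_def induced_map_in_Dpq induced_map_compose induced_map_one)
      then show ?thesis using True by simp
    next
      case False
      then show ?thesis by (simp add: induced_map_def)
    qed
  qed
qed

lemma induced_map_in_auts:
  assumes "A \<in> U_pq"
  shows "induced_map Dpq A \<in> biholomorphic_auts Dpq"
proof -
  obtain B where B: "B \<in> U_pq" "A ** B = mat 1" "B ** A = mat 1"
    using assms by (rule U_pq_inverse)
  note bij = induced_map_bij[OF B(2,3) assms B(1)]
  have "induced_map Dpq A \<in> extensional Dpq" by (simp add: induced_map_def)
  then show ?thesis
    using bij proj_holomorphic_on_induced_map[OF assms] proj_holomorphic_on_induced_map[OF B(1)]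
    by (simp add: biholomorphic_auts_def Bij_def)
qed

lemma mult_induced_map:
  assumes "A \<in> U_pq" "B \<in> U_pq"
  shows "induced_map Dpq A \<otimes>\<^bsub>Aut_group Dpq\<^esub> induced_map Dpq B = induced_map Dpq (A ** B)"
proof -
  have "induced_map Dpq A \<in> Bij Dpq" "induced_map Dpq B \<in> Bij Dpq"
    using induced_map_in_auts assms by (auto simp: biholomorphic_auts_def)
  then have "induced_map Dpq A \<otimes>\<^bsub>Aut_group Dpq\<^esub> induced_map Dpq B
      = compose Dpq (induced_map Dpq A) (induced_map Dpq B)"
    by (simp add: Aut_group_def BijGroup_def)
  also have "\<dots> = induced_map Dpq (A ** B)"
  proof
    fix L
    show "compose Dpq (induced_map Dpq A) (induced_map Dpq B) L = induced_map Dpq (A ** B) L"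
      by (cases "L \<in> Dpq") (simp_all add: compose_def induced_map_compose assms, simp add: induced_map_def)
  qed
  finally show ?thesis .
qed

lemma one_Aut_group: "\<one>\<^bsub>Aut_group Dpq\<^esub> = induced_map Dpq (mat 1)"
proof
  fix L
  show "\<one>\<^bsub>Aut_group Dpq\<^esub> L = induced_map Dpq (mat 1) L"
    by (cases "L \<in> Dpq")
      (simp_all add: Aut_group_def BijGroup_def induced_map_one, simp add: induced_map_def)
qed

text \<open>Composition with z \<mapsto> z / z_i extends the chart expression of f from the affine
  hyperplane to an open set of C^(p+q). The condition \<open>F z $ j = 1\<close> comes from the
  target chart and fixes the scale, which a projective map alone leaves undetermined.\<close>

lemma local_lift:
  assumes "proj_holomorphic_on f Dpq" "herm_form z0 > 0"
  obtains j F \<Omega> where "open \<Omega>" "z0 \<in> \<Omega>" "\<And>z. z \<in> \<Omega> \<Longrightarrow> herm_form z > 0"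
    "\<And>z. z \<in> \<Omega> \<Longrightarrow> f (proj_point z) = proj_point (F z)" "\<And>z. z \<in> \<Omega> \<Longrightarrow> F z $ j = 1"
    "\<And>z. z \<in> \<Omega> \<Longrightarrow> cdiff F z"
proof -
  have "proj_point z0 \<in> Dpq" using assms by (simp add: proj_point_in_Dpq)
  then obtain i j W where ij: "proj_point z0 \<in> affine_patch i" "f (proj_point z0) \<in> affine_patch j"
    and W: "open W" "affine_chart i (proj_point z0) \<in> W"
    and w: "\<And>w. w \<in> W \<Longrightarrow> w $ i = 1 \<Longrightarrow> proj_point w \<in> Dpq \<and> f (proj_point w) \<in> affine_patch j \<and>
           complex_differentiable_within (\<lambda>v. affine_chart j (f (proj_point v))) w {v. v $ i = 1}"
    using assms(1) unfolding proj_holomorphic_on_def by metis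
  have z0: "z0 $ i \<noteq> 0" using ij by (simp add: proj_point_in_affine_patch)
  define \<nu> where "\<nu> = (\<lambda>z :: complex^('a+'b). (1 / z $ i) *s z)"
  define F where "F = (\<lambda>z. affine_chart j (f (proj_point z)))"
  define V where "V = {z :: complex^('a+'b). z $ i \<noteq> 0}"
  have V: "open V" using open_nth_neq[of "mat 1" i] by (simp add: V_def)
  have cont: "continuous_on V \<nu>" unfolding \<nu>_def V_def by (intro continuous_intros) auto
  define \<Omega> where "\<Omega> = V \<inter> \<nu> -` W"
  have \<Omega>: "open \<Omega>" unfolding \<Omega>_def using cont V W(1)
    by (simp add: continuous_on_open_vimage Int_commute)
  have pp: "proj_point (\<nu> z) = proj_point z" "\<nu> z $ i = 1" if "z \<in> V" for z
    using that by (simp_all add: V_def \<nu>_def proj_point_scale)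
  have *: "herm_form z > 0" "f (proj_point z) \<in> affine_patch j"
    "complex_differentiable_within F (\<nu> z) {v. v $ i = 1}" if "z \<in> \<Omega>" for z
    using that w[of "\<nu> z"] pp[of z] unfolding F_def \<Omega>_def
    by (auto simp: proj_point_in_Dpq)
  have lift: "f (proj_point z) = proj_point (F z)" "F z $ j = 1" if z: "z \<in> \<Omega>" for z
  proof -
    obtain u where u: "f (proj_point z) = proj_point u" "u $ j \<noteq> 0"
      using *(2)[OF z] by (auto simp: affine_patch_def)
    then have "F z = (1 / u $ j) *s u" by (simp add: F_def affine_chart_proj_point)
    then show "f (proj_point z) = proj_point (F z)" "F z $ j = 1"
      using u by (auto simp: proj_point_scale)
  qed
  have "cdiff F z" if z: "z \<in> \<Omega>" for z
  proof -
    obtain A where A: "(F has_derivative (*v) A) (at (\<nu> z) within {v. v $ i = 1})"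
      using *(3)[OF z] by (auto simp: complex_differentiable_within_def)
    \<comment> \<open>The projection \<nu> is the normalised identity map, hence the matrix
      \<open>mat 1\<close>.\<close>
    have "complex_differentiable_within \<nu> z V"
      using complex_differentiable_within_normalize[OF cdiff_matrix[of "mat 1"], of z i V] z
      by (simp add: \<nu>_def \<Omega>_def V_def)
    then obtain B where B: "(\<nu> has_derivative (*v) B) (at z within V)"
      by (auto simp: complex_differentiable_within_def)
    have "((F \<circ> \<nu>) has_derivative ((*v) A \<circ> (*v) B)) (at z within V)"
    proof (rule diff_chain_within[OF B])
      show "(F has_derivative (*v) A) (at (\<nu> z) within \<nu> ` V)"
        by (rule has_derivative_subset[OF A]) (auto simp: pp)
    qed
    moreover have "at z within V = at z" using z V by (intro at_within_open) (auto simp: \<Omega>_def)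
    moreover have "(*v) A \<circ> (*v) B = (*v) (A ** B)"
      by (rule ext) (simp only: comp_def matrix_vector_mul_assoc)
    ultimately have "((F \<circ> \<nu>) has_derivative (*v) (A ** B)) (at z)"
      by (simp only:)
    then have "(F has_derivative (*v) (A ** B)) (at z)"
      by (rule has_derivative_transform_within_open[OF _ V])
        (use z in \<open>auto simp: \<Omega>_def F_def pp\<close>)
    then show ?thesis by (auto simp: cdiff_def)
  qed
  moreover have "z0 \<in> \<Omega>" using z0 W(2) by (simp add: \<Omega>_def V_def \<nu>_def affine_chart_proj_point)
  ultimately show ?thesis using that[of \<Omega> F j] \<Omega> * lift by blast
qed

section \<open>Complex curves and their velocities\<close>

lemma cderiv_affine: "cderiv (\<lambda>t. a + t *s b) b t"
proof -
  have "bounded_linear (\<lambda>t :: complex. t *s b)"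
    using bounded_bilinear.bounded_linear_left[OF bounded_bilinear_vec_smult] .
  then have "((\<lambda>t. a + t *s b) has_derivative (\<lambda>d. 0 + d *s b)) (at t)"
    by (intro has_derivative_add has_derivative_const bounded_linear_imp_has_derivative)
  then show ?thesis by (simp add: cderiv_def)
qed

lemma cderiv_chain:
  assumes "cderiv \<gamma> v t" "(F has_derivative (*v) A) (at (\<gamma> t))"
  shows "cderiv (\<lambda>t. F (\<gamma> t)) (A *v v) t"
  using diff_chain_at[OF assms(1)[unfolded cderiv_def] assms(2)]
  by (simp add: cderiv_def comp_def vector_scalar_commute)

lemma cderiv_nth:
  assumes "cderiv \<gamma> v t"
  shows "((\<lambda>t. \<gamma> t $ k) has_field_derivative v $ k) (at t)"
  using bounded_linear.has_derivative[OF bounded_linear_vec_nth assms[unfolded cderiv_def], of k]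
  by (simp add: has_field_derivative_def mult_commute_abs)

lemma cderiv_herm:
  assumes "cderiv \<gamma> v t"
  shows "((\<lambda>t. herm a (\<gamma> t)) has_field_derivative herm a v) (at t)"
  using bounded_linear.has_derivative[OF bounded_linear_herm assms[unfolded cderiv_def], of a]
  by (simp add: has_field_derivative_def herm_scale_right mult_commute_abs)

lemma cderiv_add_smult:
  assumes "cderiv Y v t" "(g has_field_derivative g') (at t)"
  shows "cderiv (\<lambda>t. Y t + g t *s c) (v + g' *s c) t"
proof -
  have "((\<lambda>t. Y t + g t *s c) has_derivative (\<lambda>d. d *s v + (g t *s 0 + (g' * d) *s c))) (at t)"
    using assms unfolding cderiv_def has_field_derivative_def
    by (intro has_derivative_add has_derivative_vec_smult has_derivative_const)
  then show ?thesis
    by (simp add: cderiv_def vector_add_ldistrib vector_smult_assoc mult.commute)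
qed

lemma cderiv_imp_isCont: "cderiv \<gamma> v t \<Longrightarrow> isCont \<gamma> t"
  unfolding cderiv_def by (rule has_derivative_continuous)

section \<open>One-variable analysis\<close>

text \<open>Cauchy's estimate on discs of radius r/2 bounds the second derivative on the half disc
  by 2! M / (r/2)^2 = 8 M / r^2, and Taylor's formula does the rest. The bound depends on f only
  through M, so it is uniform over families.\<close>

lemma deriv_difference_quotient_bound:
  assumes "r > 0" "f holomorphic_on ball 0 r" "continuous_on (cball 0 r) f"
    "\<And>w. w \<in> cball 0 r \<Longrightarrow> cmod (f w) < M" "s \<noteq> 0" "cmod s \<le> r / 2"
  shows "cmod ((f s - f 0) / s - deriv f 0) \<le> 8 * M / r\<^sup>2 * cmod s"
proof -
  have 2: "cmod ((deriv ^^ 2) f z) \<le> 8 * M / r\<^sup>2" if "z \<in> cball 0 (r/2)" for z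
  proof -
    have sub: "cball z (r/2) \<subseteq> cball 0 r" "ball z (r/2) \<subseteq> ball 0 r"
    proof -
      have "cmod w \<le> r" if "dist z w \<le> r/2" for w
        using that \<open>z \<in> _\<close> norm_triangle_sub[of w z] by (simp add: dist_norm norm_minus_commute)
      then show "cball z (r/2) \<subseteq> cball 0 r" by auto
      have "cmod w < r" if "dist z w < r/2" for w
        using that \<open>z \<in> _\<close> norm_triangle_sub[of w z] by (simp add: dist_norm norm_minus_commute)
      then show "ball z (r/2) \<subseteq> ball 0 r" by auto
    qed
    have "cmod ((deriv ^^ 2) f z) \<le> fact 2 * M / (r/2)^2"
    proof (rule Cauchy_higher_deriv_bound[where y = 0])
      show "f holomorphic_on ball z (r/2)" using assms(2) sub holomorphic_on_subset by blast
      show "continuous_on (cball z (r/2)) f" using assms(3) sub continuous_on_subset by blast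
      show "f w \<in> ball 0 M" if "w \<in> ball z (r/2)" for w
      proof -
        have "w \<in> cball 0 r" using that sub ball_subset_cball by blast
        then show ?thesis using assms(4) by simp
      qed
    qed (use assms in auto)
    then show ?thesis by (simp add: field_simps)
  qed
  have "cmod ((deriv ^^ 0) f s - (\<Sum>i\<le>1. (deriv ^^ i) f 0 * (s - 0) ^ i / fact i))
      \<le> 8 * M / r\<^sup>2 * cmod (s - 0) ^ Suc 1 / fact 1"
  proof (rule complex_Taylor[of "cball 0 (r/2)"])
    show "((deriv ^^ i) f has_field_derivative (deriv ^^ Suc i) f x) (at x within cball 0 (r/2))"
      if "x \<in> cball 0 (r/2)" for i x
    proof -
      have "(deriv ^^ i) f holomorphic_on ball 0 r" using assms by (intro holomorphic_higher_deriv) auto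
      moreover have "x \<in> ball 0 r" using that assms(1) by auto
      ultimately show ?thesis
        using holomorphic_derivI[of "(deriv ^^ i) f" "ball 0 r" x] has_field_derivative_at_within by auto
    qed
    show "cmod ((deriv ^^ Suc 1) f x) \<le> 8 * M / r\<^sup>2" if "x \<in> cball 0 (r/2)" for x
      using 2[OF that] by (simp add: numeral_2_eq_2)
  qed (use assms in auto)
  then have T: "cmod (f s - f 0 - deriv f 0 * s) \<le> 8 * M / r\<^sup>2 * (cmod s)\<^sup>2"
    by (simp add: diff_diff_eq power2_eq_square)
  have "cmod ((f s - f 0) / s - deriv f 0) = cmod (f s - f 0 - deriv f 0 * s) / cmod s"
    using assms(5) by (simp add: norm_divide[symmetric] diff_divide_distrib)
  also have "\<dots> \<le> 8 * M / r\<^sup>2 * (cmod s)\<^sup>2 / cmod s" by (intro divide_right_mono T) auto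
  finally show ?thesis using assms(5) by (simp add: power2_eq_square)
qed

text \<open>The s-derivative at 0 is a uniform limit of difference quotients in s, each holomorphic
  in t. Joint continuity on a compact product of discs supplies the one bound M that makes the
  convergence uniform in t.\<close>

lemma deriv_param_field_differentiable:
  fixes Q :: "complex \<Rightarrow> complex \<Rightarrow> complex"
  assumes S: "open S" "(t0, 0) \<in> S"
    and cont: "continuous_on S (\<lambda>(t, s). Q t s)"
    and d1: "\<And>t s. (t, s) \<in> S \<Longrightarrow> (\<lambda>t. Q t s) field_differentiable at t"
    and d2: "\<And>t s. (t, s) \<in> S \<Longrightarrow> Q t field_differentiable at s"
  shows "(\<lambda>t. deriv (Q t) 0) field_differentiable at t0"
proof -
  obtain A B where AB: "open A" "open B" "t0 \<in> A" "0 \<in> B" "A \<times> B \<subseteq> S"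
    by (rule open_prod_elim[OF S]) auto
  obtain r1 where r1: "r1 > 0" "cball t0 r1 \<subseteq> A" using AB open_contains_cball by blast
  obtain r2 where r2: "r2 > 0" "cball 0 r2 \<subseteq> B" using AB open_contains_cball by blast
  define r where "r = min r1 r2"
  have "cball t0 r \<subseteq> A" "cball 0 r \<subseteq> B"
    using r1(2) r2(2) subset_cball[of r r1 t0] subset_cball[of r r2 0] by (auto simp: r_def)
  then have r: "r > 0" "cball t0 r \<times> cball 0 r \<subseteq> S"
    using r1(1) r2(1) Sigma_mono[of "cball t0 r" A "\<lambda>_. cball 0 r" "\<lambda>_. B"] AB(5) by (simp_all add: r_def)
  have S': "(t, s) \<in> S" if "t \<in> cball t0 r" "s \<in> cball 0 r" for t s
    using subsetD[OF r(2)] that by blast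
  have "compact (cball t0 r \<times> cball (0::complex) r)" by (intro compact_Times compact_cball)
  moreover have "continuous_on (cball t0 r \<times> cball 0 r) (\<lambda>(t, s). Q t s)"
    using cont r(2) continuous_on_subset by blast
  ultimately have "bounded ((\<lambda>(t, s). Q t s) ` (cball t0 r \<times> cball 0 r))"
    using compact_continuous_image compact_imp_bounded by blast
  then obtain M where "\<forall>z \<in> (\<lambda>(t, s). Q t s) ` (cball t0 r \<times> cball 0 r). cmod z < M"
    unfolding bounded_pos_less by blast
  then have M: "cmod (Q t s) < M" if "t \<in> cball t0 r" "s \<in> cball 0 r" for t s using that by auto
  \<comment> \<open>Nonzero steps tending to 0, never longer than the r/2 that the quotient bound
    allows.\<close>
  define \<delta> where "\<delta> n = complex_of_real (r / 2 / Suc n)" for n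
  have \<delta>: "\<delta> n \<noteq> 0" "cmod (\<delta> n) = r / 2 / Suc n" "cmod (\<delta> n) \<le> r / 2" "\<delta> n \<in> cball 0 r" for n
  proof -
    show 1: "cmod (\<delta> n) = r / 2 / Suc n" unfolding \<delta>_def norm_of_real using r by simp
    show "\<delta> n \<noteq> 0" using r by (simp add: \<delta>_def del: of_nat_Suc)
    show "cmod (\<delta> n) \<le> r / 2" unfolding 1 using r by (simp add: divide_le_eq)
    then show "\<delta> n \<in> cball 0 r" using r by simp
  qed
  have hol2: "Q t holomorphic_on ball 0 r" "continuous_on (cball 0 r) (Q t)" if t: "t \<in> cball t0 r" for t
  proof -
    have d: "Q t field_differentiable at s" if "s \<in> cball 0 r" for s
      by (rule d2[OF S'[OF t that]])
    show "Q t holomorphic_on ball 0 r"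
      unfolding holomorphic_on_def
      by (rule ballI, rule field_differentiable_at_within, rule d) simp
    show "continuous_on (cball 0 r) (Q t)"
      using d by (intro continuous_at_imp_continuous_on ballI field_differentiable_imp_continuous_at)
  qed
  have bound: "cmod ((Q t (\<delta> n) - Q t 0) / \<delta> n - deriv (Q t) 0) \<le> 8 * M / r\<^sup>2 * cmod (\<delta> n)"
    if "t \<in> cball t0 r" for t n
    using deriv_difference_quotient_bound[OF r(1) hol2[OF that] M[OF that] \<delta>(1,3)] by simp
  have "(\<lambda>t. deriv (Q t) 0) holomorphic_on ball t0 r"
  proof (rule holomorphic_uniform_sequence)
    show "(\<lambda>t. (Q t (\<delta> n) - Q t 0) / \<delta> n) holomorphic_on ball t0 r" for n
    proof -
      have "(\<lambda>t. Q t s) holomorphic_on ball t0 r" if "s \<in> cball 0 r" for s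
        unfolding holomorphic_on_def
        by (rule ballI, rule field_differentiable_at_within, rule d1, rule S') (use that in simp_all)
      then show ?thesis using \<delta> r by (intro holomorphic_intros) auto
    qed
    fix t assume "t \<in> ball t0 r"
    then obtain d where d: "d > 0" "cball t d \<subseteq> ball t0 r" using open_contains_cball by blast
    have "uniform_limit (cball t d) (\<lambda>n t. (Q t (\<delta> n) - Q t 0) / \<delta> n) (\<lambda>t. deriv (Q t) 0) sequentially"
    proof (rule uniform_limitI)
      fix e :: real assume e: "e > 0"
      have "(\<lambda>n. 8 * M / r\<^sup>2 * (r / 2 / Suc n)) \<longlonglongrightarrow> 8 * M / r\<^sup>2 * 0"
        by (intro tendsto_mult tendsto_const LIMSEQ_Suc lim_const_over_n)
      then have "(\<lambda>n. 8 * M / r\<^sup>2 * cmod (\<delta> n)) \<longlonglongrightarrow> 0" by (simp add: \<delta>(2))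
      then have "\<forall>\<^sub>F n in sequentially. 8 * M / r\<^sup>2 * cmod (\<delta> n) < e"
        using order_tendstoD(2) e by blast
      then show "\<forall>\<^sub>F n in sequentially. \<forall>x\<in>cball t d.
          dist ((Q x (\<delta> n) - Q x 0) / \<delta> n) (deriv (Q x) 0) < e"
      proof eventually_elim
        case (elim n)
        then show ?case using bound[of _ n] d(2) by (auto simp: dist_norm intro!: le_less_trans[OF bound])
      qed
    qed
    then show "\<exists>d>0. cball t d \<subseteq> ball t0 r \<and>
        uniform_limit (cball t d) (\<lambda>n t. (Q t (\<delta> n) - Q t 0) / \<delta> n) (\<lambda>t. deriv (Q t) 0) sequentially"
      using d by blast
  qed auto
  then show ?thesis using r(1) by (simp add: holomorphic_on_imp_differentiable_at)
qed

text \<open>N and N' (not a derivative) are the expressions of one section of O(1) in the two charts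
  of a projective line, up to the factor \<kappa>. Boundedness of N' on the unit disc gives linear
  growth of N, and Liouville's theorem makes N affine. Its slope is the value of the section at
  infinity.\<close>

lemma entire_inversion_affine:
  assumes "\<And>t. N field_differentiable at t" "\<And>t. N' field_differentiable at t"
    and rel: "\<And>t :: complex. t \<noteq> 0 \<Longrightarrow> N t = \<kappa> * t * N' (1 / t)"
  obtains b where "\<And>t. N t = N 0 + t * b" "b = \<kappa> * N' 0"
proof -
  have cont: "continuous_on (cball 0 1) N'"
    using assms(2) by (intro continuous_at_imp_continuous_on ballI field_differentiable_imp_continuous_at)
  then have "bounded (N' ` cball 0 1)"
    using compact_continuous_image compact_imp_bounded compact_cball by blast
  then obtain M where "\<forall>z \<in> N' ` cball 0 1. cmod z \<le> M"
    unfolding bounded_iff by blast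
  then have M: "cmod (N' t) \<le> M" if "cmod t \<le> 1" for t using that by simp
  have hol: "N holomorphic_on UNIV" using assms(1) by (simp add: holomorphic_on_def field_differentiable_at_within)
  have "cmod (N t) \<le> (cmod \<kappa> * M) * cmod t ^ 1" if "1 \<le> cmod t" for t
  proof -
    have t: "t \<noteq> 0" using that by auto
    have "cmod (N' (1 / t)) \<le> M" using that by (intro M) (simp add: norm_divide divide_le_eq)
    then have "cmod \<kappa> * cmod t * cmod (N' (1 / t)) \<le> cmod \<kappa> * cmod t * M"
      by (intro mult_left_mono) auto
    then show ?thesis using rel[OF t] by (simp add: norm_mult mult_ac)
  qed
  then have N: "N t = (\<Sum>k\<le>1. (deriv ^^ k) N 0 / fact k * t ^ k)" for t
    using Liouville_polynomial[OF hol] by blast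
  define b where "b = deriv N 0"
  have b: "N t = N 0 + t * b" for t using N[of t] by (simp add: b_def)
  have "(\<lambda>t. \<kappa> * N' t) \<midarrow>0\<rightarrow> \<kappa> * N' 0"
    using field_differentiable_imp_continuous_at[OF assms(2), of 0] unfolding isCont_def
    by (intro tendsto_mult tendsto_const)
  moreover have "(\<lambda>t. N 0 * t + b) \<midarrow>0\<rightarrow> N 0 * 0 + b" by (intro tendsto_intros)
  \<comment> \<open>The relation is read at \<open>1 / t\<close>; letting t tend to 0 identifies the
    slope.\<close>
  moreover have "\<kappa> * N' t = N 0 * t + b" if "t \<noteq> 0" for t
    using rel[of "1 / t"] b[of "1 / t"] that by (simp add: field_simps)
  then have "(\<lambda>t. \<kappa> * N' t) \<midarrow>0\<rightarrow> l \<longleftrightarrow> (\<lambda>t. N 0 * t + b) \<midarrow>0\<rightarrow> l" for l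
    by (intro LIM_cong) auto
  ultimately have "b = \<kappa> * N' 0" using LIM_unique by (metis add_0 mult_zero_right)
  then show ?thesis using that b by blast
qed

section \<open>Positive lines are mapped to lines\<close>

text \<open>The span of x and y is a positive definite plane: x and y are independent and the whole
  projective line through them lies in \<open>Dpq\<close>.\<close>

definition pos :: "complex^('p::finite + 'q::finite) \<Rightarrow> complex^('p + 'q) \<Rightarrow> bool" where
  "pos x y \<longleftrightarrow> (\<forall>s t. (s, t) \<noteq> (0, 0) \<longrightarrow> herm_form (s *s x + t *s y) > 0)"

text \<open>An arbitrary choice of homogeneous coordinates; it enters only expressions that are
  invariant under scaling.\<close>

definition rep :: "(complex^'n) set \<Rightarrow> complex^'n" where
  "rep L = (SOME w. L = proj_point w \<and> w \<noteq> 0)"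

lemma rep_Dpq:
  assumes "L \<in> Dpq"
  shows "proj_point (rep L) = L" "rep L \<noteq> 0" "herm_form (rep L) > 0"
proof -
  have "\<exists>w. L = proj_point w \<and> w \<noteq> 0" using assms Dpq_cases by metis
  then have "L = proj_point (rep L) \<and> rep L \<noteq> 0" unfolding rep_def by (rule someI_ex)
  then show "proj_point (rep L) = L" "rep L \<noteq> 0" by simp_all
  then show "herm_form (rep L) > 0" using assms proj_point_in_Dpq by metis
qed

lemma isCont_eventually_nhds:
  assumes "isCont g t" "open S" "g t \<in> S"
  shows "\<forall>\<^sub>F s in nhds t. g s \<in> S"
  using assms topological_tendstoD[of g "g t" "at t" S]
  by (simp add: isCont_def eventually_nhds_conv_at)

lemma herm_form_add_orth: "herm x y = 0 \<Longrightarrow> herm_form (x + y) = herm_form x + herm_form y"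
  by (simp add: herm_form_eq herm_simps herm_commute[of y x])

text \<open>The hypotheses are symmetric in f and h, so that the two can be exchanged; for p = 1
  this yields the reverse norm inequality.\<close>

locale proj_biholo =
  fixes f h :: "(complex^('p::finite + 'q::finite)) set \<Rightarrow> (complex^('p + 'q)) set"
  assumes f_holo: "proj_holomorphic_on f Dpq" and h_holo: "proj_holomorphic_on h Dpq"
    and f_in: "L \<in> Dpq \<Longrightarrow> f L \<in> Dpq" and h_in: "L \<in> Dpq \<Longrightarrow> h L \<in> Dpq"
    and hf: "L \<in> Dpq \<Longrightarrow> h (f L) = L" and fh: "L \<in> Dpq \<Longrightarrow> f (h L) = L"
begin

lemma f_inj: "herm_form x > 0 \<Longrightarrow> herm_form y > 0 \<Longrightarrow> f (proj_point x) = f (proj_point y)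
    \<Longrightarrow> proj_point x = proj_point y"
  using hf proj_point_in_Dpq by metis

text \<open>The rational function [w] \<mapsto> \<open>herm u w / herm x w\<close>, pulled back by
  h. If u is orthogonal to a line, the function vanishes on it, and its derivative measures
  displacement normal to the line.\<close>

definition ratio :: "complex^('p + 'q) \<Rightarrow> complex^('p + 'q) \<Rightarrow> complex^('p + 'q) \<Rightarrow> complex" where
  "ratio u x Y = herm u (rep (h (proj_point Y))) / herm x (rep (h (proj_point Y)))"

lemma ratio_eq:
  assumes "h (proj_point Y) = proj_point w" "herm_form w > 0"
  shows "ratio u x Y = herm u w / herm x w"
proof -
  have "proj_point w \<in> Dpq" "w \<noteq> 0" using assms(2) by (auto simp: proj_point_in_Dpq)
  then obtain c where "c \<noteq> 0" "rep (proj_point w) = c *s w"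
    using rep_Dpq(1)[of "proj_point w"] proj_point_eq_iff by metis
  then show ?thesis by (simp add: ratio_def assms(1) herm_scale_right)
qed

lemma ratio_scale: "c \<noteq> 0 \<Longrightarrow> ratio u x (c *s Y) = ratio u x Y"
  by (simp add: ratio_def proj_point_scale)

text \<open>
  The value, at the point x + t y of the line, of the section of O(1) obtained from the vector field with
  homogeneous lift Y_k c; the factor Y_k makes it independent of the choice of the representative Y.
\<close>

definition lineflow ::
    "complex^('p + 'q) \<Rightarrow> complex^('p + 'q) \<Rightarrow> complex^('p + 'q) \<Rightarrow> complex^('p + 'q) \<Rightarrow> ('p + 'q) \<Rightarrow> complex \<Rightarrow> complex"
  where
  "lineflow c u x y k t = deriv (\<lambda>s. ratio u x
     (rep (f (proj_point (x + t *s y))) + (s * rep (f (proj_point (x + t *s y))) $ k) *s c)) 0"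

lemma lineflow_eq:
  assumes "f (proj_point (x + t *s y)) = proj_point Z" "herm_form Z > 0"
  shows "lineflow c u x y k t = deriv (\<lambda>s. ratio u x (Z + (s * Z $ k) *s c)) 0"
proof -
  have "proj_point Z \<in> Dpq" "Z \<noteq> 0" using assms(2) by (auto simp: proj_point_in_Dpq)
  then obtain \<mu> where \<mu>: "\<mu> \<noteq> 0" "rep (proj_point Z) = \<mu> *s Z"
    using rep_Dpq(1)[of "proj_point Z"] proj_point_eq_iff by metis
  have eq: "rep (proj_point Z) + (s * rep (proj_point Z) $ k) *s c = \<mu> *s (Z + (s * Z $ k) *s c)" for s
    by (simp add: \<mu>(2) vec_eq_iff algebra_simps)
  show ?thesis by (simp only: lineflow_def assms(1) eq ratio_scale[OF \<mu>(1)])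
qed

lemma f_proj_point_pos: "herm_form z > 0 \<Longrightarrow> f (proj_point z) = proj_point Z \<Longrightarrow> herm_form Z > 0"
  using f_in proj_point_in_Dpq by metis

lemma h_proj_point_pos: "herm_form z > 0 \<Longrightarrow> h (proj_point z) = proj_point Z \<Longrightarrow> herm_form Z > 0"
  using h_in proj_point_in_Dpq by metis

text \<open>Local lifts F of f and W of h turn the expression near t0 into the s-derivative at 0 of
  a function Q(t, s) holomorphic in each variable. The second hypothesis keeps the denominator of Q
  away from 0 along the line.\<close>

lemma lineflow_field_differentiable:
  assumes pos: "\<And>t. herm_form (x + t *s y) > 0" and x: "\<And>t. herm x (x + t *s y) \<noteq> 0"
  shows "lineflow c u x y k field_differentiable at t0"
proof -
  obtain j F \<Omega> where F: "open \<Omega>" "x + t0 *s y \<in> \<Omega>" "\<And>z. z \<in> \<Omega> \<Longrightarrow> herm_form z > 0"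
    "\<And>z. z \<in> \<Omega> \<Longrightarrow> f (proj_point z) = proj_point (F z)" "\<And>z. z \<in> \<Omega> \<Longrightarrow> F z $ j = 1"
    "\<And>z. z \<in> \<Omega> \<Longrightarrow> cdiff F z"
    using local_lift[OF f_holo pos[of t0]] by metis
  have Z0: "herm_form (F (x + t0 *s y)) > 0" using f_proj_point_pos[OF pos F(4)[OF F(2)]] .
  obtain i W \<Omega>' where W: "open \<Omega>'" "F (x + t0 *s y) \<in> \<Omega>'" "\<And>z. z \<in> \<Omega>' \<Longrightarrow> herm_form z > 0"
    "\<And>z. z \<in> \<Omega>' \<Longrightarrow> h (proj_point z) = proj_point (W z)" "\<And>z. z \<in> \<Omega>' \<Longrightarrow> W z $ i = 1"
    "\<And>z. z \<in> \<Omega>' \<Longrightarrow> cdiff W z"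
    using local_lift[OF h_holo Z0] by metis
  define \<Psi> where "\<Psi> = (\<lambda>t s. F (x + t *s y) + (s * F (x + t *s y) $ k) *s c)"
  define Q where "Q = (\<lambda>t s. herm u (W (\<Psi> t s)) / herm x (W (\<Psi> t s)))"
  \<comment> \<open>Three nested sets: each further condition is open only because the map in it is
    continuous on the previous set.\<close>
  define S1 where "S1 = UNIV \<inter> (\<lambda>ts :: complex \<times> complex. x + fst ts *s y) -` \<Omega>"
  define S2 where "S2 = S1 \<inter> (\<lambda>ts. \<Psi> (fst ts) (snd ts)) -` \<Omega>'"
  define S where "S = S2 \<inter> (\<lambda>ts. herm x (W (\<Psi> (fst ts) (snd ts)))) -` (- {0})"
  have S1: "open S1" unfolding S1_def
    by (intro continuous_open_preimage F continuous_intros) auto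
  have contF: "continuous_on S1 (\<lambda>ts. F (x + fst ts *s y))"
    by (rule continuous_on_compose2[OF cdiff_imp_continuous_on[of \<Omega> F]])
      (auto simp: F S1_def intro!: continuous_intros)
  have cont\<Psi>: "continuous_on S1 (\<lambda>ts. \<Psi> (fst ts) (snd ts))"
    unfolding \<Psi>_def by (intro continuous_intros contF)
  have S2: "open S2" unfolding S2_def
    by (intro continuous_open_preimage cont\<Psi> S1 W)
  have contW: "continuous_on S2 (\<lambda>ts. W (\<Psi> (fst ts) (snd ts)))"
    by (rule continuous_on_compose2[OF cdiff_imp_continuous_on[of \<Omega>' W]])
      (auto simp: W S2_def intro!: continuous_on_subset[OF cont\<Psi>])
  have S: "open S" unfolding S_def
    by (intro continuous_open_preimage S2 continuous_intros contW)
  have mem: "x + t *s y \<in> \<Omega>" "\<Psi> t s \<in> \<Omega>'" "herm x (W (\<Psi> t s)) \<noteq> 0" if "(t, s) \<in> S" for t s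
    using that by (auto simp: S_def S2_def S1_def)
  have \<Psi>0: "\<Psi> t 0 = F (x + t *s y)" for t by (simp add: \<Psi>_def)
  have t0: "(t0, 0) \<in> S"
  proof -
    have "proj_point (W (F (x + t0 *s y))) = proj_point (x + t0 *s y)"
      using W(4)[OF W(2)] F(4)[OF F(2)] hf pos[of t0] by (metis proj_point_in_Dpq)
    moreover have "x + t0 *s y \<noteq> 0" using pos[of t0] by auto
    ultimately obtain \<mu> where "\<mu> \<noteq> 0" "W (F (x + t0 *s y)) = \<mu> *s (x + t0 *s y)"
      using proj_point_eq_iff by metis
    then have "herm x (W (F (x + t0 *s y))) \<noteq> 0"
      using x[of t0] by (metis herm_scale_right mult_eq_0_iff)
    then show ?thesis using F(2) W(2) by (simp add: S_def S2_def S1_def \<Psi>0)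
  qed
  have dF: "\<exists>v. cderiv (\<lambda>t. F (x + t *s y)) v t" if "x + t *s y \<in> \<Omega>" for t
    using F(6)[OF that] cderiv_chain[OF cderiv_affine[of x y t]] by (auto simp: cdiff_def)
  have dQ: "(\<lambda>t. herm u (W (\<gamma> t)) / herm x (W (\<gamma> t))) field_differentiable at t"
    if \<gamma>: "cderiv \<gamma> v t" "\<gamma> t \<in> \<Omega>'" "herm x (W (\<gamma> t)) \<noteq> 0" for \<gamma> v t
  proof -
    obtain A where "(W has_derivative (*v) A) (at (\<gamma> t))" using W(6)[OF \<gamma>(2)] by (auto simp: cdiff_def)
    then have "cderiv (\<lambda>t. W (\<gamma> t)) (A *v v) t" using \<gamma>(1) by (rule cderiv_chain[rotated])
    then have "(\<lambda>t. herm a (W (\<gamma> t))) field_differentiable at t" for a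
      using cderiv_herm field_differentiable_def by blast
    then show ?thesis using \<gamma>(3) by (intro field_differentiable_divide)
  qed
  have main: "(\<lambda>t. deriv (Q t) 0) field_differentiable at t0"
  proof (rule deriv_param_field_differentiable[OF S t0])
    have "continuous_on S (\<lambda>ts. Q (fst ts) (snd ts))"
      unfolding Q_def using mem
      by (intro continuous_intros continuous_on_subset[OF contW]) (auto simp: S_def)
    then show "continuous_on S (\<lambda>(t, s). Q t s)" by (simp add: case_prod_beta)
    fix t s assume ts: "(t, s) \<in> S"
    obtain v where v: "cderiv (\<lambda>t. F (x + t *s y)) v t" using dF mem(1)[OF ts] by blast
    have "((\<lambda>t. s * F (x + t *s y) $ k) has_field_derivative s * v $ k) (at t)"
      using cderiv_nth[OF v] by (rule DERIV_cmult)
    from cderiv_add_smult[OF v this, of c]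
    have "cderiv (\<lambda>t. \<Psi> t s) (v + (s * v $ k) *s c) t" by (simp add: \<Psi>_def)
    from dQ[OF this] show "(\<lambda>t. Q t s) field_differentiable at t" using mem[OF ts] by (simp add: Q_def)
    have "cderiv (\<Psi> t) (F (x + t *s y) $ k *s c) s"
      using cderiv_affine[of "F (x + t *s y)" "F (x + t *s y) $ k *s c" s]
      by (simp add: \<Psi>_def vector_smult_assoc)
    from dQ[OF this] show "Q t field_differentiable at s" using mem[OF ts] by (simp add: Q_def)
  qed
  have eq: "lineflow c u x y k t = deriv (Q t) 0" if "(t, 0) \<in> S" for t
  proof -
    have "open {s. (t, s) \<in> S}"
    proof -
      have "{s. (t, s) \<in> S} = UNIV \<inter> (\<lambda>s. (t, s)) -` S" by auto
      then show ?thesis by (auto intro!: continuous_open_preimage S continuous_intros)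
    qed
    then have ev: "\<forall>\<^sub>F s in nhds 0. (t, s) \<in> S"
      using eventually_nhds_in_open[of "{s. (t, s) \<in> S}" 0] that by simp
    have "herm_form (F (x + t *s y)) > 0" using f_proj_point_pos F mem(1)[OF that] by blast
    then have "lineflow c u x y k t = deriv (\<lambda>s. ratio u x (\<Psi> t s)) 0"
      unfolding \<Psi>_def using lineflow_eq F(4)[OF mem(1)[OF that]] by blast
    also have "\<dots> = deriv (Q t) 0"
    proof (rule deriv_cong_ev[OF _ refl])
      show "\<forall>\<^sub>F s in nhds 0. ratio u x (\<Psi> t s) = Q t s"
        using ev
      proof eventually_elim
        case (elim s)
        then have "\<Psi> t s \<in> \<Omega>'" by (rule mem)
        then show ?case unfolding Q_def using W h_proj_point_pos by (intro ratio_eq) blast+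
      qed
    qed
    finally show ?thesis .
  qed
  have "open {t. (t, 0) \<in> S}"
  proof -
    have "{t. (t, 0) \<in> S} = UNIV \<inter> (\<lambda>t. (t, 0)) -` S" by auto
    then show ?thesis by (auto intro!: continuous_open_preimage S continuous_intros)
  qed
  then have op: "open {t. (t, 0) \<in> S}" .
  obtain D where "((\<lambda>t. deriv (Q t) 0) has_field_derivative D) (at t0)"
    using main field_differentiable_def by blast
  then have "(lineflow c u x y k has_field_derivative D) (at t0)"
    by (rule has_field_derivative_transform_within_open[OF _ op]) (use t0 eq in auto)
  then show ?thesis by (auto simp: field_differentiable_def)
qed

text \<open>The numerator of the ratio vanishes at s = 0, so the quotient rule leaves only its
  derivative. The factor in front of \<open>Z $ k\<close> is then the same for all k, which is what
  makes these values homogeneous coordinates of the image point.\<close>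

lemma lineflow_value:
  assumes Z: "f (proj_point (x + t *s y)) = proj_point Z" "herm_form Z > 0"
    and W: "open \<Omega>" "Z \<in> \<Omega>" "\<And>z. z \<in> \<Omega> \<Longrightarrow> h (proj_point z) = proj_point (W z) \<and> herm_form (W z) > 0"
      "(W has_derivative (*v) A) (at Z)"
    and u: "herm u (W Z) = 0" and x: "herm x (W Z) \<noteq> 0"
  shows "lineflow c u x y k t = herm u (A *v c) / herm x (W Z) * Z $ k"
proof -
  define \<gamma> where "\<gamma> s = Z + s *s (Z $ k *s c)" for s
  have \<gamma>: "\<gamma> 0 = Z" "cderiv \<gamma> (Z $ k *s c) 0" unfolding \<gamma>_def by (simp, rule cderiv_affine)
  have "cderiv (\<lambda>s. W (\<gamma> s)) (A *v (Z $ k *s c)) 0"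
    using cderiv_chain[OF \<gamma>(2)] W(4) \<gamma>(1) by metis
  then have D: "((\<lambda>s. herm a (W (\<gamma> s))) has_field_derivative herm a (A *v (Z $ k *s c))) (at 0)" for a
    by (rule cderiv_herm)
  have "((\<lambda>s. herm u (W (\<gamma> s)) / herm x (W (\<gamma> s))) has_field_derivative
     herm u (A *v (Z $ k *s c)) / herm x (W Z)) (at 0)"
    using DERIV_divide[OF D[of u] D[of x]] u x \<gamma>(1) by (simp add: field_simps)
  then have "deriv (\<lambda>s. herm u (W (\<gamma> s)) / herm x (W (\<gamma> s))) 0 = Z $ k * herm u (A *v c) / herm x (W Z)"
    by (simp add: DERIV_imp_deriv vector_scalar_commute herm_scale_right)
  moreover have "\<forall>\<^sub>F s in nhds 0. ratio u x (\<gamma> s) = herm u (W (\<gamma> s)) / herm x (W (\<gamma> s))"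
  proof -
    have "isCont \<gamma> 0" using \<gamma>(2) by (rule cderiv_imp_isCont)
    then have "\<forall>\<^sub>F s in nhds 0. \<gamma> s \<in> \<Omega>"
      using W(1,2) \<gamma>(1) by (intro isCont_eventually_nhds) simp_all
    then show ?thesis
    proof eventually_elim
      case (elim s) then show ?case using W(3) by (intro ratio_eq) auto
    qed
  qed
  ultimately have "deriv (\<lambda>s. ratio u x (\<gamma> s)) 0 = Z $ k * herm u (A *v c) / herm x (W Z)"
    using deriv_cong_ev[OF _ refl] by metis
  then show ?thesis by (simp add: lineflow_eq[OF Z] \<gamma>_def vector_smult_assoc)
qed

text \<open>For t nonzero, x + t y and y + (1/t) x are the same point, so both values use the same
  Z, W and A and differ only in the denominators \<open>herm x (W Z)\<close> and
  \<open>herm y (W Z)\<close>. The first claim is mere membership, as the section may vanish at the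
  point.\<close>

lemma lineflow_mem:
  assumes x: "herm_form x > 0" and y: "herm_form y > 0" and xy: "herm x y = 0"
    and u: "herm u x = 0" "herm u y = 0"
  shows "(\<chi> k. lineflow c u x y k t) \<in> f (proj_point (x + t *s y))"
    and "t \<noteq> 0 \<Longrightarrow> lineflow c u x y k t = herm y y / herm x x * t * lineflow c u y x k (1 / t)"
proof -
  have "herm_form (x + t *s y) = herm_form x + (cmod t)\<^sup>2 * herm_form y"
    using herm_form_add_orth[of x "t *s y"] xy by (simp add: herm_scale_right herm_form_scale)
  then have p: "herm_form (x + t *s y) > 0" using x y
    by (metis add_pos_nonneg less_imp_le mult_nonneg_nonneg zero_le_power2)
  obtain Z where Z: "f (proj_point (x + t *s y)) = proj_point Z" "herm_form Z > 0"
    using f_in p Dpq_cases proj_point_in_Dpq by metis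
  obtain i W \<Omega> where W: "open \<Omega>" "Z \<in> \<Omega>" "\<And>z. z \<in> \<Omega> \<Longrightarrow> herm_form z > 0"
    "\<And>z. z \<in> \<Omega> \<Longrightarrow> h (proj_point z) = proj_point (W z)" "\<And>z. z \<in> \<Omega> \<Longrightarrow> W z $ i = 1"
    "\<And>z. z \<in> \<Omega> \<Longrightarrow> cdiff W z"
    using local_lift[OF h_holo Z(2)] by metis
  obtain A where A: "(W has_derivative (*v) A) (at Z)" using W(2,6) by (auto simp: cdiff_def)
  have Wh: "h (proj_point z) = proj_point (W z) \<and> herm_form (W z) > 0" if "z \<in> \<Omega>" for z
    using W(3,4) that h_proj_point_pos by metis
  have "proj_point (W Z) = proj_point (x + t *s y)"
    using Wh[OF W(2)] Z(1) hf p by (metis proj_point_in_Dpq)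
  moreover have "x + t *s y \<noteq> 0" using p by auto
  ultimately obtain \<mu> where \<mu>: "\<mu> \<noteq> 0" "W Z = \<mu> *s (x + t *s y)"
    using proj_point_eq_iff by metis
  have hx: "herm x x \<noteq> 0" "herm y y \<noteq> 0" using x y by (auto simp: herm_self)
  have yx: "herm y x = 0" using xy herm_commute[of y x] by simp
  have 1: "herm u (W Z) = 0" "herm x (W Z) = \<mu> * herm x x" "herm y (W Z) = \<mu> * (t * herm y y)"
    by (simp_all add: \<mu>(2) herm_simps u xy yx)
  have v1: "lineflow c u x y k t = herm u (A *v c) / herm x (W Z) * Z $ k" for k
    by (rule lineflow_value[OF Z W(1,2) Wh A 1(1)]) (simp_all add: 1 hx \<mu>(1))
  show "(\<chi> k. lineflow c u x y k t) \<in> f (proj_point (x + t *s y))"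
    unfolding Z(1) mem_proj_point v1
    by (rule exI[of _ "herm u (A *v c) / herm x (W Z)"]) (simp add: vec_eq_iff)
  assume t: "t \<noteq> 0"
  have "t *s (y + (1 / t) *s x) = x + t *s y" using t by (simp add: vec_eq_iff algebra_simps)
  then have "proj_point (y + (1 / t) *s x) = proj_point (x + t *s y)" using t proj_point_scale by metis
  then have Z': "f (proj_point (y + (1 / t) *s x)) = proj_point Z" using Z(1) by simp
  have "lineflow c u y x k (1 / t) = herm u (A *v c) / herm y (W Z) * Z $ k"
    by (rule lineflow_value[OF Z' Z(2) W(1,2) Wh A 1(1)]) (simp_all add: 1 hx \<mu>(1) t)
  then show "lineflow c u x y k t = herm y y / herm x x * t * lineflow c u y x k (1 / t)"
    using v1[of k] 1 t hx \<mu>(1) by simp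
qed

text \<open>The choice is c = B u, with B the derivative of F at x: then A c is the derivative of
  W(F z) in the direction u, and as W(F z) is a multiple of z, its component along u cannot
  vanish.\<close>

lemma lineflow_nonzero:
  assumes x: "herm_form x > 0" and u: "herm u x = 0" "herm u u \<noteq> 0"
  obtains c where "\<And>y. (\<chi> k. lineflow c u x y k 0) \<noteq> 0"
proof -
  obtain j F \<Omega> where F: "open \<Omega>" "x \<in> \<Omega>" "\<And>z. z \<in> \<Omega> \<Longrightarrow> herm_form z > 0"
    "\<And>z. z \<in> \<Omega> \<Longrightarrow> f (proj_point z) = proj_point (F z)" "\<And>z. z \<in> \<Omega> \<Longrightarrow> F z $ j = 1"
    "\<And>z. z \<in> \<Omega> \<Longrightarrow> cdiff F z"
    using local_lift[OF f_holo x] by metis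
  have Z: "herm_form (F z) > 0" if "z \<in> \<Omega>" for z
    using f_proj_point_pos[OF F(3) F(4)] that by blast
  obtain i W \<Omega>' where W: "open \<Omega>'" "F x \<in> \<Omega>'" "\<And>z. z \<in> \<Omega>' \<Longrightarrow> herm_form z > 0"
    "\<And>z. z \<in> \<Omega>' \<Longrightarrow> h (proj_point z) = proj_point (W z)" "\<And>z. z \<in> \<Omega>' \<Longrightarrow> W z $ i = 1"
    "\<And>z. z \<in> \<Omega>' \<Longrightarrow> cdiff W z"
    using local_lift[OF h_holo Z[OF F(2)]] by metis
  obtain A where A: "(W has_derivative (*v) A) (at (F x))" using W(2,6) by (auto simp: cdiff_def)
  obtain B where B: "(F has_derivative (*v) B) (at x)" using F(2,6) by (auto simp: cdiff_def)
  have Wh: "h (proj_point z) = proj_point (W z) \<and> herm_form (W z) > 0" if "z \<in> \<Omega>'" for z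
    using W(3,4) that h_proj_point_pos by metis
  have WF: "\<exists>\<mu>. \<mu> \<noteq> 0 \<and> W (F z) = \<mu> *s z" if "z \<in> \<Omega>" "F z \<in> \<Omega>'" for z
  proof -
    have "proj_point (W (F z)) = proj_point z"
      using Wh[OF that(2)] F(3,4)[OF that(1)] hf by (metis proj_point_in_Dpq)
    moreover have "z \<noteq> 0" using F(3)[OF that(1)] by auto
    ultimately show ?thesis using proj_point_eq_iff by metis
  qed
  define \<gamma> where "\<gamma> s = x + s *s u" for s
  have \<gamma>: "\<gamma> 0 = x" "cderiv \<gamma> u 0" unfolding \<gamma>_def by (simp, rule cderiv_affine)
  have F\<gamma>: "cderiv (\<lambda>s. F (\<gamma> s)) (B *v u) 0"
    using cderiv_chain[OF \<gamma>(2)] B \<gamma>(1) by metis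
  have "cderiv (\<lambda>s. W (F (\<gamma> s))) (A *v (B *v u)) 0"
    using cderiv_chain[OF F\<gamma>] A \<gamma>(1) by metis
  then have D: "((\<lambda>s. herm a (W (F (\<gamma> s)))) has_field_derivative herm a (A *v (B *v u))) (at 0)" for a
    by (rule cderiv_herm)
  have D1: "((\<lambda>s. herm u (W (F (\<gamma> s))) * herm x x) has_field_derivative
      herm u (A *v (B *v u)) * herm x x) (at 0)"
    using D by (rule DERIV_cmult_right)
  have "((\<lambda>s. s * herm u u) has_field_derivative 1 * herm u u) (at 0)"
    by (rule DERIV_cmult_right[OF DERIV_ident])
  from DERIV_mult[OF D[of x] this]
  have D2: "((\<lambda>s. herm x (W (F (\<gamma> s))) * (s * herm u u)) has_field_derivative
      herm x (W (F x)) * herm u u) (at 0)"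
    using \<gamma>(1) by (simp add: mult.commute)
  have xu: "herm x u = 0" using u(1) herm_commute[of x u] by simp
  have ev: "\<forall>\<^sub>F s in nhds 0. \<gamma> s \<in> \<Omega>" "\<forall>\<^sub>F s in nhds 0. F (\<gamma> s) \<in> \<Omega>'"
    using cderiv_imp_isCont[OF \<gamma>(2)] cderiv_imp_isCont[OF F\<gamma>] F(1,2) W(1,2) \<gamma>(1)
    by (auto intro!: isCont_eventually_nhds)
  \<comment> \<open>Cross-multiplied so that the unknown factor \<mu>, which depends on s, does not
    appear and both sides can be differentiated.\<close>
  have "\<forall>\<^sub>F s in nhds 0. herm u (W (F (\<gamma> s))) * herm x x = herm x (W (F (\<gamma> s))) * (s * herm u u)"
    using ev
  proof eventually_elim
    case (elim s)
    then obtain \<mu> where "W (F (\<gamma> s)) = \<mu> *s \<gamma> s" using WF by blast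
    then show ?case by (simp add: \<gamma>_def herm_simps u xu)
  qed
  from DERIV_cong_ev[OF refl this refl] D1
  have "((\<lambda>s. herm x (W (F (\<gamma> s))) * (s * herm u u)) has_field_derivative
      herm u (A *v (B *v u)) * herm x x) (at 0)" by blast
  then have "herm u (A *v (B *v u)) * herm x x = herm x (W (F x)) * herm u u"
    using D2 DERIV_unique by blast
  moreover have hx: "herm x (W (F x)) \<noteq> 0" "herm u (W (F x)) = 0"
    using WF[OF F(2) W(2)] x u by (auto simp: herm_simps herm_self)
  ultimately have ne: "herm u (A *v (B *v u)) \<noteq> 0" using u(2) by auto
  \<comment> \<open>At t = 0 the point is x whatever y is, and the j-th coordinate of the lift is 1;
    hence one c serves all y.\<close>
  have "(\<chi> k. lineflow (B *v u) u x y k 0) \<noteq> 0" for y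
  proof -
    have "lineflow (B *v u) u x y j 0 = herm u (A *v (B *v u)) / herm x (W (F x)) * F x $ j"
      by (rule lineflow_value[OF _ Z[OF F(2)] W(1,2) Wh A]) (use F(2,4) hx in auto)
    then have "(\<chi> k. lineflow (B *v u) u x y k 0) $ j \<noteq> 0" using ne hx(1) F(5)[OF F(2)] by simp
    then show ?thesis by (metis zero_index)
  qed
  then show ?thesis using that by blast
qed

text \<open>The tuple N(t) of sections is affine, N(t) = A + t B, and N(t) lies in f[x + t y]. As
  the zero vector lies in every f[x + t y], zeros must still be excluded, and injectivity of f does
  this.\<close>

lemma line_map_orth:
  assumes x: "herm_form x > 0" and y: "herm_form y > 0" and xy: "herm x y = 0"
  obtains A B where "\<And>s t. (s, t) \<noteq> (0, 0) \<Longrightarrow> s *s A + t *s B \<noteq> 0"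
    "\<And>s t. (s, t) \<noteq> (0, 0) \<Longrightarrow> f (proj_point (s *s x + t *s y)) = proj_point (s *s A + t *s B)"
proof -
  have yx: "herm y x = 0" using xy herm_commute[of y x] by simp
  have hx: "herm x x \<noteq> 0" "herm y y \<noteq> 0" using x y by (auto simp: herm_self)
  have form: "herm_form (s *s x + t *s y) = (cmod s)\<^sup>2 * herm_form x + (cmod t)\<^sup>2 * herm_form y" for s t
    using herm_form_add_orth[of "s *s x" "t *s y"] xy
    by (simp add: herm_scale_right herm_scale_left herm_form_scale)
  have p: "herm_form (s *s x + t *s y) > 0" if "(s, t) \<noteq> (0, 0)" for s t
    unfolding form using that x y
    by (cases "s = 0") (auto intro!: add_pos_nonneg)
  \<comment> \<open>A normal direction with nonzero square is needed. Subtracting from a negative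
    basis vector its projection w to the positive definite span leaves u with square -1 -
    \<open>herm_form w\<close>, which is negative.\<close>
  define e :: "complex^('p + 'q)" where "e = axis (Inr undefined) 1"
  have "herm_form e = - 1"
    by (simp add: herm_form_expand e_def axis_def if_distrib[of "\<lambda>z. (cmod z)\<^sup>2"] cong: if_cong)
  define w where "w = (herm x e / herm x x) *s x + (herm y e / herm y y) *s y"
  define u where "u = e - w"
  have xu: "herm x u = 0" "herm y u = 0"
    using hx by (simp_all add: u_def w_def herm_simps xy yx)
  then have ux: "herm u x = 0" "herm u y = 0"
    using herm_commute[of u x] herm_commute[of u y] by simp_all
  have "herm_form (u + w) = herm_form u + herm_form w"
    by (rule herm_form_add_orth) (simp add: w_def herm_simps ux)
  moreover have "herm_form w \<ge> 0" unfolding w_def form using x y by (intro add_nonneg_nonneg) auto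
  ultimately have "herm_form u \<noteq> 0" using \<open>herm_form e = - 1\<close> by (simp add: u_def)
  then have "herm u u \<noteq> 0" by (simp add: herm_self)
  then obtain c where c: "\<And>y. (\<chi> k. lineflow c u x y k 0) \<noteq> 0"
    using lineflow_nonzero[OF x ux(1)] by blast
  define N where "N = (\<lambda>t. \<chi> k. lineflow c u x y k t)"
  define N' where "N' = (\<lambda>t. \<chi> k. lineflow c u y x k t)"
  define \<kappa> where "\<kappa> = herm y y / herm x x"
  have "\<exists>b. (\<forall>t. N t $ k = N 0 $ k + t * b) \<and> b = \<kappa> * N' 0 $ k" for k
  proof -
    have "herm_form (x + t *s y) > 0" "herm_form (y + t *s x) > 0" for t
      using p[of 1 t] p[of t 1] by (simp_all add: add.commute)
    then have "lineflow c u x y k field_differentiable at t" "lineflow c u y x k field_differentiable at t" for t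
      using hx xy yx by (auto intro!: lineflow_field_differentiable simp: herm_simps)
    moreover have "lineflow c u x y k t = \<kappa> * t * lineflow c u y x k (1 / t)" if "t \<noteq> 0" for t
      unfolding \<kappa>_def by (rule lineflow_mem(2)[OF x y xy ux that])
    ultimately show ?thesis
      using entire_inversion_affine[of "lineflow c u x y k" "lineflow c u y x k" \<kappa>]
      unfolding N_def N'_def by (metis vec_lambda_beta)
  qed
  then have "\<forall>k. \<exists>b. (\<forall>t. N t $ k = N 0 $ k + t * b) \<and> b = \<kappa> * N' 0 $ k" by blast
  from choice[OF this] obtain b
    where b: "\<And>k t. N t $ k = N 0 $ k + t * b k" "\<And>k. b k = \<kappa> * N' 0 $ k" by blast
  define A where "A = N 0"
  define B where "B = (\<chi> k. b k)"
  have AB: "N t = A + t *s B" for t using b(1)[of t] by (simp add: A_def B_def vec_eq_iff)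
  have mem: "A + t *s B \<in> f (proj_point (x + t *s y))" for t
    using lineflow_mem(1)[OF x y xy ux] by (simp add: AB[symmetric] N_def)
  \<comment> \<open>The point y is the point at infinity of the parameter t, and the slope B is the
    value of the section there.\<close>
  have "N' 0 \<in> f (proj_point (y + 0 *s x))"
    unfolding N'_def by (rule lineflow_mem(1)[OF y x yx ux(2,1)])
  moreover have "B = \<kappa> *s N' 0" using b(2) by (simp add: B_def vec_eq_iff)
  ultimately have memB: "B \<in> f (proj_point y)"
  proof -
    assume 1: "N' 0 \<in> f (proj_point (y + 0 *s x))" "B = \<kappa> *s N' 0"
    obtain Z where "f (proj_point y) = proj_point Z"
      using f_in y Dpq_cases proj_point_in_Dpq by metis
    then show ?thesis using 1 by (auto simp: mem_proj_point)
  qed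
  have eq: "f (proj_point z) = proj_point v" if v: "v \<in> f (proj_point z)" "v \<noteq> 0" "herm_form z > 0" for v z
  proof -
    obtain Z where "f (proj_point z) = proj_point Z"
      using f_in v(3) Dpq_cases proj_point_in_Dpq by metis
    then show ?thesis using v proj_point_mem_eq by metis
  qed
  have px: "herm_form (x + t *s y) > 0" for t using p[of 1 t] by simp
  have inj: "t = t'" if eqt: "f (proj_point (x + t *s y)) = f (proj_point (x + t' *s y))" for t t'
  proof -
    have "proj_point (x + t *s y) = proj_point (x + t' *s y)" using f_inj px eqt by blast
    moreover have "x + t' *s y \<noteq> 0" using px[of t'] by auto
    ultimately obtain r where r: "x + t *s y = r *s (x + t' *s y)" using proj_point_eq_iff by metis
    have "herm x (x + t *s y) = herm x (r *s (x + t' *s y))" "herm y (x + t *s y) = herm y (r *s (x + t' *s y))"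
      using r by simp_all
    then show "t = t'" using hx by (simp add: herm_simps xy yx)
  qed
  have A0: "A \<noteq> 0" using c[of y] by (simp add: A_def N_def)
  \<comment> \<open>With B = 0 the map f would be constant on the line.\<close>
  have B0: "B \<noteq> 0"
  proof
    assume "B = 0"
    then have "f (proj_point (x + 0 *s y)) = proj_point A" "f (proj_point (x + 1 *s y)) = proj_point A"
      using eq[OF mem[of 0]] eq[OF mem[of 1]] A0 px[of 0] px[of 1] by simp_all
    then show False using inj[of 0 1] by simp
  qed
  have AB0: "A + t *s B \<noteq> 0" for t
  proof
    assume 0: "A + t *s B = 0"
    then have "t \<noteq> 0" using A0 by auto
    \<comment> \<open>If A + t B = 0, then A + 2 t B = -A represents the same point as A, so f would
      take equal values at the parameters 2 t and 0.\<close>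
    have "A + (2 * t) *s B = 2 *s (A + t *s B) + (- 1) *s A"
      by (simp only: vec_eq_iff vector_add_component vector_smult_component) (simp add: algebra_simps)
    then have 2: "A + (2 * t) *s B = (- 1) *s A" using 0 by simp
    have "A + (2 * t) *s B \<noteq> 0" unfolding 2 using A0 by simp
    then have "f (proj_point (x + (2 * t) *s y)) = proj_point (A + (2 * t) *s B)"
      using eq[OF mem _ px] by blast
    also have "\<dots> = proj_point A" unfolding 2 by (rule proj_point_scale) simp
    also have "\<dots> = f (proj_point (x + 0 *s y))" using eq[OF mem[of 0] _ px[of 0]] A0 by simp
    finally show False using inj[of "2 * t" 0] \<open>t \<noteq> 0\<close> by simp
  qed
  show ?thesis
  proof (rule that[of A B])
    fix s t :: complex assume st: "(s, t) \<noteq> (0, 0)"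
    have "s *s A + t *s B \<noteq> 0 \<and> f (proj_point (s *s x + t *s y)) = proj_point (s *s A + t *s B)"
    proof (cases "s = 0")
      case True
      then have "t \<noteq> 0" using st by simp
      moreover have "f (proj_point y) = proj_point B" by (rule eq[OF memB B0 y])
      ultimately show ?thesis using True B0 by (simp add: proj_point_scale)
    next
      case False
      have "s *s x + t *s y = s *s (x + (t / s) *s y)" "s *s A + t *s B = s *s (A + (t / s) *s B)"
        using False by (simp_all add: vec_eq_iff algebra_simps)
      moreover have "f (proj_point (x + (t / s) *s y)) = proj_point (A + (t / s) *s B)"
        by (rule eq[OF mem AB0 px])
      moreover have "s *s (A + (t / s) *s B) \<noteq> 0" using False AB0[of "t / s"] by (metis vector_mul_eq_0)
      ultimately show ?thesis using False by (simp only: proj_point_scale not_False_eq_True simp_thms)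
    qed
    then show "s *s A + t *s B \<noteq> 0" "f (proj_point (s *s x + t *s y)) = proj_point (s *s A + t *s B)"
      by blast+
  qed
qed

text \<open>Replacing y by its component orthogonal to x keeps the span; undoing the change of basis
  turns B into B + c A.\<close>

lemma line_map:
  assumes "pos x y"
  obtains A B where "\<And>s t. (s, t) \<noteq> (0, 0) \<Longrightarrow> s *s A + t *s B \<noteq> 0"
    "\<And>s t. (s, t) \<noteq> (0, 0) \<Longrightarrow> f (proj_point (s *s x + t *s y)) = proj_point (s *s A + t *s B)"
proof -
  have p: "herm_form (s *s x + t *s y) > 0" if "(s, t) \<noteq> (0, 0)" for s t
    using assms that by (simp add: pos_def)
  have x: "herm_form x > 0" using p[of 1 0] by simp
  define c where "c = herm x y / herm x x"
  define y' where "y' = y - c *s x"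
  have "herm_form y' > 0" using p[of "- c" 1] by (simp add: y'_def algebra_simps vector_smult_lneg)
  moreover have "herm x y' = 0" using x by (simp add: y'_def c_def herm_simps herm_self)
  ultimately obtain A B where AB: "\<And>s t. (s, t) \<noteq> (0, 0) \<Longrightarrow> s *s A + t *s B \<noteq> 0"
    "\<And>s t. (s, t) \<noteq> (0, 0) \<Longrightarrow> f (proj_point (s *s x + t *s y')) = proj_point (s *s A + t *s B)"
    using line_map_orth[OF x] by metis
  show ?thesis
  proof (rule that[of A "B + c *s A"])
    fix s t :: complex assume st: "(s, t) \<noteq> (0, 0)"
    then have st': "(s + t * c, t) \<noteq> (0, 0)" by auto
    have 1: "s *s A + t *s (B + c *s A) = (s + t * c) *s A + t *s B"
      "s *s x + t *s y = (s + t * c) *s x + t *s y'"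
      by (simp_all add: y'_def vec_eq_iff algebra_simps)
    show "s *s A + t *s (B + c *s A) \<noteq> 0" unfolding 1 by (rule AB(1)[OF st'])
    show "f (proj_point (s *s x + t *s y)) = proj_point (s *s A + t *s (B + c *s A))"
      unfolding 1 by (rule AB(2)[OF st'])
  qed
qed

end

section \<open>Linearity when p is at least 2\<close>

text \<open>Completion of the square, with the Gram determinant of x and y in the second summand; it
  yields Sylvester's criterion for \<open>pos\<close>.\<close>

lemma herm_form_combination:
  "herm_form x * herm_form (s *s x + t *s y)
    = (cmod (s * herm_form x + t * herm x y))\<^sup>2
      + (cmod t)\<^sup>2 * (herm_form x * herm_form y - (cmod (herm x y))\<^sup>2)"
proof -
  have sq: "complex_of_real ((cmod z)\<^sup>2) = z * cnj z" for z by (rule complex_norm_square)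
  have "complex_of_real (herm_form x * herm_form (s *s x + t *s y))
    = herm x x * (cnj s * s * herm x x + cnj s * t * herm x y + cnj t * s * cnj (herm x y) + cnj t * t * herm y y)"
    unfolding of_real_mult herm_self[symmetric] herm_simps herm_commute[of y x] by (simp add: algebra_simps)
  also have "\<dots> = complex_of_real ((cmod (s * herm_form x + t * herm x y))\<^sup>2
      + (cmod t)\<^sup>2 * (herm_form x * herm_form y - (cmod (herm x y))\<^sup>2))"
    unfolding of_real_add of_real_mult of_real_diff sq herm_self by (simp add: algebra_simps)
  finally show ?thesis using of_real_eq_iff by blast
qed

lemma pos_iff: "pos x y \<longleftrightarrow> herm_form x > 0 \<and> herm_form x * herm_form y > (cmod (herm x y))\<^sup>2"
proof
  assume p: "pos x y"
  have x: "herm_form x > 0" using p[unfolded pos_def, rule_format, of 1 0] by simp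
  \<comment> \<open>These coefficients make the completed square vanish, so that only the Gram
    determinant is left.\<close>
  have "herm_form x * herm_form ((- herm x y / herm_form x) *s x + 1 *s y)
      = herm_form x * herm_form y - (cmod (herm x y))\<^sup>2"
    unfolding herm_form_combination using x by simp
  moreover have "herm_form ((- herm x y / herm_form x) *s x + 1 *s y) > 0"
    by (rule p[unfolded pos_def, rule_format]) simp
  ultimately show "herm_form x > 0 \<and> herm_form x * herm_form y > (cmod (herm x y))\<^sup>2"
    using x by (metis diff_gt_0_iff_gt mult_pos_pos)
next
  assume a: "herm_form x > 0 \<and> herm_form x * herm_form y > (cmod (herm x y))\<^sup>2"
  show "pos x y"
    unfolding pos_def
  proof (intro allI impI)
    fix s t :: complex assume st: "(s, t) \<noteq> (0, 0)"
    have "herm_form x * herm_form (s *s x + t *s y) > 0"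
    proof (cases "t = 0")
      case True
      then show ?thesis using a st by (simp add: herm_form_scale)
    next
      case False
      then have "(cmod t)\<^sup>2 * (herm_form x * herm_form y - (cmod (herm x y))\<^sup>2) > 0" using a by simp
      then show ?thesis unfolding herm_form_combination by (simp add: add_nonneg_pos)
    qed
    then show "herm_form (s *s x + t *s y) > 0" using a zero_less_mult_pos by blast
  qed
qed

lemma pos_sym: "pos x y \<Longrightarrow> pos y x"
  unfolding pos_def by (metis add.commute Pair_inject)

lemma pos_indep: "pos x y \<Longrightarrow> a *s x + b *s y = 0 \<Longrightarrow> a = 0 \<and> b = 0"
  unfolding pos_def by (metis Pair_inject herm_form_zero less_irrefl)

lemma open_pos: "open {w. pos x w}"
proof (cases "herm_form x > 0")
  case True
  have "open {w. (cmod (herm x w))\<^sup>2 < herm_form x * herm_form w}"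
    by (intro open_Collect_less continuous_intros)
  then show ?thesis using True by (simp add: pos_iff)
qed (simp add: pos_iff)

context proj_biholo
begin

text \<open>On the line, f[x + t w] = [F x + t B], while the lift is normalised by F_j = a. The
  minor identity F_i (F x + t B)_j = a (F x + t B)_i can therefore be differentiated at t = 0, and
  it expresses B by P w and F x.\<close>

lemma lift_deriv_along_line:
  assumes "pos x w" and \<Omega>: "open \<Omega>" "x \<in> \<Omega>"
    and F: "\<And>z. z \<in> \<Omega> \<Longrightarrow> f (proj_point z) = proj_point (F z)"
      "\<And>z. z \<in> \<Omega> \<Longrightarrow> F z $ j = a" "a \<noteq> 0" "(F has_derivative (*v) P) (at x)"
  obtains B \<beta> where "B = P *v w + \<beta> *s F x"
    "\<And>s t. (s, t) \<noteq> (0, 0) \<Longrightarrow> s *s F x + t *s B \<noteq> 0"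
    "\<And>s t. (s, t) \<noteq> (0, 0) \<Longrightarrow> f (proj_point (s *s x + t *s w)) = proj_point (s *s F x + t *s B)"
proof -
  obtain A1 B1 where AB: "\<And>s t. (s, t) \<noteq> (0, 0) \<Longrightarrow> s *s A1 + t *s B1 \<noteq> 0"
    "\<And>s t. (s, t) \<noteq> (0, 0) \<Longrightarrow> f (proj_point (s *s x + t *s w)) = proj_point (s *s A1 + t *s B1)"
    using line_map[OF assms(1)] by metis
  have "F x \<noteq> 0" using F(2)[OF \<Omega>(2)] F(3) by (metis zero_index)
  moreover have "proj_point A1 = proj_point (F x)" using AB(2)[of 1 0] F(1)[OF \<Omega>(2)] by simp
  ultimately obtain c where c: "c \<noteq> 0" "A1 = c *s F x" using proj_point_eq_iff by metis
  define B where "B = (1 / c) *s B1"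
  have sc: "s *s A1 + t *s B1 = c *s (s *s F x + t *s B)" for s t
    using c by (simp add: B_def vec_eq_iff algebra_simps)
  have B1: "s *s F x + t *s B \<noteq> 0" if "(s, t) \<noteq> (0, 0)" for s t
    using AB(1)[OF that] unfolding sc by (metis vector_smult_rzero)
  have B2: "f (proj_point (s *s x + t *s w)) = proj_point (s *s F x + t *s B)" if "(s, t) \<noteq> (0, 0)" for s t
    using AB(2)[OF that] c(1) unfolding sc by (simp only: proj_point_scale not_False_eq_True)
  define \<gamma> where "\<gamma> t = x + t *s w" for t
  have \<gamma>: "\<gamma> 0 = x" "cderiv \<gamma> w 0" unfolding \<gamma>_def by (simp, rule cderiv_affine)
  have F\<gamma>: "cderiv (\<lambda>t. F (\<gamma> t)) (P *v w) 0" using cderiv_chain[OF \<gamma>(2)] F(4) \<gamma>(1) by metis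
  have "(P *v w) $ i * a + F x $ i * B $ j = a * B $ i" for i
  proof -
    have "((\<lambda>t. F x $ i + t * B $ i) has_field_derivative B $ i) (at 0)" for i
      by (auto intro!: derivative_eq_intros)
    note D = this
    have D1: "((\<lambda>t. F (\<gamma> t) $ i * (F x $ j + t * B $ j)) has_field_derivative
        ((P *v w) $ i * F x $ j + B $ j * F x $ i)) (at 0)"
      using DERIV_mult[OF cderiv_nth[OF F\<gamma>] D] \<gamma>(1) by simp
    have D2: "((\<lambda>t. a * (F x $ i + t * B $ i)) has_field_derivative (a * B $ i)) (at 0)"
      using D by (rule DERIV_cmult)
    have "\<forall>\<^sub>F t in nhds 0. F (\<gamma> t) $ i * (F x $ j + t * B $ j) = a * (F x $ i + t * B $ i)"
    proof -
      have "\<forall>\<^sub>F t in nhds 0. \<gamma> t \<in> \<Omega>"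
        using cderiv_imp_isCont[OF \<gamma>(2)] \<Omega> \<gamma>(1) by (intro isCont_eventually_nhds) auto
      then show ?thesis
      proof eventually_elim
        case (elim t)
        have "proj_point (F (\<gamma> t)) = proj_point (F x + t *s B)"
          using F(1)[OF elim] B2[of 1 t] by (simp add: \<gamma>_def)
        from proj_point_eq_minor[OF this, of i j] show ?case using F(2)[OF elim] by simp
      qed
    qed
    from DERIV_cong_ev[OF refl this refl] D1
    have "((\<lambda>t. a * (F x $ i + t * B $ i)) has_field_derivative
        ((P *v w) $ i * F x $ j + B $ j * F x $ i)) (at 0)" by blast
    then have "(P *v w) $ i * F x $ j + B $ j * F x $ i = a * B $ i"
      using D2 DERIV_unique by blast
    then show ?thesis using F(2)[OF \<Omega>(2)] by (simp add: mult.commute)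
  qed
  then have "B = P *v w + (B $ j / a) *s F x" using F(3) by (simp add: vec_eq_iff field_simps)
  then show ?thesis using that B1 B2 by blast
qed

text \<open>W(F z) is a multiple of z. If P v = 0, then W(F(x + t v)) is stationary at t = 0, so the
  projective point [x + t v] is stationary as well, and v must be proportional to x.\<close>

lemma lift_deriv_kernel:
  assumes x: "herm_form x > 0" and \<Omega>: "open \<Omega>" "x \<in> \<Omega>"
    and F: "\<And>z. z \<in> \<Omega> \<Longrightarrow> f (proj_point z) = proj_point (F z)" "(F has_derivative (*v) P) (at x)"
    and v: "P *v v = 0"
  obtains c where "v = c *s x"
proof -
  have "herm_form (F x) > 0" using f_proj_point_pos[OF x F(1)[OF \<Omega>(2)]] .
  then obtain i W \<Omega>' where W: "open \<Omega>'" "F x \<in> \<Omega>'" "\<And>z. z \<in> \<Omega>' \<Longrightarrow> herm_form z > 0"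
    "\<And>z. z \<in> \<Omega>' \<Longrightarrow> h (proj_point z) = proj_point (W z)" "\<And>z. z \<in> \<Omega>' \<Longrightarrow> W z $ i = 1"
    "\<And>z. z \<in> \<Omega>' \<Longrightarrow> cdiff W z"
    using local_lift[OF h_holo] by metis
  obtain A where A: "(W has_derivative (*v) A) (at (F x))" using W(2,6) by (auto simp: cdiff_def)
  define \<gamma> where "\<gamma> t = x + t *s v" for t
  have \<gamma>: "\<gamma> 0 = x" "cderiv \<gamma> v 0" unfolding \<gamma>_def by (simp, rule cderiv_affine)
  have F\<gamma>: "cderiv (\<lambda>t. F (\<gamma> t)) 0 0" using cderiv_chain[OF \<gamma>(2)] F(2) \<gamma>(1) v by metis
  have W\<gamma>: "cderiv (\<lambda>t. W (F (\<gamma> t))) 0 0" using cderiv_chain[OF F\<gamma>] A \<gamma>(1) by (metis matrix_vector_mult_0_right)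
  have ev: "\<forall>\<^sub>F t in nhds 0. \<gamma> t \<in> \<Omega> \<inter> {z. herm_form z > 0}"
    by (rule isCont_eventually_nhds[OF cderiv_imp_isCont[OF \<gamma>(2)]])
      (simp_all add: open_Int \<Omega> open_herm_form_pos \<gamma>(1) x)
  have ev': "\<forall>\<^sub>F t in nhds 0. F (\<gamma> t) \<in> \<Omega>'"
    by (rule isCont_eventually_nhds[OF cderiv_imp_isCont[OF F\<gamma>] W(1)]) (simp add: \<gamma>(1) W(2))
  \<comment> \<open>W has i-th coordinate 1, so the minor identity with index i is free of the
    unknown factor.\<close>
  have eq: "\<forall>\<^sub>F t in nhds 0. W (F (\<gamma> t)) $ m * \<gamma> t $ i = \<gamma> t $ m" for m
    using ev ev'
  proof eventually_elim
    case (elim t)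
    have "proj_point (W (F (\<gamma> t))) = proj_point (\<gamma> t)"
      using W(4)[OF elim(2)] F(1)[of "\<gamma> t"] elim(1) hf by (metis IntE mem_Collect_eq proj_point_in_Dpq)
    from proj_point_eq_minor[OF this, of m i] show ?case using W(5)[OF elim(2)] by simp
  qed
  have "v $ m = v $ i * W (F x) $ m" for m
  proof -
    have "((\<lambda>t. W (F (\<gamma> t)) $ m * \<gamma> t $ i) has_field_derivative v $ i * W (F x) $ m) (at 0)"
      using DERIV_mult[OF cderiv_nth[OF W\<gamma>] cderiv_nth[OF \<gamma>(2)]] \<gamma>(1) by simp
    then have "((\<lambda>t. \<gamma> t $ m) has_field_derivative v $ i * W (F x) $ m) (at 0)"
      using DERIV_cong_ev[OF refl eq refl] by blast
    then show ?thesis using cderiv_nth[OF \<gamma>(2)] DERIV_unique by blast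
  qed
  moreover have "W (F x) $ m * x $ i = x $ m" for m
    using eventually_nhds_x_imp_x[OF eq[of m]] \<gamma>(1) by simp
  ultimately have 1: "v $ m * x $ i = v $ i * x $ m" for m by (metis mult.assoc)
  have "x $ i \<noteq> 0"
  proof
    assume "x $ i = 0"
    then have "x = 0" using \<open>\<And>m. W (F x) $ m * x $ i = x $ m\<close> by (simp add: vec_eq_iff)
    then show False using x by simp
  qed
  then have "v = (v $ i / x $ i) *s x" using 1 by (simp add: vec_eq_iff field_simps)
  then show ?thesis using that by blast
qed

text \<open>Expansions at two points are comparable only if their representatives are tied together;
  a constant rescaling lets the lift at y start from the vector A0 already found on the line
  xy.\<close>

lemma scaled_lift:
  assumes "herm_form z0 > 0" "f (proj_point z0) = proj_point A" "A \<noteq> 0"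
  obtains j F \<Omega> a P where "open \<Omega>" "z0 \<in> \<Omega>" "\<And>z. z \<in> \<Omega> \<Longrightarrow> f (proj_point z) = proj_point (F z)"
    "\<And>z. z \<in> \<Omega> \<Longrightarrow> F z $ j = a" "a \<noteq> 0" "(F has_derivative (*v) P) (at z0)" "F z0 = A"
proof -
  obtain j F \<Omega> where F: "open \<Omega>" "z0 \<in> \<Omega>" "\<And>z. z \<in> \<Omega> \<Longrightarrow> herm_form z > 0"
    "\<And>z. z \<in> \<Omega> \<Longrightarrow> f (proj_point z) = proj_point (F z)" "\<And>z. z \<in> \<Omega> \<Longrightarrow> F z $ j = 1"
    "\<And>z. z \<in> \<Omega> \<Longrightarrow> cdiff F z"
    using local_lift[OF f_holo assms(1)] by metis
  have "F z0 \<noteq> 0" using F(5)[OF F(2)] by auto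
  then obtain c where c: "c \<noteq> 0" "A = c *s F z0" using assms(2) F(4)[OF F(2)] proj_point_eq_iff by metis
  obtain P where P: "(F has_derivative (*v) P) (at z0)" using F(2,6) by (auto simp: cdiff_def)
  have "((\<lambda>z. c *s F z) has_derivative (\<lambda>v. c *s (P *v v))) (at z0)"
    using bounded_linear.has_derivative[OF bounded_bilinear.bounded_linear_right[OF bounded_bilinear_vec_smult] P] .
  moreover obtain P' where "\<And>v. P' *v v = c *s (P *v v)"
    by (rule complex_linear_matrix[of "\<lambda>v. c *s (P *v v)"])
      (auto simp: matrix_vector_right_distrib vector_scalar_commute vec_eq_iff algebra_simps)
  then have "(\<lambda>v. c *s (P *v v)) = (*v) P'" by auto
  ultimately have "((\<lambda>z. c *s F z) has_derivative (*v) P') (at z0)" by (simp only:)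
  then show ?thesis
    using that[of \<Omega> "\<lambda>z. c *s F z" j c P'] F c by (simp add: proj_point_scale)
qed

text \<open>The lines xw and yw give f[w] = [B] = [C] with B = P w + \<beta> A, C = Q w + \<gamma>
  A0 and C = \<mu> B. A third line, from x to y + t w, forces \<mu> = 1, so the two representatives
  agree as vectors. Comparing coefficients there needs x, y, w independent, whence the exclusion of
  the span of x and y.\<close>

lemma linear_on_common_neighbours:
  assumes xy: "pos x y"
  obtains T :: "complex^('p + 'q)^('p + 'q)" where
    "\<And>w. pos x w \<Longrightarrow> pos y w \<Longrightarrow> (\<And>a b. w \<noteq> a *s x + b *s y) \<Longrightarrow> f (proj_point w) = proj_point (T *v w) \<and> T *v w \<noteq> 0"
proof -
  have x: "herm_form x > 0" using xy pos_iff by blast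
  have y: "herm_form y > 0" using pos_sym[OF xy] pos_iff by blast
  obtain A where A: "f (proj_point x) = proj_point A" "A \<noteq> 0"
    using f_in x Dpq_cases proj_point_in_Dpq by metis
  obtain j F \<Omega> a P where F: "open \<Omega>" "x \<in> \<Omega>" "\<And>z. z \<in> \<Omega> \<Longrightarrow> f (proj_point z) = proj_point (F z)"
    "\<And>z. z \<in> \<Omega> \<Longrightarrow> F z $ j = a" "a \<noteq> 0" "(F has_derivative (*v) P) (at x)" "F x = A"
    using scaled_lift[OF x A] by metis
  note lineF = lift_deriv_along_line[OF _ F(1-6), unfolded F(7)]
  obtain A0 \<beta>0 where A0: "A0 = P *v y + \<beta>0 *s A"
    "\<And>s t. (s, t) \<noteq> (0, 0) \<Longrightarrow> s *s A + t *s A0 \<noteq> 0"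
    "\<And>s t. (s, t) \<noteq> (0, 0) \<Longrightarrow> f (proj_point (s *s x + t *s y)) = proj_point (s *s A + t *s A0)"
    using lineF[OF xy] by metis
  have fy: "f (proj_point y) = proj_point A0" "A0 \<noteq> 0" using A0(2,3)[of 0 1] by simp_all
  obtain j' G \<Omega>' a' Q where G: "open \<Omega>'" "y \<in> \<Omega>'" "\<And>z. z \<in> \<Omega>' \<Longrightarrow> f (proj_point z) = proj_point (G z)"
    "\<And>z. z \<in> \<Omega>' \<Longrightarrow> G z $ j' = a'" "a' \<noteq> 0" "(G has_derivative (*v) Q) (at y)" "G y = A0"
    using scaled_lift[OF y fy] by metis
  note lineG = lift_deriv_along_line[OF _ G(1-6), unfolded G(7)]
  have Aj: "A $ j = a" using F(2,4,7) by blast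
  \<comment> \<open>F keeps its j-th coordinate constant, so the range of P lies in the hyperplane
    where this coordinate is 0, while \<open>A $ j = a\<close> is nonzero: the coordinate separates
    A from the range of P.\<close>
  have Pj: "(P *v v) $ j = 0" for v
  proof -
    have 1: "cderiv (\<lambda>t. F (x + t *s v)) (P *v v) 0"
      using cderiv_chain[OF cderiv_affine[of x v 0], of F P] F(6) by simp
    have "\<forall>\<^sub>F t in nhds 0. x + t *s v \<in> \<Omega>"
      using cderiv_imp_isCont[OF cderiv_affine[of x v 0]] F(1,2) by (intro isCont_eventually_nhds) auto
    then have ev: "\<forall>\<^sub>F t in nhds 0. F (x + t *s v) $ j = a" by eventually_elim (rule F(4))
    have "((\<lambda>t. a) has_field_derivative (P *v v) $ j) (at 0)"
      using cderiv_nth[OF 1, of j] DERIV_cong_ev[OF refl ev refl] by blast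
    then show ?thesis using DERIV_const DERIV_unique by blast
  qed
  have kernel: "\<exists>c. v = c *s x" if "P *v v = 0" for v
    using lift_deriv_kernel[OF x F(1,2,3,6) that] by metis
  have "P *v y \<noteq> 0"
  proof
    assume "P *v y = 0"
    then obtain c where "y = c *s x" using kernel by blast
    then have "c *s x + (- 1) *s y = 0" by (simp add: vec_eq_iff)
    then show False using pos_indep[OF xy] by fastforce
  qed
  then obtain m where m: "(P *v y) $ m \<noteq> 0" by (auto simp: vec_eq_iff)
  \<comment> \<open>The derivatives P at x and Q at y give a representative of f[w] in the two forms
    P w + \<beta> A and Q w + \<gamma> A0. The functional \<alpha> with \<alpha> A = 1 and \<alpha> A0 = 0 reads off \<beta>,
    which is therefore linear in w.\<close>
  define \<alpha> where "\<alpha> v = v $ j / a - \<beta>0 * (v $ m - A $ m * v $ j / a) / (P *v y) $ m" for v :: "complex^('p + 'q)"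
  have \<alpha>A: "\<alpha> A = 1" using F(5) by (simp add: \<alpha>_def Aj)
  have \<alpha>A0: "\<alpha> A0 = 0" using F(5) m by (simp add: \<alpha>_def A0(1) Aj Pj)
  have \<alpha>_add: "\<alpha> (u + v) = \<alpha> u + \<alpha> v" for u v
    by (simp add: \<alpha>_def distrib_left right_diff_distrib add_divide_distrib diff_divide_distrib)
  have \<alpha>_scale: "\<alpha> (c *s v) = c * \<alpha> v" for c v
    by (simp add: \<alpha>_def right_diff_distrib)
  define D where "D w = P *v w + (\<alpha> (Q *v w) - \<alpha> (P *v w)) *s A" for w
  have "D (u + v) = D u + D v" "D (c *s v) = c *s D v" for u v c
    by (simp_all add: D_def matrix_vector_right_distrib vector_scalar_commute \<alpha>_add \<alpha>_scale
        vec_eq_iff algebra_simps)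
  then obtain T where T: "\<And>w. T *v w = D w"
    using complex_linear_matrix[of D] by blast
  have "f (proj_point w) = proj_point (T *v w) \<and> T *v w \<noteq> 0"
    if xw: "pos x w" and yw: "pos y w" and nspan: "\<And>a b. w \<noteq> a *s x + b *s y" for w
  proof -
    obtain B \<beta> where B: "B = P *v w + \<beta> *s A" "\<And>s t. (s, t) \<noteq> (0, 0) \<Longrightarrow> s *s A + t *s B \<noteq> 0"
      "\<And>s t. (s, t) \<noteq> (0, 0) \<Longrightarrow> f (proj_point (s *s x + t *s w)) = proj_point (s *s A + t *s B)"
      using lineF[OF xw] by metis
    obtain C \<gamma> where C: "C = Q *v w + \<gamma> *s A0" "\<And>s t. (s, t) \<noteq> (0, 0) \<Longrightarrow> s *s A0 + t *s C \<noteq> 0"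
      "\<And>s t. (s, t) \<noteq> (0, 0) \<Longrightarrow> f (proj_point (s *s y + t *s w)) = proj_point (s *s A0 + t *s C)"
      using lineG[OF yw] by metis
    have B0: "B \<noteq> 0" using B(2)[of 0 1] by simp
    have "proj_point C = proj_point B" using B(3)[of 0 1] C(3)[of 0 1] by simp
    then obtain \<mu> where \<mu>: "\<mu> \<noteq> 0" "C = \<mu> *s B" using proj_point_eq_iff[OF B0] by blast
    have "\<forall>\<^sub>F t in nhds 0. y + t *s w \<in> {v. pos x v}"
      using cderiv_imp_isCont[OF cderiv_affine[of y w 0]] open_pos xy by (intro isCont_eventually_nhds) auto
    then obtain d where d: "d > 0" "\<And>t. dist t 0 < d \<Longrightarrow> pos x (y + t *s w)"
      unfolding eventually_nhds_metric by auto
    \<comment> \<open>Small and nonzero: by openness x and y + t w still span a line in the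
      domain.\<close>
    define t where "t = complex_of_real (d / 2)"
    have t: "t \<noteq> 0" "pos x (y + t *s w)" using d(1) by (auto simp: t_def intro!: d(2))
    obtain E \<epsilon> where E: "E = P *v (y + t *s w) + \<epsilon> *s A" "\<And>s t. (s, t) \<noteq> (0, 0) \<Longrightarrow> s *s A + t *s E \<noteq> 0"
      "\<And>s r. (s, r) \<noteq> (0, 0) \<Longrightarrow> f (proj_point (s *s x + r *s (y + t *s w))) = proj_point (s *s A + r *s E)"
      using lineF[OF t(2)] by metis
    have "proj_point E = f (proj_point (y + t *s w))" using E(3)[of 0 1] by simp
    also have "\<dots> = proj_point (A0 + t *s C)" using C(3)[of 1 t] by simp
    finally have "\<exists>k. E = k *s (A0 + t *s C)" using proj_point_self[of E] mem_proj_point by metis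
    then obtain k where k: "E = k *s (A0 + t *s C)" by blast
    have eq: "P *v y + t *s (P *v w) + \<epsilon> *s A = k *s (P *v y + \<beta>0 *s A + (t * \<mu>) *s (P *v w + \<beta> *s A))"
      using k unfolding E(1) A0(1) \<mu>(2) B(1)
      by (simp only: matrix_vector_right_distrib vector_scalar_commute vector_smult_assoc)
    \<comment> \<open>The j-th coordinate sees only the multiples of A; once \<epsilon> is known,
      the rest of the equation lies in the range of P.\<close>
    have "\<epsilon> = k * (\<beta>0 + t * \<mu> * \<beta>)"
    proof -
      have "(P *v y + t *s (P *v w) + \<epsilon> *s A) $ j = (k *s (P *v y + \<beta>0 *s A + (t * \<mu>) *s (P *v w + \<beta> *s A))) $ j"
        using eq by simp
      then have "t * 0 + \<epsilon> * a = k * (\<beta>0 * a + (t * \<mu>) * (\<beta> * a))"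
        by (simp only: vector_add_component vector_smult_component Pj Aj add_0)
      then have "(\<epsilon> - k * (\<beta>0 + t * \<mu> * \<beta>)) * a = 0" by algebra
      then show ?thesis using F(5) by simp
    qed
    with eq have "(1 - k) *s (P *v y) + (t * (1 - k * \<mu>)) *s (P *v w) = 0"
      by (simp add: vec_eq_iff algebra_simps)
    then have "P *v ((1 - k) *s y + (t * (1 - k * \<mu>)) *s w) = 0"
      by (simp only: matrix_vector_right_distrib vector_scalar_commute)
    then obtain c where c: "(1 - k) *s y + (t * (1 - k * \<mu>)) *s w = c *s x" using kernel by blast
    \<comment> \<open>A nonzero coefficient would let w be solved for in terms of x and y, against
      \<open>nspan\<close>.\<close>
    have k\<mu>: "t * (1 - k * \<mu>) = 0"
    proof (rule ccontr)
      define r where "r = t * (1 - k * \<mu>)"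
      assume "t * (1 - k * \<mu>) \<noteq> 0"
      then have r: "r \<noteq> 0" by (simp add: r_def)
      have "w = (c / r) *s x + (- (1 - k) / r) *s y"
      proof -
        have "w $ i = c / r * x $ i + - (1 - k) / r * y $ i" for i
        proof -
          have "(1 - k) * y $ i + r * w $ i = c * x $ i"
            using arg_cong[OF c, of "\<lambda>v. v $ i"] unfolding r_def
            by (simp only: vector_add_component vector_smult_component)
          then have "w $ i = (c * x $ i - (1 - k) * y $ i) / r"
            using r by (simp add: eq_divide_eq algebra_simps)
          then show ?thesis using r by (simp add: field_simps)
        qed
        then show ?thesis by (simp add: vec_eq_iff)
      qed
      then show False using nspan by blast
    qed
    have "(- c) *s x + (1 - k) *s y = 0" using c unfolding k\<mu> by (simp add: vector_smult_lneg)
    then have "k = 1" using pos_indep[OF xy] by fastforce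
    then have "\<mu> = 1" using k\<mu> t(1) by simp
    then have "P *v w + \<beta> *s A = Q *v w + \<gamma> *s A0" using \<mu>(2) B(1) C(1) by simp
    then have "\<alpha> (P *v w + \<beta> *s A) = \<alpha> (Q *v w + \<gamma> *s A0)" by simp
    then have "\<beta> = \<alpha> (Q *v w) - \<alpha> (P *v w)" by (simp add: \<alpha>_add \<alpha>_scale \<alpha>A \<alpha>A0 algebra_simps)
    then have "T *v w = B" using T B(1) by (simp add: D_def)
    then show ?thesis using B(3)[of 0 1] B0 by simp
  qed
  then show ?thesis using that by blast
qed

text \<open>If T v = 0, then w0 and w0 + t v have the same image, so w0 + t v = c w0 by injectivity
  of f; applying T, which does not kill w0, gives c = 1.\<close>

lemma linear_injective:
  assumes U: "open U" "w0 \<in> U" "\<And>w. w \<in> U \<Longrightarrow> herm_form w > 0"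
    "\<And>w. w \<in> U \<Longrightarrow> f (proj_point w) = proj_point (T *v w) \<and> T *v w \<noteq> 0"
    and v: "T *v v = 0"
  shows "v = 0"
proof -
  have "\<forall>\<^sub>F t in nhds 0. w0 + t *s v \<in> U"
    using cderiv_imp_isCont[OF cderiv_affine[of w0 v 0]] U by (intro isCont_eventually_nhds) auto
  then obtain d where d: "d > 0" "\<And>t. dist t 0 < d \<Longrightarrow> w0 + t *s v \<in> U"
    unfolding eventually_nhds_metric by auto
  define t where "t = complex_of_real (d / 2)"
  have t: "t \<noteq> 0" "w0 + t *s v \<in> U" using d(1) by (auto simp: t_def intro!: d(2))
  have "T *v (w0 + t *s v) = T *v w0" by (simp add: matrix_vector_right_distrib vector_scalar_commute v)
  then have "f (proj_point (w0 + t *s v)) = f (proj_point w0)" using U t by simp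
  then have "proj_point (w0 + t *s v) = proj_point w0" using f_inj U t by blast
  moreover have "w0 \<noteq> 0" using U by fastforce
  ultimately obtain c where c: "w0 + t *s v = c *s w0" using proj_point_eq_iff by metis
  have "T *v w0 = c *s (T *v w0)"
    using \<open>T *v (w0 + t *s v) = T *v w0\<close> unfolding c by (simp add: vector_scalar_commute)
  then have "(1 - c) *s (T *v w0) = 0" by (simp add: vec_eq_iff algebra_simps)
  then have "1 - c = 0" using U(4)[OF U(2)] by (metis vector_mul_eq_0)
  then have "c = 1" by simp
  then have "t *s v = 0" using c by simp
  then show ?thesis using t(1) by simp
qed

text \<open>It is not known beforehand that T z lies in the span of A and B. Adding the relations at
  the parameters t and -t eliminates T z, and independence of A and B then yields one factor with T
  w = k A and T z = k B.\<close>

lemma linear_extend: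
  assumes U: "open U" "w \<in> U" "\<And>w. w \<in> U \<Longrightarrow> f (proj_point w) = proj_point (T *v w)"
    and T: "\<And>v. T *v v = 0 \<Longrightarrow> v = 0" and zw: "pos z w"
  shows "f (proj_point z) = proj_point (T *v z)"
proof -
  obtain A B where AB: "\<And>s t. (s, t) \<noteq> (0, 0) \<Longrightarrow> s *s A + t *s B \<noteq> 0"
    "\<And>s t. (s, t) \<noteq> (0, 0) \<Longrightarrow> f (proj_point (s *s w + t *s z)) = proj_point (s *s A + t *s B)"
    using line_map[OF pos_sym[OF zw]] by metis
  have indep: "a = 0 \<and> b = 0" if "a *s A + b *s B = 0" for a b using AB(1)[of a b] that by auto
  have "\<forall>\<^sub>F t in nhds 0. w + t *s z \<in> U"
    using cderiv_imp_isCont[OF cderiv_affine[of w z 0]] U by (intro isCont_eventually_nhds) auto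
  then obtain d where d: "d > 0" "\<And>t. dist t 0 < d \<Longrightarrow> w + t *s z \<in> U"
    unfolding eventually_nhds_metric by auto
  have k: "\<exists>k. T *v w + t *s (T *v z) = k *s (A + t *s B)" if "dist t 0 < d" for t
  proof -
    have "proj_point (T *v (w + t *s z)) = proj_point (A + t *s B)"
      using AB(2)[of 1 t] U(3)[OF d(2)[OF that]] by simp
    then show ?thesis using proj_point_self[of "T *v (w + t *s z)"]
      by (simp only: mem_proj_point matrix_vector_right_distrib vector_scalar_commute)
  qed
  define t where "t = complex_of_real (d / 2)"
  have t: "t \<noteq> 0" "dist t 0 < d" "dist (- t) 0 < d" using d(1) by (auto simp: t_def)
  obtain k0 where k0: "T *v w = k0 *s A" using k[of 0] d(1) by auto
  obtain k1 where k1: "T *v w + t *s (T *v z) = k1 *s (A + t *s B)" using k t by blast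
  obtain k2 where k2: "T *v w + (- t) *s (T *v z) = k2 *s (A + (- t) *s B)" using k t by blast
  have "(k1 + k2 - 2 * k0) *s A + (t * (k1 - k2)) *s B = 0"
  proof -
    have "(k0 * A $ i + t * (T *v z) $ i) + (k0 * A $ i - t * (T *v z) $ i)
        = k1 * (A $ i + t * B $ i) + k2 * (A $ i - t * B $ i)" for i
      using arg_cong[OF k1, of "\<lambda>v. v $ i"] arg_cong[OF k2, of "\<lambda>v. v $ i"] unfolding k0
      by (simp add: algebra_simps)
    then show ?thesis by (simp add: vec_eq_iff algebra_simps)
  qed
  then have "k1 + k2 - 2 * k0 = 0" "k1 = k2" using indep t(1) by fastforce+
  then have "k1 = k0" by simp
  then have "t *s (T *v z) = (t * k1) *s B" using k1 k0 by (simp add: vec_eq_iff algebra_simps)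
  then have Tz: "T *v z = k1 *s B" using t(1) by (simp add: vec_eq_iff)
  have "z \<noteq> 0" using pos_sym[OF zw] zw by (auto simp: pos_iff)
  then have "k1 \<noteq> 0" using T Tz by auto
  then show ?thesis using Tz AB(2)[of 0 1] by (simp add: proj_point_scale)
qed

text \<open>T is found on the open set \<open>U0\<close> of points joined to e1 and to e2 by lines
  in the domain. Spreading along such lines reaches e1 and e2, then the whole line e1 e2, then every
  positive z, since some nonzero vector in the span of e1 and e2 is orthogonal to z.\<close>

lemma projective_linear_rank_ge_2:
  assumes i12: "i1 \<noteq> (i2 :: 'p)"
  obtains T where "\<And>z. herm_form z > 0 \<Longrightarrow> f (proj_point z) = proj_point (T *v z)"
    "\<And>v. T *v v = 0 \<Longrightarrow> v = 0"
proof -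
  define l where "l = (undefined :: 'q)"
  define e1 :: "complex^('p + 'q)" where "e1 = axis (Inl i1) 1"
  define e2 :: "complex^('p + 'q)" where "e2 = axis (Inl i2) 1"
  define e3 :: "complex^('p + 'q)" where "e3 = axis (Inr l) 1"
  have h1: "herm e1 v = v $ Inl i1" and h2: "herm e2 v = v $ Inl i2" and h3: "herm e3 v = - v $ Inr l" for v
    by (simp_all add: herm_def e1_def e2_def e3_def cprod_axis_left Hpq_mult_nth)
  have ax: "e1 $ Inl i1 = 1" "e1 $ Inl i2 = 0" "e1 $ Inr l = 0" "e2 $ Inl i1 = 0" "e2 $ Inl i2 = 1"
    "e2 $ Inr l = 0" "e3 $ Inl i1 = 0" "e3 $ Inl i2 = 0" "e3 $ Inr l = 1"
    using i12 by (auto simp: e1_def e2_def e3_def axis_def)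
  have hf: "herm_form e1 = 1" "herm_form e2 = 1" by (simp_all add: herm_form_eq h1 h2 ax)
  have e12: "pos e1 e2" by (simp add: pos_iff hf h1 ax)
  obtain T where T: "\<And>w. pos e1 w \<Longrightarrow> pos e2 w \<Longrightarrow> (\<And>a b. w \<noteq> a *s e1 + b *s e2) \<Longrightarrow>
      f (proj_point w) = proj_point (T *v w) \<and> T *v w \<noteq> 0"
    using linear_on_common_neighbours[OF e12] by metis
  \<comment> \<open>The nonzero negative coordinate keeps w out of the span of e1 and e2.\<close>
  define U0 where "U0 = {w. pos e1 w} \<inter> {w. pos e2 w} \<inter> {w. w $ Inr l \<noteq> 0}"
  have U0: "open U0"
    unfolding U0_def using open_nth_neq[of "mat 1" "Inr l"] by (intro open_Int open_pos) simp
  \<comment> \<open>The square 4 + 4 - 1 = 7 of w0 exceeds 4, the squared modulus of its product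
    with e1 or e2, as \<open>pos_iff\<close> requires.\<close>
  define w0 where "w0 = 2 *s e1 + 2 *s e2 + e3"
  have "herm_form w0 = 7"
    by (simp add: herm_form_eq w0_def herm_simps h1 h2 h3 ax)
  then have p0: "pos e1 w0" "pos e2 w0" by (simp_all add: pos_iff hf h1 h2 w0_def ax)
  then have w0: "w0 \<in> U0" by (simp add: U0_def w0_def ax)
  have f0: "f (proj_point w) = proj_point (T *v w) \<and> T *v w \<noteq> 0" if "w \<in> U0" for w
    using that by (intro T) (auto simp: U0_def ax)
  have pos0: "herm_form w > 0" if "w \<in> U0" for w
    using that pos_sym[of e1 w] pos_iff[of w e1] by (auto simp: U0_def)
  have inj: "v = 0" if "T *v v = 0" for v
    by (rule linear_injective[OF U0 w0 pos0 f0 that])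
  have step: "open {z. \<exists>w\<in>U. pos z w} \<and> (\<forall>z. (\<exists>w\<in>U. pos z w) \<longrightarrow> f (proj_point z) = proj_point (T *v z))"
    if U: "open U" "\<And>w. w \<in> U \<Longrightarrow> f (proj_point w) = proj_point (T *v w)" for U
  proof
    have "{z. \<exists>w\<in>U. pos z w} = (\<Union>w\<in>U. {z. pos w z})" using pos_sym by auto
    moreover have "open (\<Union>w\<in>U. {z. pos w z})" by (intro open_UN ballI open_pos)
    ultimately show "open {z. \<exists>w\<in>U. pos z w}" by (simp only:)
    show "\<forall>z. (\<exists>w\<in>U. pos z w) \<longrightarrow> f (proj_point z) = proj_point (T *v z)"
      using linear_extend[OF U(1) _ U(2) inj] by blast
  qed
  define U1 where "U1 = {z. \<exists>w\<in>U0. pos z w}"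
  define U2 where "U2 = {z. \<exists>w\<in>U1. pos z w}"
  have U1: "open U1" "\<And>z. z \<in> U1 \<Longrightarrow> f (proj_point z) = proj_point (T *v z)"
    using step[OF U0] f0 unfolding U1_def by auto
  have U2: "open U2" "\<And>z. z \<in> U2 \<Longrightarrow> f (proj_point z) = proj_point (T *v z)"
    using step[OF U1] unfolding U2_def by auto
  have e1U: "e1 \<in> U1" "e2 \<in> U1" using p0 w0 by (auto simp: U1_def)
  \<comment> \<open>Such a vector is joined to e1 unless it is a multiple of e1, and then it is
    joined to e2.\<close>
  have *: "a *s e1 + b *s e2 \<in> U2" if "(a, b) \<noteq> (0, 0)" for a b
  proof -
    have hw: "herm_form (a *s e1 + b *s e2) = (cmod a)\<^sup>2 + (cmod b)\<^sup>2"
      using herm_form_add_orth[of "a *s e1" "b *s e2"] by (simp add: herm_simps h1 ax herm_form_scale hf)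
    have "pos e1 (a *s e1 + b *s e2) \<or> pos e2 (a *s e1 + b *s e2)"
      using that by (auto simp: pos_iff hw hf h1 h2 ax)
    then show ?thesis using e1U pos_sym unfolding U2_def by blast
  qed
  have "f (proj_point z) = proj_point (T *v z)" if z: "herm_form z > 0" for z
  proof -
    \<comment> \<open>Orthogonality to z is one linear equation for two unknowns.\<close>
    obtain a b where ab: "(a, b) \<noteq> (0, 0)" "a * cnj (z $ Inl i1) + b * cnj (z $ Inl i2) = 0"
    proof (cases "z $ Inl i1 = 0")
      case True then show ?thesis using that[of 1 0] by simp
    next
      case False then show ?thesis using that[of "- cnj (z $ Inl i2)" "cnj (z $ Inl i1)"] by simp
    qed
    define w where "w = a *s e1 + b *s e2"
    have "herm w z = 0"
    proof -
      have "herm z w = a * cnj (z $ Inl i1) + b * cnj (z $ Inl i2)"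
        by (simp add: w_def herm_simps herm_commute[of z e1] herm_commute[of z e2] h1 h2)
      then show ?thesis using ab(2) herm_commute[of w z] by simp
    qed
    moreover have "herm_form w > 0"
      using pos_def e12 ab(1) unfolding w_def by blast
    ultimately have "pos w z" using z by (simp add: pos_iff)
    then have "pos z w" by (rule pos_sym)
    moreover have "w \<in> U2" unfolding w_def by (rule *[OF ab(1)])
    ultimately show ?thesis using step[OF U2] by blast
  qed
  then show ?thesis using that inj by blast
qed

end

section \<open>The unitary decomposition\<close>

lemma unitary_iff: "B \<in> unitary_group \<longleftrightarrow> (\<forall>x y. cprod (B *v x) (B *v y) = cprod x y)"
proof
  assume "B \<in> unitary_group"
  then show "\<forall>x y. cprod (B *v x) (B *v y) = cprod x y"
    by (simp add: unitary_group_def cprod_adjoint matrix_vector_mul_assoc)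
next
  assume "\<forall>x y. cprod (B *v x) (B *v y) = cprod x y"
  then have "hermitian_transpose B ** B = mat 1"
    by (intro matrix_eqI_cprod) (simp add: cprod_adjoint matrix_vector_mul_assoc)
  then show "B \<in> unitary_group" by (simp add: unitary_group_def)
qed

lemma unitary_mult: "B \<in> unitary_group \<Longrightarrow> C \<in> unitary_group \<Longrightarrow> B ** C \<in> unitary_group"
  by (simp add: unitary_iff matrix_vector_mul_assoc[symmetric])

lemma unitary_one: "mat 1 \<in> unitary_group"
  by (simp add: unitary_iff)

lemma unitary_inverse:
  assumes "B \<in> unitary_group"
  obtains C where "C \<in> unitary_group" "B ** C = mat 1" "C ** B = mat 1"
proof -
  define C where "C = hermitian_transpose B"
  have C: "C ** B = mat 1" using assms by (simp add: C_def unitary_group_def)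
  then have C': "B ** C = mat 1" using matrix_left_right_inverse by blast
  have "cprod (C *v x) (C *v y) = cprod x y" for x y
  proof -
    have "cprod (C *v x) (C *v y) = cprod (B *v (C *v x)) (B *v (C *v y))"
      using assms by (simp add: unitary_iff)
    then show ?thesis by (simp add: matrix_vector_mul_assoc C')
  qed
  then have "C \<in> unitary_group" by (simp add: unitary_iff)
  then show ?thesis using that C C' by blast
qed

text \<open>The complex reflection along w = u - v, normalised by the factor that makes it map u to v.\<close>

lemma unitary_maps_unit_vector:
  fixes u v :: "complex^'n"
  assumes "norm u = 1" "norm v = 1"
  obtains B where "B \<in> unitary_group" "B *v u = v"
    "\<And>x. cprod u x = 0 \<Longrightarrow> cprod v x = 0 \<Longrightarrow> B *v x = x"
proof (cases "u = v")
  case True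
  then show ?thesis using that[of "mat 1"] unitary_one by simp
next
  case False
  define w where "w = u - v"
  define s where "s = cprod w u"
  have uu: "cprod u u = 1" "cprod v v = 1" using assms by (simp_all add: cprod_self)
  have s: "s = 1 - cprod v u" by (simp add: s_def w_def cprod_diff_left uu)
  \<comment> \<open>This identity makes the modified reflection unitary; it also shows s to be
    nonzero, since s = 0 would give w = 0.\<close>
  have ww: "cprod w w = s + cnj s"
    by (simp add: s w_def cprod_diff_left cprod_diff_right uu cprod_commute[of u v])
  have s0: "s \<noteq> 0"
  proof
    assume "s = 0"
    then have "cprod w w = 0" using ww by simp
    then have "w = 0" by (simp add: cprod_self)
    then show False using False by (simp add: w_def)
  qed
  define D where "D x = x - (cprod w x / s) *s w" for x
  have "D (x + y) = D x + D y" "D (c *s x) = c *s D x" for x y c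
    by (simp_all add: D_def cprod_add_right cprod_scale_right vec_eq_iff add_divide_distrib algebra_simps)
  then obtain B where B: "\<And>x. B *v x = D x" using complex_linear_matrix[of D] by blast
  have "cprod (D x) (D y) = cprod x y" for x y
  proof -
    have "cprod (D x) (D y) = cprod x y - cprod w y * cnj (cprod w x) * (1 / s + 1 / cnj s - cprod w w / (s * cnj s))"
      using s0 by (simp add: D_def cprod_diff_left cprod_diff_right cprod_scale_left cprod_scale_right
          cprod_commute[of x w] field_simps)
    also have "1 / s + 1 / cnj s - cprod w w / (s * cnj s) = 0"
      using s0 by (simp add: ww field_simps)
    finally show ?thesis by simp
  qed
  then have "B \<in> unitary_group" by (simp add: unitary_iff B)
  moreover have "B *v u = v" using s0 by (simp add: B D_def s_def w_def)
  moreover have "B *v x = x" if "cprod u x = 0" "cprod v x = 0" for x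
    using that by (simp add: B D_def w_def cprod_diff_left)
  ultimately show ?thesis using that by blast
qed

text \<open>The last clause protects basis vectors already treated: B moves nothing that is
  orthogonal to both u and the j-th axis.\<close>

lemma unitary_maps_to_axis:
  fixes u :: "complex^'n"
  obtains B where "B \<in> unitary_group" "B *v u = of_real (norm u) *s axis j 1"
    "\<And>x. cprod u x = 0 \<Longrightarrow> x $ j = 0 \<Longrightarrow> B *v x = x"
proof (cases "u = 0")
  case True
  then show ?thesis using that[of "mat 1"] unitary_one by simp
next
  case False
  define v where "v = of_real (1 / norm u) *s u"
  have "norm v = 1" using False by (simp add: v_def norm_vec_smult norm_divide)
  moreover have "norm (axis j 1 :: complex^'n) = 1"
  proof -
    have "complex_of_real ((norm (axis j 1 :: complex^'n))\<^sup>2) = 1"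
      unfolding cprod_self[symmetric] cprod_axis_left by (simp add: axis_def)
    then have "(norm (axis j 1 :: complex^'n))\<^sup>2 = 1" using of_real_eq_1_iff by blast
    then show ?thesis
      using norm_ge_zero[of "axis j 1 :: complex^'n"] unfolding power2_eq_1_iff by linarith
  qed
  ultimately obtain B where B: "B \<in> unitary_group" "B *v v = axis j 1"
    "\<And>x. cprod v x = 0 \<Longrightarrow> cprod (axis j 1) x = 0 \<Longrightarrow> B *v x = x"
    using unitary_maps_unit_vector[of v "axis j 1"] by metis
  have "u = of_real (norm u) *s v" using False by (simp add: v_def vec_eq_iff)
  then have "B *v u = of_real (norm u) *s axis j 1" using B(2) vector_scalar_commute by metis
  then show ?thesis
    using that[of B] B(1,3) by (simp add: v_def cprod_scale_left cprod_axis_left)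
qed

section \<open>Splitting into positive and negative coordinates\<close>

definition upper :: "complex^('p::finite + 'q::finite) \<Rightarrow> complex^'p" where
  "upper z = (\<chi> i. z $ Inl i)"

definition lower :: "complex^('p::finite + 'q::finite) \<Rightarrow> complex^'q" where
  "lower z = (\<chi> i. z $ Inr i)"

lemma upper_nth [simp]: "upper z $ i = z $ Inl i"
  by (simp add: upper_def)

lemma lower_nth [simp]: "lower z $ k = z $ Inr k"
  by (simp add: lower_def)

lemma herm_split: "herm x y = cprod (upper x) (upper y) - cprod (lower x) (lower y)"
  by (simp add: herm_expand cprod_def)

lemma herm_form_split: "herm_form x = (norm (upper x))\<^sup>2 - (norm (lower x))\<^sup>2"
proof -
  have "complex_of_real (herm_form x) = of_real ((norm (upper x))\<^sup>2 - (norm (lower x))\<^sup>2)"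
    by (simp only: herm_self[symmetric] herm_split cprod_self of_real_diff)
  then show ?thesis using of_real_eq_iff by blast
qed

lemma block_diag_Inl: "(block_diag B C *v z) $ Inl i = (B *v upper z) $ i"
  and block_diag_Inr: "(block_diag B C *v z) $ Inr k = (C *v lower z) $ k"
  by (simp_all add: matrix_vector_mult_def sum_UNIV_Plus block_diag_def)

lemma upper_block_diag: "upper (block_diag B C *v z) = B *v upper z"
  and lower_block_diag: "lower (block_diag B C *v z) = C *v lower z"
  by (simp_all add: vec_eq_iff block_diag_Inl block_diag_Inr)

lemma vec_eq_upper_lower: "x = y \<longleftrightarrow> upper x = upper y \<and> lower x = lower y"
proof
  assume eq: "upper x = upper y \<and> lower x = lower y"
  have "x $ i = y $ i" for i
    using eq by (cases i) (simp_all add: vec_eq_iff)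
  then show "x = y" by (simp add: vec_eq_iff)
qed auto

definition K_group :: "(complex^('p::finite + 'q::finite)^('p + 'q)) set" where
  "K_group = {block_diag B C | B C. B \<in> unitary_group \<and> C \<in> unitary_group}"

lemma UpxUq_auts_eq: "UpxUq_auts = induced_map Dpq ` K_group"
  by (auto simp: UpxUq_auts_def K_group_def)

lemma K_group_U_pq: "k \<in> K_group \<Longrightarrow> k \<in> U_pq"
  by (auto simp: K_group_def U_pq_iff herm_split upper_block_diag lower_block_diag unitary_iff)

lemma block_diag_mult: "block_diag A B ** block_diag C D = block_diag (A ** C) (B ** D)"
  unfolding matrix_eq matrix_vector_mul_assoc[symmetric] vec_eq_upper_lower
    upper_block_diag lower_block_diag by simp

lemma block_diag_one: "block_diag (mat 1) (mat 1) = mat 1"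
  unfolding matrix_eq vec_eq_upper_lower upper_block_diag lower_block_diag by simp

lemma K_group_mult: "k \<in> K_group \<Longrightarrow> k' \<in> K_group \<Longrightarrow> k ** k' \<in> K_group"
  unfolding K_group_def by (clarsimp simp: block_diag_mult) (blast intro: unitary_mult)

lemma K_group_one: "mat 1 \<in> K_group"
  unfolding K_group_def using block_diag_one unitary_one by (metis (mono_tags, lifting) mem_Collect_eq)

lemma K_group_inverse:
  assumes "k \<in> K_group"
  obtains k' where "k' \<in> K_group" "k ** k' = mat 1" "k' ** k = mat 1"
proof -
  obtain B C where k: "k = block_diag B C" "B \<in> unitary_group" "C \<in> unitary_group"
    using assms by (auto simp: K_group_def)
  obtain B' where B': "B' \<in> unitary_group" "B ** B' = mat 1" "B' ** B = mat 1"
    using k(2) by (rule unitary_inverse)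
  obtain C' where C': "C' \<in> unitary_group" "C ** C' = mat 1" "C' ** C = mat 1"
    using k(3) by (rule unitary_inverse)
  show ?thesis
    by (rule that[of "block_diag B' C'"]) (use k B' C' in \<open>auto simp: K_group_def block_diag_mult block_diag_one\<close>)
qed

definition dilation_matrices :: "'q \<Rightarrow> (complex^('p::finite + 'q::finite)^('p + 'q)) set" where
  "dilation_matrices l = {dilation_matrix l j a b | j a b. a \<ge> 0 \<and> b \<ge> 0 \<and> a\<^sup>2 - b\<^sup>2 = 1}"

lemma dilation_matrix_mult:
  fixes l :: "'q::finite" and j :: "'p::finite"
  shows "dilation_matrix l j a b *v z = (\<chi> r.
    if r = Inl j then of_real a * z $ Inl j - of_real b * z $ Inr l
    else if r = Inr l then of_real b * z $ Inl j - of_real a * z $ Inr l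
    else z $ r)"
proof -
  have "(\<Sum>c\<in>UNIV. dilation_matrix l j a b $ r $ c * z $ c) = (\<Sum>c\<in>UNIV.
      (if c = Inl j then (if r = Inl j then of_real a else if r = Inr l then of_real b else 0) * z $ Inl j else 0)
    + (if c = Inr l then (if r = Inl j then - of_real b else if r = Inr l then - of_real a else 0) * z $ Inr l else 0)
    + (if c = r then (if r = Inl j \<or> r = Inr l then 0 else z $ r) else 0))" for r
    by (rule sum.cong) (auto simp: dilation_matrix_def)
  then show ?thesis by (simp add: vec_eq_iff matrix_vector_mult_def sum.distrib)
qed

text \<open>Only the coordinates j and l change, and their share of the form is multiplied by a^2 -
  b^2 = 1.\<close>

lemma dilation_matrices_U_pq:
  assumes "A \<in> dilation_matrices l"
  shows "A \<in> U_pq"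
proof -
  obtain j a b where A: "A = dilation_matrix l j a b" and ab: "a\<^sup>2 - b\<^sup>2 = 1"
    using assms by (auto simp: dilation_matrices_def)
  have "complex_of_real a * of_real a - of_real b * of_real b = of_real (a\<^sup>2 - b\<^sup>2)"
    by (simp add: power2_eq_square)
  then have ab': "complex_of_real a * of_real a - of_real b * of_real b = 1" unfolding ab by simp
  have "herm (A *v x) (A *v y) = herm x y" for x y
  proof -
    have up: "(\<Sum>i\<in>UNIV. cnj ((A *v x) $ Inl i) * (A *v y) $ Inl i)
        = cnj ((A *v x) $ Inl j) * (A *v y) $ Inl j + (\<Sum>i\<in>UNIV - {j}. cnj (x $ Inl i) * y $ Inl i)"
      by (subst sum.remove[of _ j]) (auto simp: A dilation_matrix_mult intro!: sum.cong)
    have lo: "(\<Sum>i\<in>UNIV. cnj ((A *v x) $ Inr i) * (A *v y) $ Inr i)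
        = cnj ((A *v x) $ Inr l) * (A *v y) $ Inr l + (\<Sum>i\<in>UNIV - {l}. cnj (x $ Inr i) * y $ Inr i)"
      by (subst sum.remove[of _ l]) (auto simp: A dilation_matrix_mult intro!: sum.cong)
    have "cnj ((A *v x) $ Inl j) * (A *v y) $ Inl j - cnj ((A *v x) $ Inr l) * (A *v y) $ Inr l
        = (of_real a * of_real a - of_real b * of_real b) * (cnj (x $ Inl j) * y $ Inl j - cnj (x $ Inr l) * y $ Inr l)"
      by (simp add: A dilation_matrix_mult algebra_simps)
    also have "\<dots> = cnj (x $ Inl j) * y $ Inl j - cnj (x $ Inr l) * y $ Inr l" by (simp add: ab')
    finally show ?thesis
      unfolding herm_expand up lo
      by (simp add: sum.remove[of UNIV j] sum.remove[of UNIV l] algebra_simps)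
  qed
  then show ?thesis by (simp add: U_pq_iff)
qed

lemma dilations_eq: "dilations l = induced_map Dpq ` dilation_matrices l"
proof (intro subset_antisym subsetI)
  fix f assume "f \<in> dilations l"
  then obtain A j a b where "f = induced_map Dpq A" "a \<ge> 0" "b \<ge> 0" "a\<^sup>2 - b\<^sup>2 = 1" "A = dilation_matrix l j a b"
    unfolding dilations_def by blast
  then show "f \<in> induced_map Dpq ` dilation_matrices l" unfolding dilation_matrices_def by blast
next
  fix f assume "f \<in> induced_map Dpq ` dilation_matrices l"
  then obtain A where A: "f = induced_map Dpq A" "A \<in> dilation_matrices l" by blast
  then obtain j a b where "a \<ge> 0" "b \<ge> 0" "a\<^sup>2 - b\<^sup>2 = 1" "A = dilation_matrix l j a b"
    unfolding dilation_matrices_def by blast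
  then show "f \<in> dilations l"
    using A(1) dilation_matrices_U_pq[OF A(2)] unfolding dilations_def by blast
qed

text \<open>One step of the column reduction; the case S = {} shows that U(p,q) acts transitively on the
  positive lines.\<close>

lemma column_reduction:
  fixes z :: "complex^('p::finite + 'q::finite)" and l :: 'q
  assumes z: "herm_form z = 1" and orth: "\<And>i. i \<in> S \<Longrightarrow> z $ Inl i = 0" and j: "j \<notin> S"
  obtains k m where "k \<in> K_group" "m \<in> dilation_matrices l" "m *v (k *v z) = axis (Inl j) 1"
    "\<And>i. i \<in> S \<Longrightarrow> m *v (k *v axis (Inl i) 1) = axis (Inl i) 1"
proof -
  obtain B where B: "B \<in> unitary_group" "B *v upper z = of_real (norm (upper z)) *s axis j 1"
    "\<And>x. cprod (upper z) x = 0 \<Longrightarrow> x $ j = 0 \<Longrightarrow> B *v x = x"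
    using unitary_maps_to_axis[of "upper z" j] by metis
  obtain C where C: "C \<in> unitary_group" "C *v lower z = of_real (norm (lower z)) *s axis l 1"
    using unitary_maps_to_axis[of "lower z" l] by metis
  \<comment> \<open>The parameters of the dilation: z has square 1, which says a^2 - b^2 =
    1.\<close>
  define a where "a = norm (upper z)"
  define b where "b = norm (lower z)"
  have ab: "a\<^sup>2 - b\<^sup>2 = 1" using z by (simp add: a_def b_def herm_form_split)
  have "complex_of_real a * of_real a - of_real b * of_real b = of_real (a\<^sup>2 - b\<^sup>2)"
    by (simp add: power2_eq_square)
  then have ab': "complex_of_real a * of_real a - of_real b * of_real b = 1" unfolding ab by simp
  define k where "k = block_diag B C"
  define m :: "complex^('p + 'q)^('p + 'q)" where "m = dilation_matrix l j a b"
  \<comment> \<open>Only the entries a at \<open>Inl j\<close> and b at \<open>Inr l\<close> remain,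
    and the dilation sends the pair (a, b) to (a^2 - b^2, b a - a b) = (1, 0).\<close>
  have kz: "k *v z = (\<chi> r. if r = Inl j then of_real a else if r = Inr l then of_real b else 0)"
    unfolding vec_eq_upper_lower k_def upper_block_diag lower_block_diag B(2) C(2)
    by (simp add: vec_eq_iff axis_def a_def b_def)
  show ?thesis
  proof (rule that[of k m])
    show "k \<in> K_group" using B(1) C(1) by (auto simp: K_group_def k_def)
    have "a \<ge> 0" "b \<ge> 0" by (simp_all add: a_def b_def)
    then show "m \<in> dilation_matrices l" unfolding dilation_matrices_def m_def using ab by blast
    show "m *v (k *v z) = axis (Inl j) 1"
      unfolding kz m_def dilation_matrix_mult using ab' by (simp add: vec_eq_iff axis_def mult.commute)
    fix i assume i: "i \<in> S"
    then have ij: "i \<noteq> j" using j by auto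
    have 1: "upper (axis (Inl i) 1 :: complex^('p + 'q)) = axis i 1"
      "lower (axis (Inl i) 1 :: complex^('p + 'q)) = 0"
      by (simp_all add: vec_eq_iff axis_def)
    \<comment> \<open>The i-th axis is orthogonal to \<open>upper z\<close> and to the j-th axis, so
      B leaves it alone.\<close>
    have "cprod (upper z) (axis i 1) = 0"
      using orth[OF i] cprod_commute[of "upper z" "axis i 1"] by (simp add: cprod_axis_left)
    then have "B *v axis i 1 = axis i 1" using ij by (intro B(3)) (auto simp: axis_def)
    then have "k *v axis (Inl i) 1 = axis (Inl i) 1"
      unfolding vec_eq_upper_lower k_def upper_block_diag lower_block_diag 1 by simp
    then show "m *v (k *v axis (Inl i) 1) = axis (Inl i) 1"
      unfolding m_def using ij by (simp add: dilation_matrix_mult vec_eq_iff axis_def)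
  qed
qed

text \<open>The number n counts the dilations; they separate n + 1 factors from
  \<open>K_group\<close>.\<close>

primrec word_matrices :: "'q \<Rightarrow> nat \<Rightarrow> (complex^('p::finite + 'q::finite)^('p + 'q)) set" where
  "word_matrices l 0 = K_group"
| "word_matrices l (Suc n) =
    {k ** (m ** w) | k m w. k \<in> K_group \<and> m \<in> dilation_matrices l \<and> w \<in> word_matrices l n}"

lemma word_matrices_K_mult:
  assumes "k \<in> K_group" "w \<in> word_matrices l n"
  shows "k ** w \<in> word_matrices l n"
proof (cases n)
  case 0
  then show ?thesis using assms by (simp add: K_group_mult)
next
  case (Suc n')
  then obtain k' m w' where "w = k' ** (m ** w')" "k' \<in> K_group" "m \<in> dilation_matrices l" "w' \<in> word_matrices l n'"
    using assms by auto
  moreover from this have "k ** w = (k ** k') ** (m ** w')" by (simp add: matrix_mul_assoc)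
  ultimately show ?thesis using Suc K_group_mult[OF assms(1)] by auto
qed

lemma word_matrices_U_pq: "w \<in> word_matrices l n \<Longrightarrow> w \<in> U_pq"
  by (induction n arbitrary: w) (auto intro!: U_pq_mult dest: K_group_U_pq dilation_matrices_U_pq)

text \<open>The images of the positive basis vectors stay orthonormal for the form. Once those in S
  are basis vectors, the next image has zero entries at S, which is what
  \<open>column_reduction\<close> asks for.\<close>

lemma word_matrices_reduce:
  fixes A :: "complex^('p::finite + 'q::finite)^('p + 'q)" and l :: 'q
  assumes A: "A \<in> U_pq" and S: "finite S"
  shows "\<exists>w \<in> word_matrices l (card S). \<forall>i\<in>S. w *v (A *v axis (Inl i) 1) = axis (Inl i) 1"
  using S
proof (induction S rule: finite_induct)
  case empty
  then show ?case using K_group_one by auto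
next
  case (insert j S)
  obtain w where w: "w \<in> word_matrices l (card S)" "\<And>i. i \<in> S \<Longrightarrow> w *v (A *v axis (Inl i) 1) = axis (Inl i) 1"
    using insert.IH by blast
  define z where "z = w *v (A *v axis (Inl j) 1)"
  have pres: "herm (w *v (A *v x)) (w *v (A *v y)) = herm x y" for x y
    using word_matrices_U_pq[OF w(1)] A by (simp add: U_pq_iff)
  have ax: "herm (axis (Inl i) 1) y = y $ Inl i" for i and y :: "complex^('p + 'q)"
    by (simp add: herm_def cprod_axis_left Hpq_mult_nth)
  have "herm_form z = 1" unfolding herm_form_eq z_def pres ax by (simp add: axis_def)
  moreover have "z $ Inl i = 0" if "i \<in> S" for i
  proof -
    have "z $ Inl i = herm (axis (Inl i) 1) z" by (simp add: ax)
    also have "\<dots> = herm (w *v (A *v axis (Inl i) 1)) (w *v (A *v axis (Inl j) 1))"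
      by (simp only: w(2)[OF that] z_def)
    also have "\<dots> = 0" unfolding pres ax using that insert.hyps by (auto simp: axis_def)
    finally show ?thesis .
  qed
  ultimately obtain k m where km: "k \<in> K_group" "m \<in> dilation_matrices l" "m *v (k *v z) = axis (Inl j) 1"
    "\<And>i. i \<in> S \<Longrightarrow> m *v (k *v axis (Inl i) 1) = axis (Inl i) 1"
    using column_reduction[of z S j l] insert.hyps(2) by metis
  \<comment> \<open>The outer factor \<open>mat 1\<close> restores the alternating shape, and k is
    absorbed into the leading factor of w, so each column costs one dilation.\<close>
  define w' where "w' = mat 1 ** (m ** (k ** w))"
  have "w' \<in> word_matrices l (card (insert j S))"
    using K_group_one km(2) word_matrices_K_mult[OF km(1) w(1)]
    unfolding w'_def card_insert_disjoint[OF insert.hyps] word_matrices.simps by blast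
  moreover have "w' *v v = m *v (k *v (w *v v))" for v
    unfolding w'_def by (simp add: matrix_vector_mul_assoc matrix_mul_assoc)
  then have "\<forall>i\<in>insert j S. w' *v (A *v axis (Inl i) 1) = axis (Inl i) 1"
    using km(3,4) w(2) by (auto simp: z_def)
  ultimately show ?case by blast
qed

text \<open>Pairing with the fixed axes shows that A keeps the upper part of every vector. On
  vectors with upper part 0 the form is minus the standard product, so the lower block is unitary;
  the fixed axes contribute no lower entries.\<close>

lemma U_pq_fixing_axes_K_group:
  fixes A :: "complex^('p::finite + 'q::finite)^('p + 'q)"
  assumes A: "A \<in> U_pq" and fix_axes: "\<And>i. A *v axis (Inl i) 1 = axis (Inl i) 1"
  shows "A \<in> K_group"
proof -
  have ax: "herm (axis (Inl i) 1) y = y $ Inl i" for i :: 'p and y :: "complex^('p + 'q)"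
    by (simp add: herm_def cprod_axis_left Hpq_mult_nth)
  have up: "upper (A *v z) = upper z" for z
  proof -
    have "herm (A *v axis (Inl i) 1) (A *v z) = herm (axis (Inl i) 1) z" for i
      using A by (simp add: U_pq_iff)
    then show ?thesis by (simp add: fix_axes ax vec_eq_iff)
  qed
  define C where "C = (\<chi> i k. A $ Inr i $ Inr k)"
  define ext :: "complex^'q \<Rightarrow> complex^('p + 'q)"
    where "ext v = (\<chi> r. case r of Inl _ \<Rightarrow> 0 | Inr k \<Rightarrow> v $ k)" for v
  have ext: "upper (ext v) = 0" "lower (ext v) = v" for v by (simp_all add: ext_def vec_eq_iff)
  have Aext: "lower (A *v ext v) = C *v v" for v
    by (simp add: vec_eq_iff matrix_vector_mult_def sum_UNIV_Plus C_def ext_def)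
  have "cprod (C *v x) (C *v y) = cprod x y" for x y
  proof -
    have "herm (A *v ext x) (A *v ext y) = herm (ext x) (ext y)" using A by (simp add: U_pq_iff)
    then show ?thesis by (simp add: herm_split up ext Aext)
  qed
  then have C: "C \<in> unitary_group" by (simp add: unitary_iff)
  have low0: "A $ Inr k $ Inl i = 0" for k i
  proof -
    have "(A *v axis (Inl i) 1) $ Inr k = A $ Inr k $ Inl i"
      by (simp add: matrix_vector_mult_def axis_def if_distrib cong: if_cong)
    moreover have "(A *v axis (Inl i) 1) $ Inr k = 0" unfolding fix_axes by (simp add: axis_def)
    ultimately show ?thesis by simp
  qed
  have "lower (A *v z) = C *v lower z" for z
    by (simp add: vec_eq_iff matrix_vector_mult_def sum_UNIV_Plus C_def low0)
  then have "A = block_diag (mat 1) C"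
    unfolding matrix_eq vec_eq_upper_lower[of "A *v _"] upper_block_diag lower_block_diag
    by (simp add: up)
  then show ?thesis using C unitary_one by (auto simp: K_group_def)
qed

text \<open>Reducing the inverse A' puts w A' into \<open>K_group\<close>; with k inverse to w A'
  this gives A = k w, and no word has to be inverted.\<close>

lemma U_pq_word_matrices:
  fixes A :: "complex^('p::finite + 'q::finite)^('p + 'q)" and l :: 'q
  assumes "A \<in> U_pq"
  shows "A \<in> word_matrices l CARD('p)"
proof -
  obtain A' where A': "A' \<in> U_pq" "A ** A' = mat 1" "A' ** A = mat 1"
    using assms by (rule U_pq_inverse)
  obtain w where w: "w \<in> word_matrices l CARD('p)" "\<And>i. w *v (A' *v axis (Inl i) 1) = axis (Inl i) 1"
    using word_matrices_reduce[OF A'(1), of UNIV l] by auto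
  have "w ** A' \<in> K_group"
    using w(2) U_pq_mult[OF word_matrices_U_pq[OF w(1)] A'(1)]
    by (intro U_pq_fixing_axes_K_group) (simp_all add: matrix_vector_mul_assoc)
  then obtain k where k: "k \<in> K_group" "k ** (w ** A') = mat 1" by (rule K_group_inverse)
  have "A = (k ** (w ** A')) ** A" using k by simp
  also have "\<dots> = k ** w ** (A' ** A)" by (simp only: matrix_mul_assoc)
  also have "\<dots> = k ** w" using A' by simp
  finally show ?thesis using word_matrices_K_mult[OF k(1) w(1)] by simp
qed

section \<open>From words of matrices to words of automorphisms\<close>

lemma alternating_word_cong:
  "(\<And>i. i \<in> {1..n + 1} \<Longrightarrow> U i = U' i) \<Longrightarrow> (\<And>i. i \<in> {1..n} \<Longrightarrow> M i = M' i) \<Longrightarrow>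
    alternating_word G U M n = alternating_word G U' M' n"
  by (induction n) auto

lemma word_matrices_alternating_word:
  assumes "w \<in> word_matrices l n"
  shows "\<exists>U M. (\<forall>i \<in> {1..n + 1}. U i \<in> induced_map Dpq ` K_group) \<and>
    (\<forall>i \<in> {1..n}. M i \<in> dilations l) \<and> induced_map Dpq w = alternating_word (Aut_group Dpq) U M n"
  using assms
proof (induction n arbitrary: w)
  case 0
  then show ?case by (intro exI[of _ "\<lambda>_. induced_map Dpq w"]) auto
next
  case (Suc n)
  obtain k m v where w: "w = k ** (m ** v)" "k \<in> K_group" "m \<in> dilation_matrices l" "v \<in> word_matrices l n"
    using Suc.prems by auto
  obtain U M where UM: "\<forall>i \<in> {1..n + 1}. U i \<in> induced_map Dpq ` K_group"
    "\<forall>i \<in> {1..n}. M i \<in> dilations l" "induced_map Dpq v = alternating_word (Aut_group Dpq) U M n"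
    using Suc.IH[OF w(4)] by blast
  \<comment> \<open>Factors are numbered from 1, so the two new outer ones get the indices n + 2 and
    n + 1, which the shorter word does not use.\<close>
  define U' where "U' = U(n + 2 := induced_map Dpq k)"
  define M' where "M' = M(n + 1 := induced_map Dpq m)"
  have "alternating_word (Aut_group Dpq) U' M' n = induced_map Dpq v"
    unfolding UM(3) by (rule alternating_word_cong) (auto simp: U'_def M'_def)
  moreover have mem: "v \<in> U_pq" "m \<in> U_pq" "k \<in> U_pq"
    using w K_group_U_pq dilation_matrices_U_pq word_matrices_U_pq by blast+
  ultimately have "alternating_word (Aut_group Dpq) U' M' (Suc n) = induced_map Dpq w"
    by (simp add: U'_def M'_def w(1) mult_induced_map U_pq_mult)
  moreover have "\<forall>i \<in> {1..Suc n + 1}. U' i \<in> induced_map Dpq ` K_group"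
    using UM(1) w(2) by (auto simp: U'_def)
  moreover have "\<forall>i \<in> {1..Suc n}. M' i \<in> dilations l"
    using UM(2) w(3) by (auto simp: M'_def dilations_eq)
  ultimately show ?case by metis
qed

text \<open>Block diagonal matrices keep vanishing negative coordinates at 0; the same inclusion for
  the inverse matrix gives equality.\<close>

lemma K_group_subspace_auts:
  assumes "k \<in> K_group"
  shows "induced_map Dpq k \<in> subspace_auts"
proof -
  have sub: "induced_map Dpq k ` p_subspace \<subseteq> p_subspace" if k: "k \<in> K_group" for k
  proof
    fix L assume "L \<in> induced_map Dpq k ` p_subspace"
    then obtain z where z: "L = induced_map Dpq k (proj_point z)" "herm_form z > 0" "\<forall>i. z $ Inr i = 0"
      by (auto simp: p_subspace_def proj_point_in_Dpq)
    obtain B C where BC: "k = block_diag B C" using k by (auto simp: K_group_def)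
    have "lower z = 0" using z(3) by (simp add: vec_eq_iff)
    then have "(k *v z) $ Inr i = 0" for i by (simp add: BC block_diag_Inr)
    then show "L \<in> p_subspace"
      using z K_group_U_pq[OF k]
      by (auto simp: p_subspace_def induced_map_proj_point proj_point_in_Dpq U_pq_herm_form)
  qed
  obtain k' where k': "k' \<in> K_group" "k ** k' = mat 1" "k' ** k = mat 1"
    using assms by (rule K_group_inverse)
  have "p_subspace \<subseteq> induced_map Dpq k ` p_subspace"
  proof
    fix L :: "(complex^('a + 'b)) set" assume L: "L \<in> p_subspace"
    then have "L \<in> Dpq" by (auto simp: p_subspace_def)
    then have "L = induced_map Dpq k (induced_map Dpq k' L)"
      using K_group_U_pq[OF k'(1)] k' by (simp add: induced_map_compose induced_map_one)
    moreover have "induced_map Dpq k' L \<in> p_subspace" using sub[OF k'(1)] L by blast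
    ultimately show "L \<in> induced_map Dpq k ` p_subspace" by blast
  qed
  then show ?thesis
    using sub[OF assms] induced_map_in_auts[OF K_group_U_pq[OF assms]]
    by (auto simp: subspace_auts_def Aut_group_def)
qed

section \<open>Linearity when p is 1, and the automorphism group\<close>

text \<open>The scalar Schwarz lemma is applied to <c, g(s)> with c the unit vector along g(t). In
  the equality case <c, g(s)> = \<alpha> s with |\<alpha>| = 1, hence |g(s)| \<le> |s| = |<c,
  g(s)>|, and equality in Cauchy-Schwarz forces g(s) to be a multiple of c.\<close>

lemma
  fixes g :: "complex \<Rightarrow> complex^'n"
  assumes hol: "\<And>k. (\<lambda>t. g t $ k) holomorphic_on ball 0 1" and g0: "g 0 = 0"
    and less: "\<And>t. cmod t < 1 \<Longrightarrow> norm (g t) < 1"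
  shows Schwarz_vec_le: "cmod t < 1 \<Longrightarrow> norm (g t) \<le> cmod t"
    and Schwarz_vec_eq: "cmod t < 1 \<Longrightarrow> t \<noteq> 0 \<Longrightarrow> norm (g t) = cmod t
      \<Longrightarrow> \<exists>B. \<forall>s. cmod s < 1 \<longrightarrow> g s = s *s B"
proof -
  have phi: "(\<lambda>s. cprod c (g s)) holomorphic_on ball 0 1" "cprod c (g 0) = 0"
    "\<And>s. cmod (cprod c (g s)) \<le> norm (g s)" "\<And>s. cmod s < 1 \<Longrightarrow> cmod (cprod c (g s)) < 1"
    if c: "norm c = 1" for c
  proof -
    show "(\<lambda>s. cprod c (g s)) holomorphic_on ball 0 1"
      unfolding cprod_def by (intro holomorphic_intros hol)
    show "cprod c (g 0) = 0" by (simp add: g0 cprod_def)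
    show 1: "cmod (cprod c (g s)) \<le> norm (g s)" for s
      using cprod_Cauchy_Schwarz[of c "g s"] c by (simp add: abs_le_square_iff[symmetric])
    show "cmod (cprod c (g s)) < 1" if "cmod s < 1" for s using 1[of s] less[OF that] by simp
  qed
  define c where "c t = of_real (1 / norm (g t)) *s g t" for t
  have c: "norm (c t) = 1" "cprod (c t) (g t) = of_real (norm (g t))" if "g t \<noteq> 0" for t
    using that by (simp_all add: c_def norm_vec_smult norm_divide cprod_scale_left cprod_self power2_eq_square)
  show le: "norm (g t) \<le> cmod t" if t: "cmod t < 1" for t
  proof (cases "g t = 0")
    case False
    have "cmod (cprod (c t) (g t)) \<le> cmod t"
      using Schwarz_Lemma(1)[OF phi(1,2,4)[OF c(1)[OF False]] t] by simp
    then show ?thesis using c(2)[OF False] by simp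
  qed simp
  assume t: "cmod t < 1" and t0: "t \<noteq> 0" and eq: "norm (g t) = cmod t"
  then have gt: "g t \<noteq> 0" by auto
  have "cmod (cprod (c t) (g t)) = cmod t" using c(2)[OF gt] eq by simp
  then obtain \<alpha> where \<alpha>: "\<And>s. cmod s < 1 \<Longrightarrow> cprod (c t) (g s) = \<alpha> * s" "cmod \<alpha> = 1"
    using Schwarz_Lemma(3)[OF phi(1,2,4)[OF c(1)[OF gt]], of t] t t0 by auto
  have "g s = s *s (\<alpha> *s c t)" if s: "cmod s < 1" for s
  proof -
    have "cmod (cprod (c t) (g s)) = norm (g s)"
      using phi(3)[OF c(1)[OF gt], of s] le[OF s] \<alpha>(1)[OF s] \<alpha>(2) by (simp add: norm_mult)
    then have "g s = cprod (c t) (g s) *s c t" using cprod_Cauchy_Schwarz_eq[OF c(1)[OF gt]] by simp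
    then show ?thesis using \<alpha>(1)[OF s] by (simp add: vector_smult_assoc mult.commute)
  qed
  then show "\<exists>B. \<forall>s. cmod s < 1 \<longrightarrow> g s = s *s B" by blast
qed

text \<open>In the chart where the only positive coordinate is 1, the domain is the unit ball around
  e, with v as coordinate.\<close>

lemma herm_form_rank_1:
  fixes v :: "complex^('p::finite + 'q::finite)"
  assumes "(UNIV :: 'p set) = {i0}" "v $ Inl i0 = 0"
  shows "herm_form (axis (Inl i0) 1 + v) = 1 - (norm v)\<^sup>2"
proof -
  have ax: "herm (axis (Inl i0) 1) y = y $ Inl i0" for y :: "complex^('p + 'q)"
    by (simp add: herm_def cprod_axis_left Hpq_mult_nth)
  have "upper v = 0" using assms by (auto simp: vec_eq_iff)
  moreover have "cprod v v = cprod (upper v) (upper v) + cprod (lower v) (lower v)"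
    by (simp add: cprod_def sum_UNIV_Plus)
  ultimately have "of_real ((norm v)\<^sup>2) = complex_of_real ((norm (lower v))\<^sup>2)"
    by (simp only: cprod_self) (simp add: cprod_self)
  then have "(norm v)\<^sup>2 = (norm (lower v))\<^sup>2" using of_real_eq_iff by blast
  then have "herm_form v = - (norm v)\<^sup>2" using \<open>upper v = 0\<close> by (simp add: herm_form_split)
  moreover have "herm_form (axis (Inl i0) 1 :: complex^('p + 'q)) = 1"
    unfolding herm_form_eq ax by (simp add: axis_def)
  ultimately show ?thesis
    using herm_form_add_orth[of "axis (Inl i0) 1" v] by (simp add: ax assms)
qed

lemma rank_1_coordinate:
  fixes z :: "complex^('p::finite + 'q::finite)"
  assumes "(UNIV :: 'p set) = {i0}" "herm_form z > 0"
  shows "z $ Inl i0 \<noteq> 0"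
proof
  assume "z $ Inl i0 = 0"
  then have "upper z = 0" using assms(1) by (auto simp: vec_eq_iff)
  then show False using assms(2) by (simp add: herm_form_split)
qed

context proj_biholo
begin

lemma inverse_proj_biholo: "proj_biholo h f"
  by unfold_locales (auto simp: f_holo h_holo f_in h_in hf fh)

lemma rank_1_chart:
  assumes p: "(UNIV :: 'p set) = {i0}" and v: "v $ Inl i0 = 0" "norm v < 1"
  obtains v' where "v' $ Inl i0 = 0" "norm v' < 1"
    "f (proj_point (axis (Inl i0) 1 + v)) = proj_point (axis (Inl i0) 1 + v')"
    "affine_chart (Inl i0) (f (proj_point (axis (Inl i0) 1 + v))) - axis (Inl i0) 1 = v'"
proof -
  have "herm_form (axis (Inl i0) 1 + v) > 0"
    using herm_form_rank_1[OF p v(1)] v(2) by (simp add: abs_square_less_1)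
  then obtain w where w: "f (proj_point (axis (Inl i0) 1 + v)) = proj_point w" "herm_form w > 0"
    using f_in Dpq_cases proj_point_in_Dpq by metis
  have w0: "w $ Inl i0 \<noteq> 0" using rank_1_coordinate[OF p w(2)] .
  define v' where "v' = (1 / w $ Inl i0) *s w - axis (Inl i0) 1"
  have eq: "axis (Inl i0) 1 + v' = (1 / w $ Inl i0) *s w" by (simp add: v'_def)
  have v'0: "v' $ Inl i0 = 0" using w0 by (simp add: v'_def axis_def)
  have "herm_form (axis (Inl i0) 1 + v') > 0" unfolding eq using w w0 by (simp add: herm_form_scale)
  then have "(norm v')\<^sup>2 < 1" using herm_form_rank_1[OF p v'0] by simp
  then have "norm v' < 1" by (simp add: abs_square_less_1)
  moreover have "f (proj_point (axis (Inl i0) 1 + v)) = proj_point (axis (Inl i0) 1 + v')"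
    unfolding eq w(1) using w0 by (simp add: proj_point_scale)
  moreover have "affine_chart (Inl i0) (f (proj_point (axis (Inl i0) 1 + v))) - axis (Inl i0) 1 = v'"
    unfolding w(1) affine_chart_proj_point[OF w0] v'_def ..
  ultimately show ?thesis using that v'0 by blast
qed

text \<open>For p = 1 the coordinate \<open>Inl i0\<close> vanishes nowhere on the domain, so one
  chart serves all values of f, and there f is a quotient of coordinates of any local lift.\<close>

lemma rank_1_chart_holomorphic:
  assumes p: "(UNIV :: 'p set) = {i0}" and u: "u $ Inl i0 = 0" "norm u = 1"
  shows "(\<lambda>t. (affine_chart (Inl i0) (f (proj_point (axis (Inl i0) 1 + t *s u))) - axis (Inl i0) 1) $ k)
    holomorphic_on ball 0 1"
  unfolding holomorphic_on_def
proof (rule ballI, rule field_differentiable_at_within)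
  define e :: "complex^('p + 'q)" where "e = axis (Inl i0) 1"
  fix t0 :: complex assume "t0 \<in> ball 0 1"
  then have "norm (t0 *s u) < 1" using u by (simp add: norm_vec_smult)
  then have "herm_form (e + t0 *s u) > 0"
    using herm_form_rank_1[OF p, of "t0 *s u"] u by (simp add: e_def abs_square_less_1)
  then obtain j F \<Omega> where F: "open \<Omega>" "e + t0 *s u \<in> \<Omega>" "\<And>z. z \<in> \<Omega> \<Longrightarrow> herm_form z > 0"
    "\<And>z. z \<in> \<Omega> \<Longrightarrow> f (proj_point z) = proj_point (F z)" "\<And>z. z \<in> \<Omega> \<Longrightarrow> F z $ j = 1"
    "\<And>z. z \<in> \<Omega> \<Longrightarrow> cdiff F z"
    using local_lift[OF f_holo] by metis
  have F0: "F z $ Inl i0 \<noteq> 0" if "z \<in> \<Omega>" for z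
    using rank_1_coordinate[OF p f_proj_point_pos[OF F(3)[OF that] F(4)[OF that]]] .
  obtain A where A: "(F has_derivative (*v) A) (at (e + t0 *s u))" using F(2,6) by (auto simp: cdiff_def)
  have "cderiv (\<lambda>t. F (e + t *s u)) (A *v u) t0"
    using cderiv_chain[OF cderiv_affine A] .
  from cderiv_nth[OF this]
  have "(\<lambda>t. F (e + t *s u) $ i) field_differentiable at t0" for i
    by (auto simp: field_differentiable_def)
  then have "(\<lambda>t. F (e + t *s u) $ k / F (e + t *s u) $ Inl i0 - e $ k) field_differentiable at t0"
    using F0[OF F(2)] by (intro field_differentiable_diff field_differentiable_divide) auto
  then obtain D where D: "((\<lambda>t. F (e + t *s u) $ k / F (e + t *s u) $ Inl i0 - e $ k)
      has_field_derivative D) (at t0)"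
    by (auto simp: field_differentiable_def)
  have ev: "\<forall>\<^sub>F t in nhds t0. e + t *s u \<in> \<Omega>"
    using cderiv_imp_isCont[OF cderiv_affine[of e u t0]] F(1,2) by (intro isCont_eventually_nhds) auto
  have "\<forall>\<^sub>F t in nhds t0. F (e + t *s u) $ k / F (e + t *s u) $ Inl i0 - e $ k
      = (affine_chart (Inl i0) (f (proj_point (e + t *s u))) - e) $ k"
    using ev by eventually_elim (simp add: F(4) affine_chart_proj_point F0)
  from DERIV_cong_ev[OF refl this refl] D
  have "((\<lambda>t. (affine_chart (Inl i0) (f (proj_point (e + t *s u))) - e) $ k) has_field_derivative D) (at t0)"
    by blast
  then show "(\<lambda>t. (affine_chart (Inl i0) (f (proj_point (axis (Inl i0) 1 + t *s u))) - axis (Inl i0) 1) $ k)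
      field_differentiable at t0"
    unfolding e_def field_differentiable_def by blast
qed

text \<open>The Schwarz lemma on the disc through the centre in the direction u = v / |v|, at the
  parameter |v|.\<close>

lemma rank_1_norm_le:
  assumes p: "(UNIV :: 'p set) = {i0}" and fe: "f (proj_point (axis (Inl i0) 1)) = proj_point (axis (Inl i0) 1)"
    and v: "v $ Inl i0 = 0" "norm v < 1" and v': "v' $ Inl i0 = 0"
    and fv: "f (proj_point (axis (Inl i0) 1 + v)) = proj_point (axis (Inl i0) 1 + v')"
  shows "norm v' \<le> norm v"
proof -
  have chart: "affine_chart (Inl i0) (proj_point (axis (Inl i0) 1 + w)) - axis (Inl i0) 1 = w"
    if "w $ Inl i0 = 0" for w :: "complex^('p + 'q)"
    using that by (subst affine_chart_proj_point) (simp_all add: axis_def)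
  show ?thesis
  proof (cases "v = 0")
    case True
    then have "v' = 0" using fv fe chart[OF v'] chart[of 0] by simp
    then show ?thesis by simp
  next
    case False
    define u where "u = of_real (1 / norm v) *s v"
    have u: "u $ Inl i0 = 0" "norm u = 1" using False v by (simp_all add: u_def norm_vec_smult norm_divide)
    have vu: "v = of_real (norm v) *s u" using False by (simp add: u_def vec_eq_iff)
    define g where "g t = affine_chart (Inl i0) (f (proj_point (axis (Inl i0) 1 + t *s u))) - axis (Inl i0) 1" for t
    have "norm (g (of_real (norm v))) \<le> cmod (of_real (norm v))"
    proof (rule Schwarz_vec_le)
      show "(\<lambda>t. g t $ k) holomorphic_on ball 0 1" for k
        unfolding g_def by (rule rank_1_chart_holomorphic[OF p u])
      show "g 0 = 0" using fe chart[of 0] by (simp add: g_def)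
      show "norm (g t) < 1" if "cmod t < 1" for t
      proof -
        have "(t *s u) $ Inl i0 = 0" "norm (t *s u) < 1" using that u by (simp_all add: norm_vec_smult)
        from rank_1_chart[OF p this] show ?thesis unfolding g_def by metis
      qed
      show "cmod (of_real (norm v)) < 1" using v(2) by simp
    qed
    moreover have "g (of_real (norm v)) = v'"
      unfolding g_def vu[symmetric] fv by (rule chart[OF v'])
    ultimately show ?thesis by simp
  qed
qed

text \<open>Schwarz for f and for its inverse forces |g(t)| = |t| on each disc through the centre,
  so g is linear there by the equality case. The slopes of all discs are values of the single
  derivative P at the centre, so f is linear as a whole.\<close>

lemma projective_linear_rank_1_fixing:
  assumes p: "(UNIV :: 'p set) = {i0}" and fe: "f (proj_point (axis (Inl i0) 1)) = proj_point (axis (Inl i0) 1)"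
  obtains T where "\<And>z. herm_form z > 0 \<Longrightarrow> f (proj_point z) = proj_point (T *v z)"
proof -
  define e :: "complex^('p + 'q)" where "e = axis (Inl i0) 1"
  have e0: "e $ Inl i0 = 1" by (simp add: e_def axis_def)
  have fe': "f (proj_point e) = proj_point e" using fe by (simp add: e_def)
  have he: "herm_form e > 0" using herm_form_rank_1[OF p, of "0 :: complex^('p + 'q)"] by (simp add: e_def)
  then have "h (proj_point e) = proj_point e" using hf fe' by (metis proj_point_in_Dpq)
  then have hle: "norm v' \<le> norm v" if "v $ Inl i0 = 0" "norm v < 1" "v' $ Inl i0 = 0"
    "h (proj_point (e + v)) = proj_point (e + v')" for v v'
    using proj_biholo.rank_1_norm_le[OF inverse_proj_biholo p, of v v'] that by (simp add: e_def)
  have "e \<noteq> 0" using he by auto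
  obtain j F \<Omega> a P where F: "open \<Omega>" "e \<in> \<Omega>" "\<And>z. z \<in> \<Omega> \<Longrightarrow> f (proj_point z) = proj_point (F z)"
    "\<And>z. z \<in> \<Omega> \<Longrightarrow> F z $ j = a" "a \<noteq> 0" "(F has_derivative (*v) P) (at e)" "F e = e"
    using scaled_lift[OF he fe' \<open>e \<noteq> 0\<close>] by metis
  \<comment> \<open>The normalised coordinate of the lift is nonzero at e, and \<open>Inl i0\<close>
    is the only nonzero coordinate of e.\<close>
  have "e $ j = a" using F(2,4,7) by metis
  then have j: "j = Inl i0" "a = 1" using F(5) by (auto simp: e_def axis_def split: if_splits)
  have main: "f (proj_point (e + v)) = proj_point (e + P *v v)" if v: "v $ Inl i0 = 0" "norm v < 1" for v
  proof (cases "v = 0")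
    case True
    then show ?thesis using fe' by simp
  next
    case False
    define u where "u = of_real (1 / norm v) *s v"
    have u: "u $ Inl i0 = 0" "norm u = 1" using False v by (simp_all add: u_def norm_vec_smult norm_divide)
    have vu: "v = of_real (norm v) *s u" using False by (simp add: u_def vec_eq_iff)
    define g where "g t = affine_chart (Inl i0) (f (proj_point (e + t *s u))) - e" for t
    have g: "g t $ Inl i0 = 0" "norm (g t) < 1" "f (proj_point (e + t *s u)) = proj_point (e + g t)"
      if "cmod t < 1" for t
    proof -
      have 1: "(t *s u) $ Inl i0 = 0" "norm (t *s u) < 1" using that u by (simp_all add: norm_vec_smult)
      obtain v' where "v' $ Inl i0 = 0" "norm v' < 1" "f (proj_point (e + t *s u)) = proj_point (e + v')" "g t = v'"
        using rank_1_chart[OF p 1] unfolding g_def e_def by metis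
      then show "g t $ Inl i0 = 0" "norm (g t) < 1" "f (proj_point (e + t *s u)) = proj_point (e + g t)" by simp_all
    qed
    have norm_eq: "norm (g t) = cmod t" if t: "cmod t < 1" for t
    proof (rule antisym)
      have 1: "(t *s u) $ Inl i0 = 0" "norm (t *s u) < 1" using t u by (simp_all add: norm_vec_smult)
      have "norm (g t) \<le> norm (t *s u)"
        using rank_1_norm_le[OF p fe 1 g(1)[OF t]] g(3)[OF t] by (simp add: e_def)
      then show "norm (g t) \<le> cmod t" using u by (simp add: norm_vec_smult)
      have "herm_form (e + t *s u) > 0"
        using herm_form_rank_1[OF p 1(1)] 1(2) by (simp add: e_def abs_square_less_1)
      then have "h (proj_point (e + g t)) = proj_point (e + t *s u)"
        using g(3)[OF t] hf by (metis proj_point_in_Dpq)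
      then have "norm (t *s u) \<le> norm (g t)" by (rule hle[OF g(1,2)[OF t] 1(1)])
      then show "cmod t \<le> norm (g t)" using u by (simp add: norm_vec_smult)
    qed
    have hol: "(\<lambda>t. g t $ k) holomorphic_on ball 0 1" for k
      unfolding g_def e_def by (rule rank_1_chart_holomorphic[OF p u])
    have "g 0 = 0" using norm_eq[of 0] by simp
    from Schwarz_vec_eq[OF hol this g(2), of "of_real (norm v)"] norm_eq[of "of_real (norm v)"] v False
    obtain B where B: "\<And>s. cmod s < 1 \<Longrightarrow> g s = s *s B" by auto
    have "(P *v u) $ k = B $ k" for k
    proof -
      have ev: "\<forall>\<^sub>F t in nhds 0. e + t *s u \<in> \<Omega>"
        using cderiv_imp_isCont[OF cderiv_affine[of e u 0]] F(1,2) by (intro isCont_eventually_nhds) auto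
      have ev1: "\<forall>\<^sub>F t in nhds 0. t \<in> ball (0::complex) 1" by (rule eventually_nhds_in_open) auto
      have eq: "\<forall>\<^sub>F t in nhds 0. F (e + t *s u) $ k = (e + t *s B) $ k"
        using ev ev1
      proof eventually_elim
        case (elim t)
        then have t: "cmod t < 1" by simp
        have "proj_point (F (e + t *s u)) = proj_point (e + g t)" using g(3)[OF t] F(3)[OF elim(1)] by simp
        from proj_point_eq_minor[OF this, of k "Inl i0"]
        have "F (e + t *s u) $ k = (e + g t) $ k" using F(4)[OF elim(1)] j g(1)[OF t] e0 by simp
        then show ?case using B[OF t] by simp
      qed
      have "cderiv (\<lambda>t. F (e + t *s u)) (P *v u) 0"
        by (rule cderiv_chain[OF cderiv_affine]) (simp add: F(6))
      from cderiv_nth[OF this] DERIV_cong_ev[OF refl eq refl]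
      have "((\<lambda>t. (e + t *s B) $ k) has_field_derivative (P *v u) $ k) (at 0)" by blast
      then show ?thesis using cderiv_nth[OF cderiv_affine[of e B 0]] DERIV_unique by blast
    qed
    then have "P *v u = B" by (simp add: vec_eq_iff)
    then have "P *v v = g (of_real (norm v))"
      using B[of "of_real (norm v)"] v(2) vu by (metis vector_scalar_commute norm_of_real abs_norm_cancel)
    then show ?thesis using g(3)[of "of_real (norm v)"] v(2) vu by simp
  qed
  \<comment> \<open>Homogenisation: w = c (e + v) is sent to c (e + P v).\<close>
  define D where "D w = w $ Inl i0 *s e + P *v (w - w $ Inl i0 *s e)" for w
  have "D (x + y) = D x + D y" "D (c *s x) = c *s D x" for x y c
    unfolding D_def
    by (simp_all add: matrix_vector_right_distrib matrix_vector_mult_diff_distrib vector_scalar_commute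
        vec_eq_iff algebra_simps)
  then obtain T where T: "\<And>x. T *v x = D x" using complex_linear_matrix[of D] by blast
  have "f (proj_point z) = proj_point (T *v z)" if z: "herm_form z > 0" for z
  proof -
    define c where "c = z $ Inl i0"
    have c: "c \<noteq> 0" using rank_1_coordinate[OF p z] by (simp add: c_def)
    define v where "v = (1 / c) *s z - e"
    have v0: "v $ Inl i0 = 0" using c by (simp add: v_def e0 c_def)
    have zv: "z = c *s (e + v)" using c by (simp add: v_def vec_eq_iff)
    have "herm_form (e + v) > 0" using z c unfolding zv herm_form_scale by (simp add: zero_less_mult_iff)
    then have "(norm v)\<^sup>2 < 1" using herm_form_rank_1[OF p v0] by (simp add: e_def)
    then have "norm v < 1" by (simp add: abs_square_less_1)
    then have "f (proj_point (e + v)) = proj_point (e + P *v v)" by (rule main[OF v0])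
    moreover have "T *v z = c *s (e + P *v v)"
    proof -
      have "z - c *s e = c *s v" by (simp add: zv vec_eq_iff algebra_simps)
      then show ?thesis unfolding T D_def c_def[symmetric]
        by (simp add: vector_scalar_commute vector_add_ldistrib)
    qed
    ultimately show ?thesis using c proj_point_scale[OF c, of "e + v"] proj_point_scale[OF c, of "e + P *v v"]
      unfolding zv by simp
  qed
  then show ?thesis using that by blast
qed

lemma proj_biholo_compose:
  assumes A: "A \<in> U_pq" "B \<in> U_pq" "A ** B = mat 1" "B ** A = mat 1"
  shows "proj_biholo (\<lambda>L. induced_map Dpq A (f L)) (\<lambda>L. h (induced_map Dpq B L))"
proof
  show "proj_holomorphic_on (\<lambda>L. induced_map Dpq A (f L)) Dpq"
  proof (rule proj_holomorphic_on_DpqI)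
    fix z0 :: "complex^('p + 'q)" assume "herm_form z0 > 0"
    then obtain j F \<Omega> where F: "open \<Omega>" "z0 \<in> \<Omega>" "\<And>z. z \<in> \<Omega> \<Longrightarrow> herm_form z > 0"
      "\<And>z. z \<in> \<Omega> \<Longrightarrow> f (proj_point z) = proj_point (F z)" "\<And>z. z \<in> \<Omega> \<Longrightarrow> F z $ j = 1"
      "\<And>z. z \<in> \<Omega> \<Longrightarrow> cdiff F z"
      using local_lift[OF f_holo] by metis
    have pos: "herm_form (F z) > 0" if "z \<in> \<Omega>" for z using f_proj_point_pos F that by blast
    have "herm_form (A *v F z0) > 0" using pos[OF F(2)] A by (simp add: U_pq_herm_form)
    then have "A *v F z0 \<noteq> 0" by auto
    then show "\<exists>F \<Omega>. open \<Omega> \<and> z0 \<in> \<Omega> \<and> F z0 \<noteq> 0 \<and> (\<forall>z\<in>\<Omega>. herm_form z > 0 \<and>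
        induced_map Dpq A (f (proj_point z)) = proj_point (F z) \<and> cdiff F z)"
      using F pos by (intro exI[of _ "\<lambda>z. A *v F z"] exI[of _ \<Omega>])
        (auto simp: induced_map_proj_point intro!: cdiff_compose[OF _ cdiff_matrix])
  qed
  show "proj_holomorphic_on (\<lambda>L. h (induced_map Dpq B L)) Dpq"
  proof (rule proj_holomorphic_on_DpqI)
    fix z0 :: "complex^('p + 'q)" assume z0: "herm_form z0 > 0"
    then have "herm_form (B *v z0) > 0" using A by (simp add: U_pq_herm_form)
    then obtain j F \<Omega> where F: "open \<Omega>" "B *v z0 \<in> \<Omega>" "\<And>z. z \<in> \<Omega> \<Longrightarrow> herm_form z > 0"
      "\<And>z. z \<in> \<Omega> \<Longrightarrow> h (proj_point z) = proj_point (F z)" "\<And>z. z \<in> \<Omega> \<Longrightarrow> F z $ j = 1"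
      "\<And>z. z \<in> \<Omega> \<Longrightarrow> cdiff F z"
      using local_lift[OF h_holo] by metis
    define \<Omega>' where "\<Omega>' = UNIV \<inter> (*v) B -` \<Omega>"
    have "open \<Omega>'" unfolding \<Omega>'_def
      by (intro continuous_open_preimage linear_continuous_on matrix_vector_mul_bounded_linear F open_UNIV)
    moreover have "F (B *v z0) \<noteq> 0" using F(5)[OF F(2)] by auto
    moreover have "herm_form z > 0" if "B *v z \<in> \<Omega>" for z using F(3)[OF that] A by (simp add: U_pq_herm_form)
    ultimately show "\<exists>F \<Omega>. open \<Omega> \<and> z0 \<in> \<Omega> \<and> F z0 \<noteq> 0 \<and> (\<forall>z\<in>\<Omega>. herm_form z > 0 \<and>
        h (induced_map Dpq B (proj_point z)) = proj_point (F z) \<and> cdiff F z)"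
      using F by (intro exI[of _ "\<lambda>z. F (B *v z)"] exI[of _ \<Omega>'])
        (auto simp: \<Omega>'_def induced_map_proj_point intro!: cdiff_compose[OF cdiff_matrix])
  qed
qed (use A in \<open>simp_all add: f_in h_in hf fh induced_map_in_Dpq induced_map_compose induced_map_one\<close>)

text \<open>By transitivity of U(p,q) on positive lines some A moves f[e] back to [e]; the composite
  fixes the centre of the ball, and B undoes A.\<close>

lemma projective_linear_rank_1:
  assumes p: "(UNIV :: 'p set) = {i0}"
  obtains T where "\<And>z. herm_form z > 0 \<Longrightarrow> f (proj_point z) = proj_point (T *v z)"
proof -
  define e :: "complex^('p + 'q)" where "e = axis (Inl i0) 1"
  have he: "herm_form e > 0" using herm_form_rank_1[OF p, of "0 :: complex^('p + 'q)"] by (simp add: e_def)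
  obtain w where w: "f (proj_point e) = proj_point w" "herm_form w > 0"
    using f_in he Dpq_cases proj_point_in_Dpq by metis
  \<comment> \<open>\<open>column_reduction\<close> asks for a representative of square 1.\<close>
  define z where "z = of_real (1 / sqrt (herm_form w)) *s w"
  have z: "proj_point z = proj_point w" unfolding z_def using w(2) by (intro proj_point_scale) simp
  have "herm_form z = 1"
    unfolding z_def herm_form_scale using w(2) by (simp add: norm_divide power_divide)
  then obtain k m :: "complex^('p + 'q)^('p + 'q)"
    where km: "k \<in> K_group" "m \<in> dilation_matrices undefined" "m *v (k *v z) = e"
    by (rule column_reduction[of z "{}" i0 undefined]) (auto simp: e_def)
  define A where "A = m ** k"
  have A: "A \<in> U_pq" unfolding A_def
    using K_group_U_pq[OF km(1)] dilation_matrices_U_pq[OF km(2)] by (rule U_pq_mult[rotated])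
  have Az: "A *v z = e" unfolding A_def using km(3) by (simp add: matrix_vector_mul_assoc)
  obtain B where B: "B \<in> U_pq" "A ** B = mat 1" "B ** A = mat 1" using A by (rule U_pq_inverse)
  interpret g: proj_biholo "\<lambda>L. induced_map Dpq A (f L)" "\<lambda>L. h (induced_map Dpq B L)"
    by (rule proj_biholo_compose[OF A B])
  have "induced_map Dpq A (f (proj_point e)) = proj_point e"
    using w z Az \<open>herm_form z = 1\<close> by (metis induced_map_proj_point zero_less_one)
  then obtain T where T: "\<And>z. herm_form z > 0 \<Longrightarrow> induced_map Dpq A (f (proj_point z)) = proj_point (T *v z)"
    using g.projective_linear_rank_1_fixing[OF p] unfolding e_def by blast
  have "f (proj_point z) = proj_point ((B ** T) *v z)" if "herm_form z > 0" for z
  proof -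
    have L: "f (proj_point z) \<in> Dpq" using that f_in by (simp add: proj_point_in_Dpq)
    have "f (proj_point z) = induced_map Dpq B (induced_map Dpq A (f (proj_point z)))"
      using L A B by (simp add: induced_map_compose induced_map_one)
    also have "\<dots> = induced_map Dpq B (proj_point (T *v z))" using T[OF that] by simp
    also have "\<dots> = proj_point (B *v (T *v z))"
      by (rule induced_map_proj_point)
        (use L T[OF that] induced_map_in_Dpq[OF A] in \<open>metis proj_point_in_Dpq\<close>)
    finally show ?thesis by (simp add: matrix_vector_mul_assoc)
  qed
  then show ?thesis using that by blast
qed

text \<open>Two different indices in 'p exist exactly when p is at least 2. For p = 1 injectivity of
  T is recovered from that of f on the open set of positive vectors.\<close>

lemma projective_linear:
  obtains T where "\<And>z. herm_form z > 0 \<Longrightarrow> f (proj_point z) = proj_point (T *v z)"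
    "\<And>v. T *v v = 0 \<Longrightarrow> v = 0"
proof (cases "\<exists>i1 i2 :: 'p. i1 \<noteq> i2")
  case True
  then show ?thesis using that projective_linear_rank_ge_2 by metis
next
  case False
  then have p: "(UNIV :: 'p set) = {undefined}" by blast
  obtain T where T: "\<And>z. herm_form z > 0 \<Longrightarrow> f (proj_point z) = proj_point (T *v z)"
    using projective_linear_rank_1[OF p] by metis
  define e :: "complex^('p + 'q)" where "e = axis (Inl undefined) 1"
  have he: "herm_form e > 0" using herm_form_rank_1[OF p, of "0 :: complex^('p + 'q)"] by (simp add: e_def)
  have "T *v z \<noteq> 0" if "herm_form z > 0" for z using f_proj_point_pos[OF that T[OF that]] by auto
  then have "f (proj_point z) = proj_point (T *v z) \<and> T *v z \<noteq> 0" if "z \<in> {z. herm_form z > 0}" for z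
    using T that by blast
  note on_pos = this
  have inj: "v = 0" if "T *v v = 0" for v
  proof (rule linear_injective[OF open_herm_form_pos _ _ on_pos that])
    show "e \<in> {z. herm_form z > 0}" using he by simp
  qed simp_all
  show ?thesis by (rule that[OF T inj])
qed

end

text \<open>
  The pulled back form vanishes on the null vectors e_i + \<omega> d_k, e_i + \<omega> e_i' + sqrt 2 d_k and
  d_k + \<omega> d_k' + sqrt 2 e_i with |\<omega>| = 1, which determines its matrix up to a factor.
\<close>

lemma herm_scale_of_null_cone:
  fixes T :: "complex^('p::finite + 'q::finite)^('p + 'q)"
  assumes iff: "\<And>z. herm_form (T *v z) > 0 \<longleftrightarrow> herm_form z > 0"
  obtains c :: real where "c > 0" "\<And>x y. herm (T *v x) (T *v y) = of_real c * herm x y"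
proof -
  define H where "H x y = herm (T *v x) (T *v y)" for x y
  have H: "H x (y + z) = H x y + H x z" "H (x + y) z = H x z + H y z" "H x (c *s y) = c * H x y"
    "H (c *s x) y = cnj c * H x y" "H y x = cnj (H x y)" for x y z c
    by (simp_all add: H_def matrix_vector_right_distrib vector_scalar_commute herm_simps herm_commute[of "T *v y"])
  define e :: "'p \<Rightarrow> complex^('p + 'q)" where "e i = axis (Inl i) 1" for i
  define d :: "'q \<Rightarrow> complex^('p + 'q)" where "d k = axis (Inr k) 1" for k
  have he: "herm (e i) y = y $ Inl i" and hd: "herm (d k) y = - y $ Inr k" for i k y
    by (simp_all add: e_def d_def herm_def cprod_axis_left Hpq_mult_nth)
  have ax: "e i $ Inl i' = (if i' = i then 1 else 0)" "e i $ Inr k = 0"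
    "d k $ Inl i = 0" "d k $ Inr k' = (if k' = k then 1 else 0)" for i i' k k'
    by (simp_all add: e_def d_def axis_def)
  \<comment> \<open>A null vector is a limit of positive ones, so the pulled back form is
    nonnegative on it; positivity is also reflected by T, so it is not positive either.\<close>
  have null: "H z z = 0" if z: "herm z z = 0" for z
  proof -
    define i where "i = (undefined :: 'p)"
    \<comment> \<open>With this sign the term linear in s does not lower the form, and the term
      (\<sigma> s)^2 makes it positive.\<close>
    define \<sigma> :: real where "\<sigma> = (if Re (herm z (e i)) \<ge> 0 then 1 else - 1)"
    have pos: "herm_form (z + of_real (\<sigma> * s) *s e i) > 0" if "s > 0" for s
    proof -
      have "herm_form (z + of_real (\<sigma> * s) *s e i) = 2 * s * (\<sigma> * Re (herm z (e i))) + (\<sigma> * s)\<^sup>2"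
        unfolding herm_form_eq
        by (simp add: herm_simps z he ax herm_commute[of "e i" z] power2_eq_square algebra_simps)
          (simp add: he herm_commute[of z "e i"])
      moreover have "\<sigma> * Re (herm z (e i)) \<ge> 0" "\<sigma> * s \<noteq> 0" using that by (auto simp: \<sigma>_def)
      ultimately show ?thesis using that by (simp add: add_nonneg_pos)
    qed
    have "(\<lambda>n. herm_form (T *v (z + of_real (\<sigma> * (1 / real (Suc n))) *s e i)))
        \<longlonglongrightarrow> herm_form (T *v (z + of_real (\<sigma> * 0) *s e i))"
    proof -
      have "continuous_on UNIV (\<lambda>s. herm_form (T *v (z + of_real (\<sigma> * s) *s e i)))"
        by (intro continuous_intros linear_continuous_on_compose[OF _ matrix_vector_mul_linear])
      moreover have "(\<lambda>n. 1 / real (Suc n)) \<longlonglongrightarrow> 0" by (rule LIMSEQ_Suc[OF lim_1_over_n])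
      ultimately show ?thesis by (rule continuous_on_tendsto_compose) auto
    qed
    then have "herm_form (T *v (z + of_real (\<sigma> * 0) *s e i)) \<ge> 0"
    proof (rule LIMSEQ_le_const)
      have "0 < herm_form (z + of_real (\<sigma> * (1 / real (Suc n))) *s e i)" for n by (rule pos) simp
      then have "0 \<le> herm_form (T *v (z + of_real (\<sigma> * (1 / real (Suc n))) *s e i))" for n
        by (intro less_imp_le) (simp only: iff)
      then show "\<exists>N. \<forall>n\<ge>N. 0 \<le> herm_form (T *v (z + of_real (\<sigma> * (1 / real (Suc n))) *s e i))" by blast
    qed
    moreover have "\<not> herm_form (T *v z) > 0" using iff z by (simp add: herm_form_eq)
    ultimately have "herm_form (T *v z) = 0" by simp
    then show ?thesis by (simp add: H_def herm_self)
  qed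
  \<comment> \<open>The values 1, -1, \<i>, -\<i> of \<omega> separate a from the real and imaginary
    parts of b.\<close>
  have quad: "b = 0 \<and> a = 0" if "\<And>\<omega>. cmod \<omega> = 1 \<Longrightarrow> a + \<omega> * b + cnj \<omega> * cnj b = 0" for a b
  proof -
    have "a + b + cnj b = 0" "a - b - cnj b = 0" "a + \<i> * b - \<i> * cnj b = 0" "a - \<i> * b + \<i> * cnj b = 0"
      using that[of 1] that[of "- 1"] that[of \<i>] that[of "- \<i>"] by simp_all
    then show ?thesis by (simp add: complex_eq_iff)
  qed
  have ed: "H (e i) (d k) = 0 \<and> H (e i) (e i) + H (d k) (d k) = 0" for i k
  proof (rule quad)
    fix \<omega> :: complex assume w: "cmod \<omega> = 1"
    have ww: "\<omega> * cnj \<omega> = 1" using w complex_norm_square[of \<omega>] by simp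
    have "herm (e i + \<omega> *s d k) (e i + \<omega> *s d k) = 0"
      using ww by (simp add: herm_simps he hd ax mult.commute)
    then have "H (e i + \<omega> *s d k) (e i + \<omega> *s d k) = 0" by (rule null)
    moreover have ww': "\<omega> * (cnj \<omega> * x) = x" for x using ww by (metis mult.assoc mult_1)
    ultimately show "H (e i) (e i) + H (d k) (d k) + \<omega> * H (e i) (d k) + cnj \<omega> * cnj (H (e i) (d k)) = 0"
      by (simp add: H(1-4) H(5)[of "d k" "e i"] ww' algebra_simps)
  qed
  define c where "c = Re (H (e undefined) (e undefined))"
  have c0: "c > 0"
  proof -
    have "herm_form (e undefined) > 0" by (simp add: herm_form_eq he ax)
    then show ?thesis using iff by (simp add: c_def H_def herm_form_eq)
  qed
  have cu: "H (e undefined) (e undefined) = of_real c"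
    by (simp add: c_def H_def herm_self)
  have dd: "H (d k) (d k) = - of_real c" for k
    using ed[of undefined k] cu by (metis add_eq_0_iff)
  have ee: "H (e i) (e i) = of_real c" for i
    using ed[of i undefined] dd[of undefined] by simp
  define r where "r = complex_of_real (sqrt 2)"
  have r: "r * r = 2" "cnj r = r" by (simp_all add: r_def flip: of_real_mult)
  have de: "H (d k) (e i) = 0" for k i using ed[of i k] H(5)[of "e i" "d k"] by simp
  \<comment> \<open>One computation for two positive or two negative basis vectors, with s = 1 or -1
    and z of the opposite sign. The factor sqrt 2 balances the squares of x and \<omega> y, in the
    form and in its pull-back, so only the products of x and y survive.\<close>
  have off: "H x y = 0"
    if x: "H x x = s * of_real c" "H y y = s * of_real c" "H z z = - s * of_real c"
      "H x z = 0" "H y z = 0" "herm x x = s" "herm y y = s" "herm z z = - s" "herm x y = 0"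
      "herm x z = 0" "herm y z = 0" for x y z and s :: complex
  proof -
    have sym: "H z x = 0" "H z y = 0" "herm y x = 0" "herm z x = 0" "herm z y = 0"
      using x H(5)[of z x] H(5)[of z y] herm_commute[of y x] herm_commute[of z x] herm_commute[of z y] by simp_all
    have "H x y = 0 \<and> (0::complex) = 0"
    proof (rule quad)
      fix \<omega> :: complex assume w: "cmod \<omega> = 1"
      have ww: "\<omega> * cnj \<omega> = 1" using w complex_norm_square[of \<omega>] by simp
      then have ww': "\<omega> * (u * (cnj \<omega> * v)) = u * v" for u v
        by (metis mult.assoc mult.left_commute mult_1)
      have rr: "r * (r * u) = 2 * u" for u using r(1) by (metis mult.assoc)
      have "herm (x + \<omega> *s y + r *s z) (x + \<omega> *s y + r *s z) = 0"
        by (simp add: herm_simps x sym r(2) ww ww' rr algebra_simps)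
      then have "H (x + \<omega> *s y + r *s z) (x + \<omega> *s y + r *s z) = 0" by (rule null)
      then show "0 + \<omega> * H x y + cnj \<omega> * cnj (H x y) = 0"
        by (simp add: H(1-4) x sym H(5)[of y x] r(2) ww ww' rr algebra_simps)
    qed
    then show ?thesis by simp
  qed
  have ee': "H (e i) (e i') = 0" if "i \<noteq> i'" for i i'
    by (rule off[where s = 1 and z = "d undefined"]) (use that in \<open>auto simp: ee dd ed he hd ax\<close>)
  have dd': "H (d k) (d k') = 0" if "k \<noteq> k'" for k k'
    by (rule off[where s = "- 1" and z = "e undefined"]) (use that in \<open>auto simp: ee dd de he hd ax\<close>)
  have entries: "H (axis r 1) (axis s 1) = of_real c * herm (axis r 1) (axis s 1)" for r s
    by (cases r; cases s)
      (auto simp: e_def[symmetric] d_def[symmetric] he hd ax ee dd ed de ee' dd')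
  define M where "M = hermitian_transpose T ** Hpq ** T"
  have HM: "H x y = cprod x (M *v y)" for x y
    by (simp add: H_def herm_def cprod_adjoint M_def matrix_vector_mul_assoc matrix_mul_assoc)
  have "(M *v axis s 1) $ r = (of_real c *s (Hpq *v axis s 1)) $ r" for r s
    using entries[of r s] by (simp add: HM herm_def cprod_axis_left)
  then have col: "M *v axis s 1 = of_real c *s (Hpq *v axis s 1)" for s by (simp add: vec_eq_iff)
  have "M $ r $ s = of_real c * Hpq $ r $ s" for r s
  proof -
    have "(A *v axis s 1) $ r = A $ r $ s" for A :: "complex^('p + 'q)^('p + 'q)"
      by (simp add: matrix_vector_mult_def axis_def if_distrib cong: if_cong)
    then show ?thesis using arg_cong[OF col[of s], of "\<lambda>v. v $ r"] by simp
  qed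
  then have "M *v y = of_real c *s (Hpq *v y)" for y
    by (simp add: vec_eq_iff matrix_vector_mult_def sum_distrib_left mult.assoc)
  then have "H x y = of_real c * herm x y" for x y
    by (simp add: HM herm_def cprod_scale_right)
  then show ?thesis using that[OF c0] by (simp add: H_def)
qed

text \<open>A linear T with f = [T] preserves and reflects positivity, so it multiplies the form by
  some c > 0; dividing T by the square root of c leads into U(p,q) without changing the induced
  map.\<close>

theorem biholomorphic_auts_Dpq:
  "biholomorphic_auts (Dpq :: (complex^('p::finite + 'q::finite)) set set) = induced_map Dpq ` U_pq"
proof (intro subset_antisym subsetI)
  fix f :: "(complex^('p + 'q)) set \<Rightarrow> (complex^('p + 'q)) set"
  assume "f \<in> biholomorphic_auts Dpq"
  then have f: "f \<in> extensional Dpq" "bij_betw f Dpq Dpq" "proj_holomorphic_on f Dpq"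
    "proj_holomorphic_on (restrict (inv_into Dpq f) Dpq) Dpq"
    by (auto simp: biholomorphic_auts_def Bij_def)
  interpret proj_biholo f "restrict (inv_into Dpq f) Dpq"
    using f bij_betw_inv_into[OF f(2)]
    by unfold_locales (auto simp: bij_betw_def inv_into_f_f f_inv_into_f)
  obtain T where T: "\<And>z. herm_form z > 0 \<Longrightarrow> f (proj_point z) = proj_point (T *v z)"
    "\<And>v. T *v v = 0 \<Longrightarrow> v = 0"
    using projective_linear by metis
  have "herm_form (T *v z) > 0 \<longleftrightarrow> herm_form z > 0" for z
  proof
    \<comment> \<open>Surjectivity of f gives a positive w with [T w] = [T z], and injectivity of T
      makes z a multiple of w.\<close>
    assume "herm_form (T *v z) > 0"
    then have L: "proj_point (T *v z) \<in> Dpq" by (simp add: proj_point_in_Dpq)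
    then obtain w where w: "restrict (inv_into Dpq f) Dpq (proj_point (T *v z)) = proj_point w" "herm_form w > 0" "w \<noteq> 0"
      using h_in Dpq_cases by metis
    then have "proj_point (T *v z) = proj_point (T *v w)" using fh[OF L] T(1)[OF w(2)] by simp
    moreover have "T *v w \<noteq> 0" using T(2) w(3) by blast
    ultimately obtain c where c: "c \<noteq> 0" "T *v z = c *s (T *v w)" using proj_point_eq_iff by metis
    then have "T *v (z - c *s w) = 0" by (simp add: matrix_vector_mult_diff_distrib vector_scalar_commute)
    then have "z = c *s w" using T(2) by fastforce
    then show "herm_form z > 0" using w(2) c(1) by (simp add: herm_form_scale)
  next
    assume "herm_form z > 0"
    then show "herm_form (T *v z) > 0" using f_proj_point_pos T(1) by blast
  qed
  then obtain c where c: "c > 0" "\<And>x y. herm (T *v x) (T *v y) = of_real c * herm x y"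
    using herm_scale_of_null_cone by metis
  define s where "s = complex_of_real (1 / sqrt c)"
  have s: "s \<noteq> 0" "cnj s = s" "s * s * of_real c = 1"
    using c(1) by (auto simp: s_def simp flip: of_real_mult)
  obtain A where A: "\<And>x. A *v x = s *s (T *v x)"
    by (rule complex_linear_matrix[of "\<lambda>x. s *s (T *v x)"])
      (auto simp: matrix_vector_right_distrib vector_scalar_commute vec_eq_iff algebra_simps)
  have "herm (A *v x) (A *v y) = herm x y" for x y
  proof -
    have "herm (A *v x) (A *v y) = (s * s * of_real c) * herm x y"
      by (simp add: A herm_simps s(2) c(2))
    then show ?thesis by (simp add: s(3))
  qed
  then have "A \<in> U_pq" by (simp add: U_pq_iff)
  moreover have "f = induced_map Dpq A"
  proof
    fix L
    show "f L = induced_map Dpq A L"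
    proof (cases "L \<in> Dpq")
      case True
      then show ?thesis
        by (rule Dpq_cases) (simp add: induced_map_proj_point T(1) A proj_point_scale s(1))
    next
      case False
      then show ?thesis using f(1) by (simp add: induced_map_def extensional_def)
    qed
  qed
  ultimately show "f \<in> induced_map Dpq ` U_pq" by blast
qed (auto simp: induced_map_in_auts)

section \<open>The automorphism group as a quotient of U(p,q), and its generators\<close>

lemma carrier_Aut_group_Dpq: "carrier (Aut_group Dpq) = induced_map Dpq ` U_pq"
  by (simp add: Aut_group_def biholomorphic_auts_Dpq)

text \<open>Closure and inverses are read off from matrices, which the linear description of all
  automorphisms makes possible.\<close>

lemma group_Aut_group_Dpq: "group (Aut_group Dpq)"
proof (rule groupI)
  show "\<exists>y\<in>carrier (Aut_group Dpq). y \<otimes>\<^bsub>Aut_group Dpq\<^esub> x = \<one>\<^bsub>Aut_group Dpq\<^esub>"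
    if x: "x \<in> carrier (Aut_group Dpq)" for x
  proof -
    obtain A where A: "A \<in> U_pq" "x = induced_map Dpq A" using x by (auto simp: carrier_Aut_group_Dpq)
    obtain B where B: "B \<in> U_pq" "A ** B = mat 1" "B ** A = mat 1" using A(1) by (rule U_pq_inverse)
    then show ?thesis using A
      by (intro bexI[of _ "induced_map Dpq B"]) (auto simp: mult_induced_map one_Aut_group carrier_Aut_group_Dpq)
  qed
qed (auto simp: carrier_Aut_group_Dpq mult_induced_map one_Aut_group U_pq_mult U_pq_one matrix_mul_assoc)

theorem theorem3p12:
  fixes l :: "'q::finite"
  defines "G \<equiv> Aut_group (Dpq :: (complex^('p::finite + 'q)) set set)"
  shows "generate G (UpxUq_auts \<union> dilations l) = carrier G \<and>
    (\<forall>g \<in> carrier G. \<exists>U M.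
       (\<forall>i \<in> {1..CARD('p) + 1}. U i \<in> subspace_auts) \<and>
       (\<forall>i \<in> {1..CARD('p)}. M i \<in> dilations l) \<and>
       g = alternating_word G U M (CARD('p)))"
proof (intro conjI ballI)
  interpret group G unfolding G_def by (rule group_Aut_group_Dpq)
  have gens: "UpxUq_auts \<union> dilations l \<subseteq> carrier G"
    using K_group_U_pq dilation_matrices_U_pq[of _ l]
    by (auto simp: G_def carrier_Aut_group_Dpq UpxUq_auts_eq dilations_eq)
  \<comment> \<open>Induction on the number of dilations; each layer multiplies by two
    generators.\<close>
  have word: "induced_map Dpq w \<in> generate G (UpxUq_auts \<union> dilations l)" if "w \<in> word_matrices l n"
    for w :: "complex^('p + 'q)^('p + 'q)" and n
    using that
  proof (induction n arbitrary: w)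
    case 0
    then show ?case by (auto simp: UpxUq_auts_eq intro!: generate.incl)
  next
    case (Suc n)
    then obtain k m v where w: "w = k ** (m ** v)" "k \<in> K_group" "m \<in> dilation_matrices l" "v \<in> word_matrices l n"
      by auto
    have mem: "v \<in> U_pq" "m \<in> U_pq" "k \<in> U_pq"
      using w K_group_U_pq dilation_matrices_U_pq word_matrices_U_pq by blast+
    have "induced_map Dpq w = induced_map Dpq k \<otimes>\<^bsub>G\<^esub> (induced_map Dpq m \<otimes>\<^bsub>G\<^esub> induced_map Dpq v)"
      by (simp add: G_def mult_induced_map mem U_pq_mult w(1))
    moreover have "induced_map Dpq k \<in> UpxUq_auts \<union> dilations l" "induced_map Dpq m \<in> UpxUq_auts \<union> dilations l"
      using w(2,3) by (simp_all add: UpxUq_auts_eq dilations_eq)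
    ultimately show ?case
      using Suc.IH[OF w(4)] by (simp only: generate.eng generate.incl)
  qed
  show "generate G (UpxUq_auts \<union> dilations l) = carrier G"
  proof
    show "generate G (UpxUq_auts \<union> dilations l) \<subseteq> carrier G" by (rule generate_incl[OF gens])
    show "carrier G \<subseteq> generate G (UpxUq_auts \<union> dilations l)"
      using word[OF U_pq_word_matrices] by (auto simp: G_def carrier_Aut_group_Dpq)
  qed
  fix g assume "g \<in> carrier G"
  then obtain A where A: "A \<in> U_pq" "g = induced_map Dpq A" by (auto simp: G_def carrier_Aut_group_Dpq)
  show "\<exists>U M. (\<forall>i \<in> {1..CARD('p) + 1}. U i \<in> subspace_auts) \<and>
      (\<forall>i \<in> {1..CARD('p)}. M i \<in> dilations l) \<and> g = alternating_word G U M (CARD('p))"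
  proof -
    obtain U M where UM: "\<forall>i \<in> {1..CARD('p) + 1}. U i \<in> induced_map Dpq ` K_group"
      "\<forall>i \<in> {1..CARD('p)}. M i \<in> dilations l"
      "induced_map Dpq A = alternating_word (Aut_group Dpq) U M CARD('p)"
      using word_matrices_alternating_word[OF U_pq_word_matrices[OF A(1), of l]] by (elim exE conjE)
    have "\<forall>i \<in> {1..CARD('p) + 1}. U i \<in> subspace_auts"
    proof
      fix i assume "i \<in> {1..CARD('p) + 1}"
      then obtain k where "U i = induced_map Dpq k" "k \<in> K_group" using UM(1) by blast
      then show "U i \<in> subspace_auts" using K_group_subspace_auts[of k] by simp
    qed
    then show ?thesis
      unfolding A(2) G_def using UM(2,3) by (intro exI[of _ U] exI[of _ M] conjI)
  qed
qed

end
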